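(* Let $\mathbb{F}$ be a field. The persistence module $PH_0(\hat{\mathcal{H}}^2_{-,-};\mathbb{F})$ associated with the second configuration spaces of the metric H-graph is interval decomposable. Its indecomposable direct summands are, up to isomorphism and with multiplicity, the interval modules supported on the following subsets of the parameter poset: $\{(r,L)\mid r\le L+2\}$ (multiplicity $1$); $\{(r,L)\mid 1<r\le L+2\}$ (multiplicity $1$); $\{(r,L)\mid 1<r\le 2\}$ (multiplicity $4$); $\{(r,L)\mid L+1<r\le L+2\}$ (multiplicity $6$).
   Context: Metric graph and configuration spaces: the H-graph $H$ is the geometric realization of the tree with two vertices $u,v$ of degree $3$ joined by an edge $e_1$ (the bridge), with two further edges from $u$ to leaves and two further edges from $v$ to leaves. For $L>0$ let $\delta_L$ be the path metric on $H$ in which $e_1$ has length $L=L_{e_1}$ and all other edges have length $1$ (each edge is a fixed copy of $[0,1]$, rescaled linearly to its length). For $r>0$, $\hat{\mathcal{H}}^2_{r,L}=\{(x,y)\in H\times H\mid \delta_L(x,y)\ge r\}$. Poset and persistence module: let $P=(\mathbb{R}_{>0},\le)^{\mathrm{op}}\times(\mathbb{R}_{>0},\le)$, i.e. pairs $(r,L)$ of positive reals with $(r,L)\le (r',L')$ iff $r'\le r$ and $L\le L'$; then $\hat{\mathcal{H}}^2_{r,L}\subseteq \hat{\mathcal{H}}^2_{r',L'}$. A persistence module over $P$ is a functor $P\to \mathrm{Vect}_{\mathbb{F}}$. $PH_0(\hat{\mathcal{H}}^2_{-,-};\mathbb{F})$ is $(r,L)\mapsto H_0(\hat{\mathcal{H}}^2_{r,L};\mathbb{F})$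 with maps induced by inclusions. Interval modules: $I\subseteq P$ is an interval if it is connected (as a poset) and convex ($a\le b\le c$, $a,c\in I$ imply $b\in I$); the interval module supported on $I$ is $\mathbb{F}$ on $I$ and $0$ elsewhere, with identity maps within $I$ and zero maps otherwise. A module is interval decomposable if it is isomorphic to a direct sum of interval modules. *)

theory Defs
  imports "HOL-Homology.Homology"
begin

section \<open>The metric H-graph and its second configuration spaces\<close>

datatype hvertex = Hu | Hv | Hu1 | Hu2 | Hv1 | Hv2

instance hvertex :: finite
proof
  have "(UNIV :: hvertex set) = {Hu, Hv, Hu1, Hu2, Hv1, Hv2}"
    using hvertex.exhaust by auto
  then show "finite (UNIV :: hvertex set)"
    by (metis finite.emptyI finite_insert)
qed

text \<open>Every edge is listed once; the orientation only fixes its parametrisation by $[0,1]$.\<close>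

definition hbridge :: "hvertex \<times> hvertex" where
  "hbridge = (Hu, Hv)"

definition hedges :: "(hvertex \<times> hvertex) set" where
  "hedges = {hbridge, (Hu, Hu1), (Hu, Hu2), (Hv, Hv1), (Hv, Hv2)}"

text \<open>The geometric realization, in barycentric coordinates: vertices are the standard basis
  vectors, edges the segments between them, and the topology is that of the ambient Euclidean space.\<close>

type_synonym hpoint = "real ^ hvertex"

definition edge_point :: "hvertex \<times> hvertex \<Rightarrow> real \<Rightarrow> hpoint" where
  "edge_point e t = (1 - t) *\<^sub>R axis (fst e) 1 + t *\<^sub>R axis (snd e) 1"

definition hgraph :: "hpoint set" where
  "hgraph = (\<Union>e\<in>hedges. edge_point e ` {0..1})"

definition edge_length :: "real \<Rightarrow> hvertex \<times> hvertex \<Rightarrow> real" where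
  "edge_length L e = (if e = hbridge then L else 1)"

text \<open>\<open>hpath L x y l\<close>: some path from \<open>x\<close> to \<open>y\<close> composed of finitely many linear pieces, each inside
  one edge, has length \<open>l\<close>.\<close>

inductive hpath :: "real \<Rightarrow> hpoint \<Rightarrow> hpoint \<Rightarrow> real \<Rightarrow> bool" for L :: real where
  refl: "x \<in> hgraph \<Longrightarrow> hpath L x x 0"
| step: "\<lbrakk>hpath L x (edge_point e s) l; e \<in> hedges; s \<in> {0..1}; t \<in> {0..1}\<rbrakk>
    \<Longrightarrow> hpath L x (edge_point e t) (l + edge_length L e * \<bar>s - t\<bar>)"

definition hdist :: "real \<Rightarrow> hpoint \<Rightarrow> hpoint \<Rightarrow> real" where
  "hdist L x y = Inf {l. hpath L x y l}"

definition hconf :: "real \<Rightarrow> real \<Rightarrow> (hpoint \<times> hpoint) set" where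
  "hconf r L = {(x, y). x \<in> hgraph \<and> y \<in> hgraph \<and> hdist L x y \<ge> r}"


section \<open>Vector spaces over a field given as a type\<close>

definition field_ring :: "'f::field ring" where
  "field_ring = \<lparr>carrier = UNIV, mult = (*), one = 1, zero = 0, add = (+)\<rparr>"

text \<open>The record for modules extends the one for rings; its fields \<open>mult\<close> and \<open>one\<close> are not
  constrained by the locale for modules and are left undefined below.\<close>

definition vec_space :: "('f::field, 'v) module \<Rightarrow> bool" where
  "vec_space V \<longleftrightarrow> module field_ring V"

definition linear_maps :: "('f::field, 'v) module \<Rightarrow> ('f, 'w) module \<Rightarrow> ('v \<Rightarrow> 'w) set" where
  "linear_maps V W = {f \<in> carrier V \<rightarrow> carrier W.
     (\<forall>x\<in>carrier V. \<forall>y\<in>carrier V. f (x \<oplus>\<^bsub>V\<^esub> y) = f x \<oplus>\<^bsub>W\<^esub> f y) \<and>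
     (\<forall>k. \<forall>x\<in>carrier V. f (k \<odot>\<^bsub>V\<^esub> x) = k \<odot>\<^bsub>W\<^esub> f x)}"


section \<open>Singular homology with coefficients in a field\<close>

type_synonym ('a, 'f) fchain = "((nat \<Rightarrow> real) \<Rightarrow> 'a) \<Rightarrow>\<^sub>0 'f"

definition fchains :: "nat \<Rightarrow> 'a topology \<Rightarrow> ('a, 'f::field) fchain set" where
  "fchains p X = {c. Poly_Mapping.keys c \<subseteq> singular_simplex_set p X}"

definition fboundary :: "nat \<Rightarrow> ('a, 'f::field) fchain \<Rightarrow> ('a, 'f) fchain" where
  "fboundary p c = (if p = 0 then 0 else
     (\<Sum>s\<in>Poly_Mapping.keys c. \<Sum>k\<le>p.
        Poly_Mapping.single (singular_face p k s) ((-1) ^ k * Poly_Mapping.lookup c s)))"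

definition fcycles :: "nat \<Rightarrow> 'a topology \<Rightarrow> ('a, 'f::field) fchain set" where
  "fcycles p X = {c \<in> fchains p X. fboundary p c = 0}"

definition fboundaries :: "nat \<Rightarrow> 'a topology \<Rightarrow> ('a, 'f::field) fchain set" where
  "fboundaries p X = fboundary (Suc p) ` fchains (Suc p) X"

definition fscale :: "'f::field \<Rightarrow> ('a, 'f) fchain \<Rightarrow> ('a, 'f) fchain" where
  "fscale k c = Poly_Mapping.map ((*) k) c"

text \<open>Homology classes are cosets of the space of boundaries.\<close>

definition fclass :: "nat \<Rightarrow> 'a topology \<Rightarrow> ('a, 'f::field) fchain \<Rightarrow> ('a, 'f) fchain set" where
  "fclass p X c = {c + b | b. b \<in> fboundaries p X}"

definition fhomology :: "nat \<Rightarrow> 'a topology \<Rightarrow> ('f::field, ('a, 'f) fchain set) module" where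
  "fhomology p X =
    \<lparr>carrier = fclass p X ` fcycles p X,
     mult = undefined, one = undefined,
     zero = fclass p X 0,
     add = (\<lambda>A B. \<Union>a\<in>A. \<Union>b\<in>B. fclass p X (a + b)),
     smult = (\<lambda>k A. \<Union>a\<in>A. fclass p X (fscale k a))\<rparr>"

definition fchain_map :: "nat \<Rightarrow> ('a \<Rightarrow> 'b) \<Rightarrow> ('a, 'f::field) fchain \<Rightarrow> ('b, 'f) fchain" where
  "fchain_map p g c =
    (\<Sum>s\<in>Poly_Mapping.keys c. Poly_Mapping.single (simplex_map p g s) (Poly_Mapping.lookup c s))"

definition fhom_induced ::
    "nat \<Rightarrow> 'b topology \<Rightarrow> ('a \<Rightarrow> 'b) \<Rightarrow> ('a, 'f::field) fchain set \<Rightarrow> ('b, 'f) fchain set" where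
  "fhom_induced p Y g A = (\<Union>a\<in>A. fclass p Y (fchain_map p g a))"


section \<open>Persistence modules over the parameter poset\<close>

type_synonym param = "real \<times> real"

definition params :: "param set" where
  "params = {(r, L). r > 0 \<and> L > 0}"

definition param_le :: "param \<Rightarrow> param \<Rightarrow> bool" (infix \<open>\<preceq>\<close> 50) where
  "p \<preceq> q \<longleftrightarrow> fst q \<le> fst p \<and> snd p \<le> snd q"

record ('f, 'v) pmod =
  obj :: "param \<Rightarrow> ('f, 'v) module"
  mor :: "param \<Rightarrow> param \<Rightarrow> 'v \<Rightarrow> 'v"

definition persistence_module :: "('f::field, 'v) pmod \<Rightarrow> bool" where
  "persistence_module M \<longleftrightarrow>
     (\<forall>p\<in>params. vec_space (obj M p)) \<and>
     (\<forall>p\<in>params. \<forall>q\<in>params. p \<preceq> q \<longrightarrow> mor M p q \<in> linear_maps (obj M p) (obj M q)) \<and>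
     (\<forall>p\<in>params. \<forall>x\<in>carrier (obj M p). mor M p p x = x) \<and>
     (\<forall>p\<in>params. \<forall>q\<in>params. \<forall>s\<in>params. p \<preceq> q \<and> q \<preceq> s \<longrightarrow>
        (\<forall>x\<in>carrier (obj M p). mor M p s x = mor M q s (mor M p q x)))"

definition pmod_iso :: "('f::field, 'v) pmod \<Rightarrow> ('f, 'w) pmod \<Rightarrow> bool" (infix \<open>\<simeq>\<^sub>P\<close> 50) where
  "M \<simeq>\<^sub>P N \<longleftrightarrow> (\<exists>\<phi>.
     (\<forall>p\<in>params. \<phi> p \<in> linear_maps (obj M p) (obj N p) \<and>
        bij_betw (\<phi> p) (carrier (obj M p)) (carrier (obj N p))) \<and>
     (\<forall>p\<in>params. \<forall>q\<in>params. p \<preceq> q \<longrightarrow>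
        (\<forall>x\<in>carrier (obj M p). \<phi> q (mor M p q x) = mor N p q (\<phi> p x))))"

definition pmod_zero :: "('f::field, 'v) pmod \<Rightarrow> bool" where
  "pmod_zero M \<longleftrightarrow> (\<forall>p\<in>params. carrier (obj M p) = {\<zero>\<^bsub>obj M p\<^esub>})"

definition direct_sum :: "'j set \<Rightarrow> ('j \<Rightarrow> ('f::field, 'v) pmod) \<Rightarrow> ('f, 'j \<Rightarrow> 'v) pmod" where
  "direct_sum J N =
    \<lparr>obj = (\<lambda>p.
       \<lparr>carrier = {x \<in> \<Pi>\<^sub>E j\<in>J. carrier (obj (N j) p). finite {j \<in> J. x j \<noteq> \<zero>\<^bsub>obj (N j) p\<^esub>}},
        mult = undefined, one = undefined,
        zero = (\<lambda>j\<in>J. \<zero>\<^bsub>obj (N j) p\<^esub>),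
        add = (\<lambda>x y. \<lambda>j\<in>J. x j \<oplus>\<^bsub>obj (N j) p\<^esub> y j),
        smult = (\<lambda>k x. \<lambda>j\<in>J. k \<odot>\<^bsub>obj (N j) p\<^esub> x j)\<rparr>),
     mor = (\<lambda>p q x. \<lambda>j\<in>J. mor (N j) p q (x j))\<rparr>"

text \<open>It suffices to let the summands range over modules with the same type of vectors as \<open>M\<close>,
  since direct summands of \<open>M\<close> are isomorphic to submodules of \<open>M\<close>.\<close>

definition indecomposable :: "('f::field, 'v) pmod \<Rightarrow> bool" where
  "indecomposable M \<longleftrightarrow> persistence_module M \<and> \<not> pmod_zero M \<and>
     (\<forall>A B :: ('f, 'v) pmod. persistence_module A \<and> persistence_module B \<and>
        M \<simeq>\<^sub>P direct_sum (UNIV :: bool set) (\<lambda>i. if i then A else B) \<longrightarrow>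
        pmod_zero A \<or> pmod_zero B)"

definition poset_connected :: "param set \<Rightarrow> bool" where
  "poset_connected I \<longleftrightarrow> I \<noteq> {} \<and>
     (\<forall>a\<in>I. \<forall>b\<in>I. (\<lambda>x y. x \<in> I \<and> y \<in> I \<and> (x \<preceq> y \<or> y \<preceq> x))\<^sup>*\<^sup>* a b)"

definition poset_convex :: "param set \<Rightarrow> bool" where
  "poset_convex I \<longleftrightarrow> (\<forall>a\<in>I. \<forall>c\<in>I. \<forall>b\<in>params. a \<preceq> b \<and> b \<preceq> c \<longrightarrow> b \<in> I)"

definition poset_interval :: "param set \<Rightarrow> bool" where
  "poset_interval I \<longleftrightarrow> I \<subseteq> params \<and> poset_connected I \<and> poset_convex I"

definition interval_module :: "param set \<Rightarrow> ('f::field, 'f) pmod" where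
  "interval_module I =
    \<lparr>obj = (\<lambda>p. \<lparr>carrier = (if p \<in> I then UNIV else {0}),
                  mult = undefined, one = undefined, zero = 0, add = (+), smult = (*)\<rparr>),
     mor = (\<lambda>p q x. if p \<in> I \<and> q \<in> I then x else 0)\<rparr>"

text \<open>No generality is lost by drawing the indices from \<open>param \<times> 'v\<close>: each interval is nonempty, so
  the summands inject into this type through a point of the interval and a nonzero vector there.\<close>

definition interval_decomposable :: "('f::field, 'v) pmod \<Rightarrow> bool" where
  "interval_decomposable M \<longleftrightarrow> persistence_module M \<and>
     (\<exists>(J :: (param \<times> 'v) set) S. (\<forall>j\<in>J. poset_interval (S j)) \<and>
        M \<simeq>\<^sub>P direct_sum J (\<lambda>j. interval_module (S j)))"


section \<open>Persistent homology of the configuration spaces\<close>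

definition PH :: "nat \<Rightarrow> ('f::field, (hpoint \<times> hpoint, 'f) fchain set) pmod" where
  "PH n =
    \<lparr>obj = (\<lambda>(r, L). fhomology n (top_of_set (hconf r L))),
     mor = (\<lambda>(r, L) (r', L'). fhom_induced n (top_of_set (hconf r' L')) (\<lambda>z. z))\<rparr>"

definition summand_supports :: "param set list" where
  "summand_supports =
     replicate 1 {(r, L) \<in> params. r \<le> L + 2} @
     replicate 1 {(r, L) \<in> params. 1 < r \<and> r \<le> L + 2} @
     replicate 4 {(r, L) \<in> params. 1 < r \<and> r \<le> 2} @
     replicate 6 {(r, L) \<in> params. L + 1 < r \<and> r \<le> L + 2}"

end

theory Submission
  imports Defs
begin

text \<open>
  The bridge coordinate and the four leaf coordinates embed the H-graph isometrically into a weighted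
  \<open>l\<^sup>1\<close> space, so the distance is explicit. Pushing both points outwards connects every configuration
  to one of the 12 ordered pairs of distinct leaves, and the pairs are separated by 12 weights: the
  constant one, the order of the two points along the bridge, and for each remaining pair \<open>(a, b)\<close> the
  condition \<open>x $ a + y $ b > 1\<close>. The \<open>k\<close>-th weight is locally constant on the \<open>k\<close>-th support,
  where the quantity defining it skips an interval of values. On leaf pairs the matrix of weights is
  unitriangular, so the weights identify \<open>H\<^sub>0\<close> with the sum of the interval modules.

  For uniqueness, a summand \<open>N\<close> gives an idempotent endomorphism of the interval sum, and a nonzero map
  between two different supports strictly raises a level. Were all matrix entries between equal supports
  zero, the idempotent would be nilpotent; hence some interval module factors through \<open>N\<close>, and \<open>N\<close> is
  isomorphic to it. Multiplicities follow by comparing dimensions at four parameters.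
\<close>

section \<open>Geometry of the configuration spaces\<close>

text \<open>Components merge as \<open>r\<close> falls or \<open>L\<close> grows, so the basis of
  \<open>H_0\<close> given by components does not split into intervals. The weights avoid this: they
  do not mention \<open>r\<close> and \<open>L\<close>, hence an inclusion keeps their values and
  the comparison with the interval sum is diagonal. Two cases remain. If a support is left, the
  target coordinate is zero. If it is entered between \<open>p\<close> and \<open>q\<close>, the
  weight must vanish on the smaller space: the lower bounds on \<open>r\<close> pass from
  \<open>q\<close> back to \<open>p\<close>, and the upper bounds follow from the existence of a
  configuration with that weight. The constants are distances: \<open>1\<close> from a branch vertex
  to a leaf next to it, \<open>L + 1\<close> from a branch vertex to a leaf across the bridge,
  \<open>2\<close> and \<open>L + 2\<close> between leaves. A point changes its leaf only by passing
  a branch vertex, which is why merging happens at \<open>1\<close> and \<open>L + 1\<close>. In the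
  uniqueness part the index set of a decomposition is arbitrary, so its finiteness has to be derived
  too, from the same dimension bound that gives the multiplicities.\<close>

definition bridge_coord :: "hpoint \<Rightarrow> real" where
  "bridge_coord x = x $ Hv + x $ Hv1 + x $ Hv2"

text \<open>\<open>bridge_coord\<close> is the barycentric mass on the side of \<open>Hv\<close>,
  that is, the position of the projection of a point to the bridge. A leaf coordinate is the
  distance travelled into that leaf edge, so every piece of a geodesic is counted by exactly one
  summand.\<close>

definition tree_dist :: "real \<Rightarrow> hpoint \<Rightarrow> hpoint \<Rightarrow> real" where
  "tree_dist L x y = L * \<bar>bridge_coord x - bridge_coord y\<bar> + \<bar>x $ Hu1 - y $ Hu1\<bar> +
     \<bar>x $ Hu2 - y $ Hu2\<bar> + \<bar>x $ Hv1 - y $ Hv1\<bar> + \<bar>x $ Hv2 - y $ Hv2\<bar>"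

lemma edge_point_nth: "edge_point e t $ v = (1 - t) * (if v = fst e then 1 else 0) + t * (if v = snd e then 1 else 0)"
  by (auto simp: edge_point_def axis_def)

lemma hedges_cases:
  assumes "e \<in> hedges"
  obtains "e = (Hu, Hv)" | "e = (Hu, Hu1)" | "e = (Hu, Hu2)" | "e = (Hv, Hv1)" | "e = (Hv, Hv2)"
  using assms by (auto simp: hedges_def hbridge_def)

lemma edge_point_simps:
  "edge_point (Hu, v) 0 = axis Hu 1" "edge_point (Hv, v) 0 = axis Hv 1"
  "edge_point (v, w) 1 = axis w 1"
  by (auto simp: edge_point_def)

lemma tree_dist_commute: "tree_dist L x y = tree_dist L y x"
  by (simp add: tree_dist_def abs_minus_commute)

lemma tree_dist_triangle:
  assumes "L \<ge> 0"
  shows "tree_dist L x z \<le> tree_dist L x y + tree_dist L y z"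
proof -
  have "L * \<bar>bridge_coord x - bridge_coord z\<bar>
      \<le> L * (\<bar>bridge_coord x - bridge_coord y\<bar> + \<bar>bridge_coord y - bridge_coord z\<bar>)"
    using assms by (intro mult_left_mono) auto
  moreover have "\<bar>x $ v - z $ v\<bar> \<le> \<bar>x $ v - y $ v\<bar> + \<bar>y $ v - z $ v\<bar>" for v
    by linarith
  note this[of Hu1] this[of Hu2] this[of Hv1] this[of Hv2]
  moreover have "a + b + c + d + e \<le> (a' + b' + c' + d' + e') + (a'' + b'' + c'' + d'' + e'')"
    if "a \<le> a' + a''" "b \<le> b' + b''" "c \<le> c' + c''" "d \<le> d' + d''" "e \<le> e' + e''"
    for a b c d e a' b' c' d' e' a'' b'' c'' d'' e'' :: real
    using that by linarith
  ultimately show ?thesis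
    unfolding tree_dist_def distrib_left by blast
qed

lemma tree_dist_same_edge:
  assumes "e \<in> hedges"
  shows "tree_dist L (edge_point e s) (edge_point e t) = edge_length L e * \<bar>s - t\<bar>"
  using assms
  by (cases rule: hedges_cases)
    (auto simp: tree_dist_def bridge_coord_def edge_point_nth edge_length_def hbridge_def abs_minus_commute)

text \<open>Lower half of the distance formula: each piece of a path lies in one edge, where
  \<open>tree_dist\<close> equals the length of the piece, so the triangle inequality bounds the
  total.\<close>

lemma hpath_length_ge:
  assumes "hpath L x y l" and "L \<ge> 0"
  shows "tree_dist L x y \<le> l"
  using assms(1)
proof induction
  case (refl x)
  then show ?case by (simp add: tree_dist_def)
next
  case (step x e s l t)
  then show ?case
    using tree_dist_triangle[OF assms(2), of x "edge_point e t" "edge_point e s"]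
      tree_dist_same_edge[of e L s t] by linarith
qed

lemma edge_point_in_hgraph: "e \<in> hedges \<Longrightarrow> t \<in> {0..1} \<Longrightarrow> edge_point e t \<in> hgraph"
  unfolding hgraph_def by blast

lemma hgraph_cases:
  assumes "x \<in> hgraph"
  obtains e t where "e \<in> hedges" "t \<in> {0..1}" "x = edge_point e t"
  using assms by (auto simp: hgraph_def)

text \<open>The rule \<open>step\<close> extends a path only at its end, so the induction runs over
  the second path, whose assumption is therefore listed first.\<close>

lemma hpath_trans:
  assumes "hpath L y z m" and "hpath L x y l"
  shows "hpath L x z (l + m)"
  using assms
proof induction
  case (step y e s m t)
  have "hpath L x (edge_point e t) ((l + m) + edge_length L e * \<bar>s - t\<bar>)"
    by (rule hpath.step) (use step in auto)
  then show ?case by (simp add: add.assoc)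
qed auto

lemma hpath_same_edge:
  assumes "e \<in> hedges" "s \<in> {0..1}" "t \<in> {0..1}"
  shows "hpath L (edge_point e s) (edge_point e t) (tree_dist L (edge_point e s) (edge_point e t))"
  using hpath.step[OF hpath.refl[OF edge_point_in_hgraph[OF assms(1,2)]] assms(1,2,3), of L]
  by (simp add: tree_dist_same_edge[OF assms(1)])

lemma hpath_tree_dist_trans:
  assumes "hpath L x y (tree_dist L x y)" "hpath L y z (tree_dist L y z)"
    and "tree_dist L x z = tree_dist L x y + tree_dist L y z"
  shows "hpath L x z (tree_dist L x z)"
  using hpath_trans[OF assms(2,1)] assms(3) by simp

lemma in_hedges: "(Hu, Hv) \<in> hedges" "(Hu, Hu1) \<in> hedges" "(Hu, Hu2) \<in> hedges"
   "(Hv, Hv1) \<in> hedges" "(Hv, Hv2) \<in> hedges"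
  by (auto simp: hedges_def hbridge_def)

text \<open>Edges are parametrised away from their first vertex, so two different edges with the
  same first vertex meet at parameter 0, and the geodesic passes through that point.\<close>

lemma hpath_adjacent:
  assumes "e \<in> hedges" "e' \<in> hedges" "fst e = fst e'" "s \<in> {0..1}" "t \<in> {0..1}"
  shows "hpath L (edge_point e s) (edge_point e' t) (tree_dist L (edge_point e s) (edge_point e' t))"
proof (cases "e = e'")
  case True
  then show ?thesis using hpath_same_edge assms by auto
next
  case False
  have a: "edge_point e 0 = edge_point e' 0"
    using assms(3) by (simp add: edge_point_def)
  show ?thesis
  proof (rule hpath_tree_dist_trans)
    show "hpath L (edge_point e s) (edge_point e 0) (tree_dist L (edge_point e s) (edge_point e 0))"
      by (rule hpath_same_edge) (use assms in auto)
    show "hpath L (edge_point e 0) (edge_point e' t) (tree_dist L (edge_point e 0) (edge_point e' t))"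
      unfolding a by (rule hpath_same_edge) (use assms in auto)
    show "tree_dist L (edge_point e s) (edge_point e' t) =
        tree_dist L (edge_point e s) (edge_point e 0) + tree_dist L (edge_point e 0) (edge_point e' t)"
      using assms(3-) False
      by (rule_tac hedges_cases[OF assms(1)]; rule_tac hedges_cases[OF assms(2)])
        (simp_all add: tree_dist_def bridge_coord_def edge_point_nth)
  qed
qed

text \<open>The bridge ends at \<open>Hv\<close>, where these leaf edges start, so parameter 1 is
  glued to parameter 0. Both directions are treated, since the inductive definition builds paths in
  one direction.\<close>

lemma hpath_bridge:
  assumes "e = (Hv, Hv1) \<or> e = (Hv, Hv2)" "s \<in> {0..1}" "t \<in> {0..1}"
  shows "hpath L (edge_point (Hu, Hv) s) (edge_point e t) (tree_dist L (edge_point (Hu, Hv) s) (edge_point e t))"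
    "hpath L (edge_point e t) (edge_point (Hu, Hv) s) (tree_dist L (edge_point e t) (edge_point (Hu, Hv) s))"
proof -
  have e: "e \<in> hedges" and a: "edge_point (Hu, Hv) 1 = edge_point e 0"
    using assms(1) by (auto simp: in_hedges edge_point_def)
  show "hpath L (edge_point (Hu, Hv) s) (edge_point e t) (tree_dist L (edge_point (Hu, Hv) s) (edge_point e t))"
  proof (rule hpath_tree_dist_trans)
    show "hpath L (edge_point (Hu, Hv) s) (edge_point (Hu, Hv) 1)
        (tree_dist L (edge_point (Hu, Hv) s) (edge_point (Hu, Hv) 1))"
      by (rule hpath_same_edge) (use assms in_hedges in auto)
    show "hpath L (edge_point (Hu, Hv) 1) (edge_point e t) (tree_dist L (edge_point (Hu, Hv) 1) (edge_point e t))"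
      unfolding a by (rule hpath_same_edge) (use assms e in auto)
  qed (use assms in \<open>elim disjE; simp add: tree_dist_def bridge_coord_def edge_point_nth algebra_simps\<close>)
  show "hpath L (edge_point e t) (edge_point (Hu, Hv) s) (tree_dist L (edge_point e t) (edge_point (Hu, Hv) s))"
  proof (rule hpath_tree_dist_trans)
    show "hpath L (edge_point (Hu, Hv) 1) (edge_point (Hu, Hv) s)
        (tree_dist L (edge_point (Hu, Hv) 1) (edge_point (Hu, Hv) s))"
      by (rule hpath_same_edge) (use assms in_hedges in auto)
    show "hpath L (edge_point e t) (edge_point (Hu, Hv) 1) (tree_dist L (edge_point e t) (edge_point (Hu, Hv) 1))"
      unfolding a by (rule hpath_same_edge) (use assms e in auto)
  qed (use assms in \<open>elim disjE; simp add: tree_dist_def bridge_coord_def edge_point_nth algebra_simps\<close>)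
qed

lemma hpath_opposite_leaves:
  assumes "e = (Hv, Hv1) \<or> e = (Hv, Hv2)" "e' = (Hu, Hu1) \<or> e' = (Hu, Hu2)" "s \<in> {0..1}" "t \<in> {0..1}"
  shows "hpath L (edge_point e' s) (edge_point e t) (tree_dist L (edge_point e' s) (edge_point e t))"
    "hpath L (edge_point e t) (edge_point e' s) (tree_dist L (edge_point e t) (edge_point e' s))"
proof -
  have e: "e \<in> hedges" "e' \<in> hedges" and fst: "fst e' = fst (Hu, Hv)"
    using assms by (auto simp: in_hedges edge_point_def)
  show "hpath L (edge_point e' s) (edge_point e t) (tree_dist L (edge_point e' s) (edge_point e t))"
  proof (rule hpath_tree_dist_trans)
    show "hpath L (edge_point e' s) (edge_point (Hu, Hv) 1)
        (tree_dist L (edge_point e' s) (edge_point (Hu, Hv) 1))"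
      by (rule hpath_adjacent[OF e(2) in_hedges(1) fst assms(3)]) simp
    show "hpath L (edge_point (Hu, Hv) 1) (edge_point e t)
        (tree_dist L (edge_point (Hu, Hv) 1) (edge_point e t))"
      by (rule hpath_bridge(1)[OF assms(1) _ assms(4)]) simp
    show "tree_dist L (edge_point e' s) (edge_point e t) =
        tree_dist L (edge_point e' s) (edge_point (Hu, Hv) 1) + tree_dist L (edge_point (Hu, Hv) 1) (edge_point e t)"
      using assms by (elim disjE) (simp_all add: tree_dist_def bridge_coord_def edge_point_nth)
  qed
  show "hpath L (edge_point e t) (edge_point e' s) (tree_dist L (edge_point e t) (edge_point e' s))"
  proof (rule hpath_tree_dist_trans)
    show "hpath L (edge_point e t) (edge_point (Hu, Hv) 1)
        (tree_dist L (edge_point e t) (edge_point (Hu, Hv) 1))"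
      by (rule hpath_bridge(2)[OF assms(1) _ assms(4)]) simp
    show "hpath L (edge_point (Hu, Hv) 1) (edge_point e' s)
        (tree_dist L (edge_point (Hu, Hv) 1) (edge_point e' s))"
      by (rule hpath_adjacent[OF in_hedges(1) e(2) fst[symmetric] _ assms(3)]) simp
    show "tree_dist L (edge_point e t) (edge_point e' s) =
        tree_dist L (edge_point e t) (edge_point (Hu, Hv) 1) + tree_dist L (edge_point (Hu, Hv) 1) (edge_point e' s)"
      using assms by (elim disjE) (simp_all add: tree_dist_def bridge_coord_def edge_point_nth)
  qed
qed

text \<open>Upper half of the distance formula. Every edge starts at \<open>Hu\<close> or
  \<open>Hv\<close>. If the first vertices differ, the edge from \<open>Hv\<close> is a leaf edge
  and the edge from \<open>Hu\<close> is the bridge or a leaf edge, which gives the four remaining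
  cases.\<close>

lemma hpath_tree_dist:
  assumes "x \<in> hgraph" "y \<in> hgraph"
  shows "hpath L x y (tree_dist L x y)"
proof -
  obtain e s where x: "e \<in> hedges" "s \<in> {0..1}" "x = edge_point e s"
    using assms(1) by (rule hgraph_cases)
  obtain e' t where y: "e' \<in> hedges" "t \<in> {0..1}" "y = edge_point e' t"
    using assms(2) by (rule hgraph_cases)
  consider "fst e = fst e'" | "e = (Hu, Hv)" "e' = (Hv, Hv1) \<or> e' = (Hv, Hv2)"
    | "e' = (Hu, Hv)" "e = (Hv, Hv1) \<or> e = (Hv, Hv2)"
    | "e = (Hv, Hv1) \<or> e = (Hv, Hv2)" "e' = (Hu, Hu1) \<or> e' = (Hu, Hu2)"
    | "e' = (Hv, Hv1) \<or> e' = (Hv, Hv2)" "e = (Hu, Hu1) \<or> e = (Hu, Hu2)"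
    using x(1) y(1) by (auto simp: hedges_def hbridge_def)
  then show ?thesis
  proof cases
    case 1
    then show ?thesis using hpath_adjacent[OF x(1) y(1) _ x(2) y(2)] x y by simp
  next
    case 2
    then show ?thesis using hpath_bridge(1)[OF _ x(2) y(2)] x y by simp
  next
    case 3
    then show ?thesis using hpath_bridge(2)[OF _ y(2) x(2)] x y by simp
  next
    case 4
    then show ?thesis using hpath_opposite_leaves(2)[OF _ _ y(2) x(2)] x y by simp
  next
    case 5
    then show ?thesis using hpath_opposite_leaves(1)[OF _ _ x(2) y(2)] x y by simp
  qed
qed

lemma hdist_eq_tree_dist:
  assumes "x \<in> hgraph" "y \<in> hgraph" "L \<ge> 0"
  shows "hdist L x y = tree_dist L x y"
  unfolding hdist_def
  by (rule cInf_eq_minimum) (use hpath_tree_dist hpath_length_ge assms in auto)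

lemma hconf_eq:
  assumes "L > 0"
  shows "hconf r L = {(x, y). x \<in> hgraph \<and> y \<in> hgraph \<and> r \<le> tree_dist L x y}"
  using assms by (auto simp: hconf_def hdist_eq_tree_dist)


section \<open>Paths of configurations and the leaf pairs they reach\<close>

lemma edge_point_convex:
  "(1 - a) *\<^sub>R edge_point e s + a *\<^sub>R edge_point e t = edge_point e ((1 - a) * s + a * t)"
  unfolding vec_eq_iff vector_add_component vector_scaleR_component edge_point_nth
  by (auto simp: algebra_simps)

text \<open>The ambient segment between two points of one edge stays in that edge, so the straight
  line in the product is a path of configurations once the distance bound holds along it.\<close>

lemma path_component_move_fst:
  assumes "L > 0" "e \<in> hedges" "s0 \<in> {0..1}" "s1 \<in> {0..1}" "y \<in> hgraph"
    and "\<And>a. a \<in> {0..1} \<Longrightarrow> r \<le> tree_dist L (edge_point e ((1 - a) * s0 + a * s1)) y"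
  shows "path_component (hconf r L) (edge_point e s0, y) (edge_point e s1, y)"
proof (rule path_component_linepath, rule subsetI)
  fix z assume "z \<in> closed_segment (edge_point e s0, y) (edge_point e s1, y)"
  then obtain a where a: "0 \<le> a" "a \<le> 1"
    and z: "z = (1 - a) *\<^sub>R (edge_point e s0, y) + a *\<^sub>R (edge_point e s1, y)"
    by (auto simp: in_segment)
  have "(1 - a) * s0 + a * s1 \<in> {0..1}"
    using convexD_alt[OF convex_real_interval(5) assms(3,4) a] by simp
  moreover have "z = (edge_point e ((1 - a) * s0 + a * s1), y)"
    unfolding z by (simp add: edge_point_convex flip: scaleR_add_left)
  ultimately show "z \<in> hconf r L"
    using assms a edge_point_in_hgraph by (simp add: hconf_eq)
qed

lemma path_component_move_snd:
  assumes "L > 0" "e \<in> hedges" "s0 \<in> {0..1}" "s1 \<in> {0..1}" "x \<in> hgraph"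
    and "\<And>a. a \<in> {0..1} \<Longrightarrow> r \<le> tree_dist L x (edge_point e ((1 - a) * s0 + a * s1))"
  shows "path_component (hconf r L) (x, edge_point e s0) (x, edge_point e s1)"
proof (rule path_component_linepath, rule subsetI)
  fix z assume "z \<in> closed_segment (x, edge_point e s0) (x, edge_point e s1)"
  then obtain a where a: "0 \<le> a" "a \<le> 1"
    and z: "z = (1 - a) *\<^sub>R (x, edge_point e s0) + a *\<^sub>R (x, edge_point e s1)"
    by (auto simp: in_segment)
  have "(1 - a) * s0 + a * s1 \<in> {0..1}"
    using convexD_alt[OF convex_real_interval(5) assms(3,4) a] by simp
  moreover have "z = (x, edge_point e ((1 - a) * s0 + a * s1))"
    unfolding z by (simp add: edge_point_convex flip: scaleR_add_left)
  ultimately show "z \<in> hconf r L"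
    using assms a edge_point_in_hgraph by (simp add: hconf_eq)
qed

text \<open>On two distinct edges none of the differences inside the absolute values changes sign,
  so the distance is affine in \<open>s\<close>. On a single edge this fails, because the points can
  pass each other.\<close>

lemma tree_dist_affine:
  assumes e: "e \<in> hedges" and e': "e' \<in> hedges" and "e \<noteq> e'" "s \<in> {0..1}" "t \<in> {0..1}"
  shows "tree_dist L (edge_point e s) (edge_point e' t) =
    (1 - s) * tree_dist L (edge_point e 0) (edge_point e' t) + s * tree_dist L (edge_point e 1) (edge_point e' t)"
  using assms(3-)
  by (rule_tac hedges_cases[OF e]; rule_tac hedges_cases[OF e'])
    (simp_all add: tree_dist_def bridge_coord_def edge_point_nth abs_if, auto simp: algebra_simps)

text \<open>Affinity makes the superlevel sets of the distance along an edge convex, so a slide has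
  to be checked only at its two ends.\<close>

lemma tree_dist_convex:
  assumes "e \<in> hedges" "e' \<in> hedges" "e \<noteq> e'" "s0 \<in> {0..1}" "s1 \<in> {0..1}" "t \<in> {0..1}" "a \<in> {0..1}"
    and "r \<le> tree_dist L (edge_point e s0) (edge_point e' t)"
      "r \<le> tree_dist L (edge_point e s1) (edge_point e' t)"
  shows "r \<le> tree_dist L (edge_point e ((1 - a) * s0 + a * s1)) (edge_point e' t)"
proof -
  let ?d = "\<lambda>s. tree_dist L (edge_point e s) (edge_point e' t)"
  have "(1 - a) * s0 + a * s1 \<in> {0..1}"
    using convexD_alt[OF convex_real_interval(5) assms(4,5), of a] assms(7) by simp
  then have "?d ((1 - a) * s0 + a * s1) =
      (1 - ((1 - a) * s0 + a * s1)) * ?d 0 + ((1 - a) * s0 + a * s1) * ?d 1"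
    using tree_dist_affine[OF assms(1-3) _ assms(6)] by blast
  also have "\<dots> = (1 - a) * ?d s0 + a * ?d s1"
    unfolding tree_dist_affine[OF assms(1-3,4,6)] tree_dist_affine[OF assms(1-3,5,6)]
    by (simp add: algebra_simps)
  also have "\<dots> \<ge> (1 - a) * r + a * r"
    using assms(7-) by (intro add_mono mult_left_mono) auto
  finally show ?thesis by (simp add: algebra_simps)
qed

lemma path_component_slide_fst:
  assumes "L > 0" "e \<in> hedges" "e' \<in> hedges" "e \<noteq> e'" "s0 \<in> {0..1}" "s1 \<in> {0..1}" "t \<in> {0..1}"
    and "r \<le> tree_dist L (edge_point e s0) (edge_point e' t)"
      "r \<le> tree_dist L (edge_point e s1) (edge_point e' t)"
  shows "path_component (hconf r L) (edge_point e s0, edge_point e' t) (edge_point e s1, edge_point e' t)"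
  by (rule path_component_move_fst)
    (use assms edge_point_in_hgraph tree_dist_convex in auto)

lemma path_component_slide_snd:
  assumes "L > 0" "e \<in> hedges" "e' \<in> hedges" "e \<noteq> e'" "s0 \<in> {0..1}" "s1 \<in> {0..1}" "t \<in> {0..1}"
    and "r \<le> tree_dist L (edge_point e' t) (edge_point e s0)"
      "r \<le> tree_dist L (edge_point e' t) (edge_point e s1)"
  shows "path_component (hconf r L) (edge_point e' t, edge_point e s0) (edge_point e' t, edge_point e s1)"
  by (rule path_component_move_snd)
    (use assms edge_point_in_hgraph tree_dist_convex tree_dist_commute in auto)

definition leaves :: "hvertex set" where
  "leaves = {Hu1, Hu2, Hv1, Hv2}"

definition stem :: "hvertex \<Rightarrow> hvertex" where
  "stem a = (if a \<in> {Hu1, Hu2} then Hu else Hv)"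

lemma leavesE:
  assumes "a \<in> leaves"
  obtains "a = Hu1" | "a = Hu2" | "a = Hv1" | "a = Hv2"
  using assms by (auto simp: leaves_def)

lemma stem_simps [simp]: "stem Hu1 = Hu" "stem Hu2 = Hu" "stem Hv1 = Hv" "stem Hv2 = Hv"
  by (auto simp: stem_def)

lemma leaf_edge_in_hedges: "a \<in> leaves \<Longrightarrow> (stem a, a) \<in> hedges"
  by (auto simp: leaves_def in_hedges)

definition vpair :: "hvertex \<Rightarrow> hvertex \<Rightarrow> hpoint \<times> hpoint" where
  "vpair a b = (axis a 1, axis b 1)"

lemma tree_dist_outward:
  assumes "a \<in> leaves" "b \<in> leaves" "a \<noteq> b" "s \<in> {0..1}" "t \<in> {0..1}" "L > 0"
  shows "tree_dist L (edge_point (stem a, a) s) (edge_point (stem b, b) t)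
     = (if stem a = stem b then 0 else L) + s + t"
  using assms
  by (elim leavesE) (simp_all add: tree_dist_def bridge_coord_def edge_point_nth)

lemma path_component_leaf_leaf:
  assumes "L > 0" "a \<in> leaves" "b \<in> leaves" "a \<noteq> b" "s \<in> {0..1}" "t \<in> {0..1}"
    and "r \<le> tree_dist L (edge_point (stem a, a) s) (edge_point (stem b, b) t)"
  shows "path_component (hconf r L) (edge_point (stem a, a) s, edge_point (stem b, b) t) (vpair a b)"
proof (rule path_component_trans)
  show "path_component (hconf r L) (edge_point (stem a, a) s, edge_point (stem b, b) t)
      (edge_point (stem a, a) 1, edge_point (stem b, b) t)"
    by (rule path_component_slide_fst)
      (use assms leaf_edge_in_hedges in \<open>auto simp: tree_dist_outward\<close>)
  show "path_component (hconf r L) (edge_point (stem a, a) 1, edge_point (stem b, b) t) (vpair a b)"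
    unfolding vpair_def edge_point_simps(3)[of "stem b" b, symmetric] edge_point_simps(3)[of "stem a" a, symmetric]
    by (rule path_component_slide_snd)
      (use assms leaf_edge_in_hedges in \<open>auto simp: tree_dist_outward\<close>)
qed

lemma path_component_bridge_leaf:
  assumes "L > 0" "b \<in> leaves" "s \<in> {0..1}" "t \<in> {0..1}"
    and "r \<le> tree_dist L (edge_point (Hu, Hv) s) (edge_point (stem b, b) t)"
  shows "\<exists>a\<in>leaves. a \<noteq> b \<and>
    path_component (hconf r L) (edge_point (Hu, Hv) s, edge_point (stem b, b) t) (vpair a b)"
proof -
  \<comment> \<open>\<open>w\<close> is the end of the bridge away from the edge of
    \<open>b\<close>, and \<open>a\<close> is a leaf beyond it: moving there never decreases the
    distance to a point on the edge of \<open>b\<close>.\<close>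
  define a where "a = (if stem b = Hu then Hv1 else Hu1)"
  define w where "w = (if stem b = Hu then 1 else 0 :: real)"
  have w: "w \<in> {0..1}" by (simp add: w_def)
  have a: "a \<in> leaves" "a \<noteq> b" using assms(2) by (auto simp: leaves_def a_def)
  have eq: "edge_point (Hu, Hv) w = edge_point (stem a, a) 0"
    using assms(2) by (auto simp: leaves_def a_def w_def edge_point_simps)
  have le: "r \<le> tree_dist L (edge_point (Hu, Hv) w) (edge_point (stem b, b) t)"
    using assms(1-4)
    by (intro order_trans[OF assms(5)])
      (elim leavesE; simp add: w_def tree_dist_def bridge_coord_def edge_point_nth)
  have "path_component (hconf r L) (edge_point (Hu, Hv) s, edge_point (stem b, b) t)
      (edge_point (Hu, Hv) w, edge_point (stem b, b) t)"
    by (rule path_component_slide_fst)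
      (use assms le w leaf_edge_in_hedges in_hedges in \<open>auto simp: leaves_def\<close>)
  moreover have "path_component (hconf r L) (edge_point (Hu, Hv) w, edge_point (stem b, b) t) (vpair a b)"
    using le unfolding eq by (intro path_component_leaf_leaf) (use assms a in auto)
  ultimately show ?thesis using a path_component_trans by blast
qed

lemma path_component_leaf_bridge:
  assumes "L > 0" "a \<in> leaves" "s \<in> {0..1}" "t \<in> {0..1}"
    and "r \<le> tree_dist L (edge_point (stem a, a) s) (edge_point (Hu, Hv) t)"
  shows "\<exists>b\<in>leaves. a \<noteq> b \<and>
    path_component (hconf r L) (edge_point (stem a, a) s, edge_point (Hu, Hv) t) (vpair a b)"
proof -
  define b where "b = (if stem a = Hu then Hv1 else Hu1)"
  define w where "w = (if stem a = Hu then 1 else 0 :: real)"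
  have w: "w \<in> {0..1}" by (simp add: w_def)
  have b: "b \<in> leaves" "a \<noteq> b" using assms(2) by (auto simp: leaves_def b_def)
  have eq: "edge_point (Hu, Hv) w = edge_point (stem b, b) 0"
    using assms(2) by (auto simp: leaves_def b_def w_def edge_point_simps)
  have le: "r \<le> tree_dist L (edge_point (stem a, a) s) (edge_point (Hu, Hv) w)"
    using assms(1-4)
    by (intro order_trans[OF assms(5)])
      (elim leavesE; simp add: w_def tree_dist_def bridge_coord_def edge_point_nth)
  have "path_component (hconf r L) (edge_point (stem a, a) s, edge_point (Hu, Hv) t)
      (edge_point (stem a, a) s, edge_point (Hu, Hv) w)"
    by (rule path_component_slide_snd)
      (use assms le w leaf_edge_in_hedges in_hedges in \<open>auto simp: leaves_def\<close>)
  moreover have "path_component (hconf r L) (edge_point (stem a, a) s, edge_point (Hu, Hv) w) (vpair a b)"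
    using le unfolding eq by (intro path_component_leaf_leaf) (use assms b in auto)
  ultimately show ?thesis using b path_component_trans by blast
qed

lemma hedge_bridge_or_leaf:
  assumes "e \<in> hedges"
  obtains "e = (Hu, Hv)" | a where "a \<in> leaves" "e = (stem a, a)"
  using assms by (cases rule: hedges_cases) (auto simp: leaves_def stem_def)

lemma reach_leaves_distinct_edges:
  assumes "L > 0" "e \<in> hedges" "e' \<in> hedges" "e \<noteq> e'" "s \<in> {0..1}" "t \<in> {0..1}"
    and "r \<le> tree_dist L (edge_point e s) (edge_point e' t)"
  shows "\<exists>a\<in>leaves. \<exists>b\<in>leaves. a \<noteq> b \<and>
    path_component (hconf r L) (edge_point e s, edge_point e' t) (vpair a b)"
  using assms(2)
proof (cases rule: hedge_bridge_or_leaf)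
  case 1
  then show ?thesis
    using path_component_bridge_leaf[OF assms(1)] assms by (metis hedge_bridge_or_leaf)
next
  case (2 a)
  show ?thesis using assms(3)
  proof (cases rule: hedge_bridge_or_leaf)
    case 1
    then show ?thesis
      using path_component_leaf_bridge[OF assms(1) 2(1) assms(5,6)] 2 assms(7) by blast
  next
    case (2 b)
    have "a \<noteq> b" using 2 \<open>e = (stem a, a)\<close> assms(4) by auto
    moreover have "path_component (hconf r L) (edge_point e s, edge_point e' t) (vpair a b)"
      using path_component_leaf_leaf[OF assms(1) \<open>a \<in> leaves\<close> 2(1) \<open>a \<noteq> b\<close> assms(5,6)]
        \<open>e = (stem a, a)\<close> 2(2) assms(7) by simp
    ultimately show ?thesis using \<open>a \<in> leaves\<close> 2(1) by blast
  qed
qed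

text \<open>The first vertex of each edge has degree 3 and so lies on a second edge. Two points on
  the same edge are reduced to distinct edges by moving one of them to that vertex.\<close>

lemma edge_point_0_other_edge:
  assumes "e \<in> hedges"
  obtains e2 where "e2 \<in> hedges" "e2 \<noteq> e" "edge_point e 0 = edge_point e2 0"
proof -
  have "\<exists>e2\<in>hedges. e2 \<noteq> e \<and> fst e2 = fst e"
    using assms by (cases rule: hedges_cases) (auto simp: hedges_def hbridge_def)
  then show ?thesis using that by (auto simp: edge_point_def)
qed

lemma reach_leaves:
  assumes "L > 0" "z \<in> hconf r L"
  shows "\<exists>a\<in>leaves. \<exists>b\<in>leaves. a \<noteq> b \<and> path_component (hconf r L) z (vpair a b)"
proof -
  obtain x y where z: "z = (x, y)" "x \<in> hgraph" "y \<in> hgraph" "r \<le> tree_dist L x y"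
    using assms by (auto simp: hconf_eq)
  obtain e s where x: "e \<in> hedges" "s \<in> {0..1}" "x = edge_point e s"
    using z(2) by (rule hgraph_cases)
  obtain e' t where y: "e' \<in> hedges" "t \<in> {0..1}" "y = edge_point e' t"
    using z(3) by (rule hgraph_cases)
  show ?thesis
  proof (cases "e = e'")
    case False
    then show ?thesis
      using reach_leaves_distinct_edges[OF assms(1) x(1) y(1) _ x(2) y(2)] x y z by simp
  next
    case True
    obtain e2 where e2: "e2 \<in> hedges" "e2 \<noteq> e" "edge_point e 0 = edge_point e2 0"
      using x(1) by (rule edge_point_0_other_edge)
    have len: "edge_length L e \<ge> 0" using assms by (simp add: edge_length_def)
    have r: "r \<le> edge_length L e * \<bar>s - t\<bar>"
      using z(4) x y True by (simp add: tree_dist_same_edge)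
    show ?thesis
    \<comment> \<open>The point with the smaller parameter retreats to parameter 0, which only
      increases the distance. There it also lies on \<open>e2\<close>, and the case of distinct
      edges applies.\<close>
    proof (cases "s \<le> t")
      case st: True
      have a: "r \<le> tree_dist L (edge_point e ((1 - a) * s + a * 0)) (edge_point e t)" if "a \<in> {0..1}" for a
      proof -
        have "\<bar>s - t\<bar> \<le> \<bar>(1 - a) * s + a * 0 - t\<bar>"
        proof -
          have "0 \<le> a * s" "(1 - a) * s + a * 0 = s - a * s"
            using that x(2) by (simp_all add: algebra_simps)
          then show ?thesis using st by linarith
        qed
        then show ?thesis
          unfolding tree_dist_same_edge[OF x(1)] using order_trans[OF r mult_left_mono[OF _ len]] by blast
      qed
      then have "path_component (hconf r L) z (edge_point e 0, edge_point e t)"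
        unfolding z x y True[symmetric]
        by (intro path_component_move_fst) (use assms x y True edge_point_in_hgraph in auto)
      moreover have "r \<le> tree_dist L (edge_point e2 0) (edge_point e t)"
        using a[of 1] by (simp add: e2)
      ultimately show ?thesis
        using reach_leaves_distinct_edges[OF assms(1) e2(1) x(1) e2(2) _ y(2), of 0] e2(3)
          path_component_trans by (metis atLeastAtMost_iff order_refl zero_le_one)
    next
      case st: False
      have a: "r \<le> tree_dist L (edge_point e s) (edge_point e ((1 - a) * t + a * 0))" if "a \<in> {0..1}" for a
      proof -
        have "\<bar>s - t\<bar> \<le> \<bar>s - ((1 - a) * t + a * 0)\<bar>"
        proof -
          have "0 \<le> a * t" "(1 - a) * t + a * 0 = t - a * t"
            using that y(2) by (simp_all add: algebra_simps)
          then show ?thesis using st by linarith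
        qed
        then show ?thesis
          unfolding tree_dist_same_edge[OF x(1)] using order_trans[OF r mult_left_mono[OF _ len]] by blast
      qed
      then have "path_component (hconf r L) z (edge_point e s, edge_point e 0)"
        unfolding z x y True[symmetric]
        by (intro path_component_move_snd) (use assms x y True edge_point_in_hgraph in auto)
      moreover have "r \<le> tree_dist L (edge_point e s) (edge_point e2 0)"
        using a[of 1] by (simp add: e2)
      ultimately show ?thesis
        using reach_leaves_distinct_edges[OF assms(1) x(1) e2(1) e2(2)[symmetric] x(2), of 0] e2(3)
          path_component_trans by (metis atLeastAtMost_iff order_refl zero_le_one)
    qed
  qed
qed


text \<open>The first point retreats to its branch vertex, crosses the bridge if the new leaf is on
  the other side, and moves out to \<open>a'\<close>, while the second point waits at the leaf
  \<open>b\<close>. A branch vertex is at distance 1 from \<open>b\<close> on the side of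
  \<open>b\<close> and \<open>L + 1\<close> across the bridge; a point of the bridge is at distance
  at least 1. This is the source of the two bounds on \<open>r\<close>.\<close>

lemma path_component_change_leaf_fst:
  assumes "L > 0" "a \<in> leaves" "a' \<in> leaves" "b \<in> leaves" "a \<noteq> b" "a' \<noteq> b"
    and "r \<le> 1 \<or> stem a = stem a' \<and> stem a \<noteq> stem b \<and> r \<le> L + 1"
  shows "path_component (hconf r L) (vpair a b) (vpair a' b)"
proof -
  let ?B = "edge_point (stem b, b) 1"
  have leg: "path_component (hconf r L) (axis (stem c) 1, ?B) (vpair c b)"
    if c: "c \<in> leaves" "c \<noteq> b" "c = a \<or> c = a'" for c
  proof -
    have "r \<le> tree_dist L (edge_point (stem c, c) 0) ?B"
      using assms c by (auto simp: tree_dist_outward)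
    then have "path_component (hconf r L) (edge_point (stem c, c) 0, ?B) (vpair c b)"
      by (intro path_component_leaf_leaf[OF assms(1) c(1) assms(4) c(2)]) auto
    moreover have "edge_point (stem c, c) 0 = axis (stem c) 1"
      by (simp add: stem_def edge_point_simps)
    ultimately show ?thesis by simp
  qed
  have "path_component (hconf r L) (axis (stem a) 1, ?B) (axis (stem a') 1, ?B)"
  proof (cases "stem a = stem a'")
    case True
    then show ?thesis
      using path_component_mem(1)[OF leg[OF assms(2,5)]] path_component_refl by auto
  next
    case False
    then have "r \<le> 1" using assms by auto
    then have r: "r \<le> tree_dist L (edge_point (Hu, Hv) w) ?B" if "w = 0 \<or> w = 1" for w
      using that assms(1,4) by (elim leavesE disjE)
       (simp_all add: tree_dist_def bridge_coord_def edge_point_nth)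
    have ne: "(Hu, Hv) \<noteq> (stem b, b)" using assms(4) by (auto simp: leaves_def)
    have "path_component (hconf r L) (edge_point (Hu, Hv) w, ?B) (edge_point (Hu, Hv) w', ?B)"
      if "w = 0 \<or> w = 1" "w' = 0 \<or> w' = 1" for w w'
    proof (rule path_component_slide_fst[OF assms(1) in_hedges(1) leaf_edge_in_hedges[OF assms(4)] ne _ _ _
          r[OF that(1)] r[OF that(2)]])
      show "w \<in> {0..1}" "w' \<in> {0..1}" using that by auto
    qed simp
    from this[of 0 1] this[of 1 0] False show ?thesis
      by (auto simp: stem_def edge_point_simps split: if_splits)
  qed
  then show ?thesis
    using leg[OF assms(2,5)] leg[OF assms(3,6)] path_component_sym path_component_trans by blast
qed

lemma vpair_swap: "prod.swap (vpair a b) = vpair b a"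
  by (simp add: vpair_def)

lemma path_component_swap:
  assumes "L > 0" "path_component (hconf r L) z z'"
  shows "path_component (hconf r L) (prod.swap z) (prod.swap z')"
proof -
  obtain g where g: "path g" "path_image g \<subseteq> hconf r L" "pathstart g = z" "pathfinish g = z'"
    using assms(2) by (auto simp: path_component_def)
  have sw: "prod.swap = (\<lambda>z :: hpoint \<times> hpoint. (snd z, fst z))" by auto
  have "prod.swap ` hconf r L \<subseteq> hconf r L"
    using assms(1) by (auto simp: hconf_eq tree_dist_commute)
  then have "path_image (prod.swap \<circ> g) \<subseteq> hconf r L"
    using g(2) by (auto simp: path_image_compose)
  moreover have "path (prod.swap \<circ> g)"
    using g(1) by (intro path_continuous_image) (auto simp: sw intro!: continuous_intros)
  moreover have "pathstart (prod.swap \<circ> g) = prod.swap z" "pathfinish (prod.swap \<circ> g) = prod.swap z'"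
    using g by (auto simp: pathstart_compose pathfinish_compose)
  ultimately show ?thesis unfolding path_component_def by blast
qed

lemma path_component_change_leaf_snd:
  assumes "L > 0" "a \<in> leaves" "b \<in> leaves" "b' \<in> leaves" "a \<noteq> b" "a \<noteq> b'"
    and "r \<le> 1 \<or> stem b = stem b' \<and> stem a \<noteq> stem b \<and> r \<le> L + 1"
  shows "path_component (hconf r L) (vpair a b) (vpair a b')"
  using path_component_swap[OF assms(1) path_component_change_leaf_fst[of L b b' a r]] assms
  by (auto simp: vpair_swap)

text \<open>The order matches \<^const>\<open>summand_supports\<close>: pairs 2 to 5 lie on one side of the bridge, pairs 6 to 8
  are connected to pair 0 and pairs 9 to 11 to pair 1 as soon as \<open>r \<le> L + 1\<close>.\<close>

definition leaf_pairs :: "(hvertex \<times> hvertex) list" where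
  "leaf_pairs = [(Hu1, Hv1), (Hv1, Hu1), (Hu1, Hu2), (Hu2, Hu1), (Hv1, Hv2), (Hv2, Hv1),
     (Hu1, Hv2), (Hu2, Hv1), (Hu2, Hv2), (Hv1, Hu2), (Hv2, Hu1), (Hv2, Hu2)]"

definition leaf_config :: "nat \<Rightarrow> hpoint \<times> hpoint" where
  "leaf_config i = vpair (fst (leaf_pairs ! i)) (snd (leaf_pairs ! i))"

lemma less_12_cases:
  assumes "i < (12 :: nat)"
  obtains "i = 0" | "i = 1" | "i = 2" | "i = 3" | "i = 4" | "i = 5" | "i = 6" | "i = 7"
    | "i = 8" | "i = 9" | "i = 10" | "i = 11"
proof -
  have "i \<in> {0, 1, 2, 3, 4, 5, 6, 7, 8, 9, 10, 11}"
    using assms by (simp, presburger)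
  then show ?thesis using that by blast
qed

lemma length_summand_supports [simp]: "length summand_supports = 12"
  by (simp add: summand_supports_def)

lemma summand_supports_nth:
  assumes "i < 12"
  shows "(r, L) \<in> summand_supports ! i \<longleftrightarrow> r > 0 \<and> L > 0 \<and>
    (if i = 0 then r \<le> L + 2 else if i = 1 then 1 < r \<and> r \<le> L + 2
     else if i < 6 then 1 < r \<and> r \<le> 2 else L + 1 < r \<and> r \<le> L + 2)"
  using assms
  by (cases rule: less_12_cases) (simp_all add: summand_supports_def params_def numeral_eq_Suc)

lemma leaf_pairs_nth [simp]:
  "leaf_pairs ! 0 = (Hu1, Hv1)" "leaf_pairs ! 1 = (Hv1, Hu1)" "leaf_pairs ! Suc 0 = (Hv1, Hu1)"
  "leaf_pairs ! 2 = (Hu1, Hu2)"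
  "leaf_pairs ! 3 = (Hu2, Hu1)" "leaf_pairs ! 4 = (Hv1, Hv2)" "leaf_pairs ! 5 = (Hv2, Hv1)"
  "leaf_pairs ! 6 = (Hu1, Hv2)" "leaf_pairs ! 7 = (Hu2, Hv1)" "leaf_pairs ! 8 = (Hu2, Hv2)"
  "leaf_pairs ! 9 = (Hv1, Hu2)" "leaf_pairs ! 10 = (Hv2, Hu1)" "leaf_pairs ! 11 = (Hv2, Hu2)"
  by (simp_all add: leaf_pairs_def numeral_eq_Suc)

text \<open>If the second point occupies \<open>Hu1\<close>, the destination of the first, then the
  first is parked on the spare leaf \<open>Hv2\<close> until the second has moved to
  \<open>Hv1\<close>.\<close>

lemma reach_first_leaf_config:
  assumes "L > 0" "r \<le> 1" "a \<in> leaves" "b \<in> leaves" "a \<noteq> b"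
  shows "path_component (hconf r L) (vpair a b) (vpair Hu1 Hv1)"
proof (cases "b = Hu1")
  case False
  have "path_component (hconf r L) (vpair a b) (vpair Hu1 b)"
    by (rule path_component_change_leaf_fst) (use assms False in \<open>auto simp: leaves_def\<close>)
  moreover have "path_component (hconf r L) (vpair Hu1 b) (vpair Hu1 Hv1)"
    by (rule path_component_change_leaf_snd) (use assms False in \<open>auto simp: leaves_def\<close>)
  ultimately show ?thesis by (rule path_component_trans)
next
  case True
  have "path_component (hconf r L) (vpair a b) (vpair Hv2 b)"
    by (rule path_component_change_leaf_fst) (use assms True in \<open>auto simp: leaves_def\<close>)
  moreover have "path_component (hconf r L) (vpair Hv2 b) (vpair Hv2 Hv1)"
    by (rule path_component_change_leaf_snd) (use assms True in \<open>auto simp: leaves_def\<close>)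
  moreover have "path_component (hconf r L) (vpair Hv2 Hv1) (vpair Hu1 Hv1)"
    by (rule path_component_change_leaf_fst) (use assms True in \<open>auto simp: leaves_def\<close>)
  ultimately show ?thesis using path_component_trans by blast
qed

lemma leaf_pairs_complete:
  assumes "a \<in> leaves" "b \<in> leaves" "a \<noteq> b"
  obtains k where "k < 12" "leaf_pairs ! k = (a, b)"
    "stem a = stem b \<longleftrightarrow> 2 \<le> k \<and> k < 6"
proof -
  have "\<exists>k\<in>{0,1,2,3,4,5,6,7,8,9,10,11}. leaf_pairs ! k = (a, b) \<and> (stem a = stem b \<longleftrightarrow> 2 \<le> k \<and> k < 6)"
    using assms by (elim leavesE) (simp_all)
  then obtain k where "k \<in> {0, 1, 2, 3, 4, 5, 6, 7, 8, 9, 10, 11}"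
    and k: "leaf_pairs ! k = (a, b)" "stem a = stem b \<longleftrightarrow> 2 \<le> k \<and> k < 6" by blast
  then have "k < 12" by (elim insertE) simp_all
  with k show ?thesis using that by blast
qed

lemma leaf_config_simps: "leaf_config 0 = vpair Hu1 Hv1" "leaf_config 1 = vpair Hv1 Hu1"
  by (simp_all add: leaf_config_def)

lemma tree_dist_leaves:
  assumes "a \<in> leaves" "b \<in> leaves" "a \<noteq> b" "L > 0"
  shows "tree_dist L (axis a 1) (axis b 1) = (if stem a = stem b then 2 else L + 2)"
  using tree_dist_outward[OF assms(1-3) _ _ assms(4), of 1 1] by (simp add: edge_point_simps)

text \<open>There are three regimes. If \<open>r \<le> 1\<close>, everything moves to pair 0. If
  \<open>r > 1\<close>, a pair on one side of the bridge is kept, and so is any pair when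
  \<open>r > L + 1\<close>. If \<open>1 < r \<le> L + 1\<close>, a pair across the bridge moves to
  pair 0 or 1 with the same orientation. The upper bounds in the supports hold because the leaf pair
  itself is a configuration.\<close>

lemma reach_leaf_config:
  assumes "(r, L) \<in> params" "z \<in> hconf r L"
  shows "\<exists>k<12. (r, L) \<in> summand_supports ! k \<and> path_component (hconf r L) z (leaf_config k)"
proof -
  have L: "L > 0" "r > 0" using assms by (auto simp: params_def)
  obtain a b where ab: "a \<in> leaves" "b \<in> leaves" "a \<noteq> b" "path_component (hconf r L) z (vpair a b)"
    using reach_leaves[OF L(1) assms(2)] by blast
  have "vpair a b \<in> hconf r L" using path_component_mem(2)[OF ab(4)] .
  then have r: "r \<le> (if stem a = stem b then 2 else L + 2)"
    using L tree_dist_leaves[OF ab(1-3) L(1)] by (simp add: hconf_eq vpair_def)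
  obtain k where k: "k < 12" "leaf_pairs ! k = (a, b)" "stem a = stem b \<longleftrightarrow> 2 \<le> k \<and> k < 6"
    using leaf_pairs_complete[OF ab(1-3)] .
  have config: "leaf_config k = vpair a b" using k by (simp add: leaf_config_def)
  consider "r \<le> 1" | "r > 1" "stem a = stem b \<or> r > L + 1" | "r > 1" "stem a \<noteq> stem b" "r \<le> L + 1"
    by linarith
  then show ?thesis
  proof cases
    case 1
    then have "path_component (hconf r L) z (leaf_config 0)"
      using path_component_trans[OF ab(4) reach_first_leaf_config[OF L(1) 1 ab(1-3)]]
      by (simp add: leaf_config_simps)
    then show ?thesis using 1 L by (intro exI[of _ 0]) (auto simp: summand_supports_nth)
  next
    case 2
    then show ?thesis using ab(4) k L r config
      by (intro exI[of _ k]) (auto simp: summand_supports_nth)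
  next
    case 3
    \<comment> \<open>\<open>a'\<close> and \<open>b'\<close> are the chosen leaves on the sides of
      \<open>a\<close> and \<open>b\<close>. Both points stay on their side, so the resulting pair
      is number 0 or 1.\<close>
    define a' where "a' = (if stem a = Hu then Hu1 else Hv1)"
    define b' where "b' = (if stem a = Hu then Hv1 else Hu1)"
    have 1: "path_component (hconf r L) (vpair a b) (vpair a' b)"
      by (rule path_component_change_leaf_fst)
        (use ab 3 L in \<open>auto simp: leaves_def a'_def\<close>)
    have 2: "path_component (hconf r L) (vpair a' b) (vpair a' b')"
      by (rule path_component_change_leaf_snd)
        (use ab 3 L in \<open>auto simp: leaves_def a'_def b'_def\<close>)
    have "path_component (hconf r L) z (vpair a' b')"
      using path_component_trans[OF ab(4) path_component_trans[OF 1 2]] .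
    moreover have "vpair a' b' = leaf_config (if stem a = Hu then 0 else 1)"
      by (simp add: a'_def b'_def leaf_config_def)
    ultimately show ?thesis using 3 L
      by (intro exI[of _ "if stem a = Hu then 0 else 1"]) (auto simp: summand_supports_nth)
  qed
qed

section \<open>Weights: locally constant invariants of configurations\<close>

definition weight :: "nat \<Rightarrow> hpoint \<times> hpoint \<Rightarrow> bool" where
  "weight i z \<longleftrightarrow> i = 0 \<or> i = 1 \<and> bridge_coord (snd z) < bridge_coord (fst z)
     \<or> 2 \<le> i \<and> 1 < fst z $ fst (leaf_pairs ! i) + snd z $ snd (leaf_pairs ! i)"

text \<open>Intermediate value theorem: a path from one side of the gap to the other would have to
  take the omitted value \<open>(c + d) / 2\<close>.\<close>

lemma path_component_gap:
  fixes g :: "'a::real_normed_vector \<Rightarrow> real"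
  assumes "continuous_on UNIV g" "\<And>z. z \<in> S \<Longrightarrow> g z \<le> c \<or> d \<le> g z" "c < d" "path_component S z z'"
  shows "g z \<le> c \<longleftrightarrow> g z' \<le> c"
proof -
  have "connected_component S z z'"
    using path_component_subset_connected_component[of S z] assms(4) by blast
  then obtain T where T: "connected T" "T \<subseteq> S" "z \<in> T" "z' \<in> T"
    by (auto simp: connected_component_def)
  have conn: "connected (g ` T)"
    using T(1) assms(1) by (meson connected_continuous_image continuous_on_subset top_greatest)
  have *: False if "x \<in> T" "y \<in> T" "g x \<le> c" "\<not> g y \<le> c" for x y
  proof -
    have "d \<le> g y" using that assms(2) T(2) by blast
    then have "(c + d) / 2 \<in> g ` T"
      using connectedD_interval[OF conn, of "g x" "g y" "(c + d) / 2"] that assms(3) by auto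
    then obtain u where u: "u \<in> T" "g u = (c + d) / 2" by auto
    show False using assms(2)[of u] u T(2) assms(3) by (auto simp: field_simps)
  qed
  show ?thesis using *[of z z'] *[of z' z] T by blast
qed

lemma hconf_cases:
  assumes "L > 0" "z \<in> hconf r L"
  obtains e s e' t where "e \<in> hedges" "s \<in> {0..1}" "e' \<in> hedges" "t \<in> {0..1}"
    "z = (edge_point e s, edge_point e' t)" "r \<le> tree_dist L (edge_point e s) (edge_point e' t)"
  using assms by (auto simp: hconf_eq elim!: hgraph_cases)

text \<open>Suppose the first point is strictly further along the bridge. Either the points are on
  leaf edges at opposite ends, and the difference is the whole of \<open>L\<close>; or at least one
  is on the bridge, and then leaf edges contribute at most 1 to the distance, which leaves at least
  \<open>r - 1\<close> for the bridge.\<close>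

lemma bridge_gap:
  assumes "L > 0" "r > 1" "z \<in> hconf r L"
  shows "L * (bridge_coord (fst z) - bridge_coord (snd z)) \<le> 0
    \<or> min L (r - 1) \<le> L * (bridge_coord (fst z) - bridge_coord (snd z))"
proof -
  obtain e s e' t where z: "e \<in> hedges" "s \<in> {0..1}" "e' \<in> hedges" "t \<in> {0..1}"
    "z = (edge_point e s, edge_point e' t)" "r \<le> tree_dist L (edge_point e s) (edge_point e' t)"
    using hconf_cases[OF assms(1,3)] .
  show ?thesis
  proof (cases "bridge_coord (fst z) \<le> bridge_coord (snd z)")
    case True
    then show ?thesis using assms(1) by (simp add: mult_le_0_iff)
  next
    case False
    have "min L (r - 1) \<le> L * (bridge_coord (edge_point e s) - bridge_coord (edge_point e' t))"
      using z(1,3) False z(2,4,6) assms(1,2) unfolding z(5) fst_conv snd_conv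
      by (elim hedges_cases) (simp_all add: tree_dist_def bridge_coord_def edge_point_nth, linarith+)
    then show ?thesis unfolding z(5) by simp
  qed
qed

text \<open>Coordinates are at most 1, so a sum above 1 forces both to be positive and pins the
  points to the leaf edges of \<open>a\<close> and \<open>b\<close>. Their distance is then the sum
  itself, plus \<open>L\<close> if the bridge lies between them.\<close>

lemma leaf_gap:
  assumes "L > 0" "z \<in> hconf r L" "a \<in> leaves" "b \<in> leaves" "a \<noteq> b" "1 < fst z $ a + snd z $ b"
  shows "fst z $ a + snd z $ b + (if stem a = stem b then 0 else L) \<ge> r"
    "fst z $ a + snd z $ b \<le> 2"
proof -
  obtain e s e' t where z: "e \<in> hedges" "s \<in> {0..1}" "e' \<in> hedges" "t \<in> {0..1}"
    "z = (edge_point e s, edge_point e' t)" "r \<le> tree_dist L (edge_point e s) (edge_point e' t)"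
    using hconf_cases[OF assms(1,2)] .
  have nz: "edge_point e s $ a > 0" "edge_point e' t $ b > 0"
  proof -
    have "edge_point e s $ v \<le> 1" "edge_point e' t $ v \<le> 1" for v
      using z(2,4) by (auto simp: edge_point_nth)
    from this(1)[of a] this(2)[of b] assms(6) show "edge_point e s $ a > 0" "edge_point e' t $ b > 0"
      unfolding z(5) fst_conv snd_conv by linarith+
  qed
  have "f = (stem c, c)" if "f \<in> hedges" "c \<in> leaves" "edge_point f w $ c > 0" for f c w
    using that by (elim hedges_cases leavesE) (simp_all add: edge_point_nth)
  then have e: "e = (stem a, a)" "e' = (stem b, b)"
    using nz z(1,3) assms(3,4) by blast+
  have "edge_point e s $ a = s" "edge_point e' t $ b = t"
    unfolding e using assms(3,4) by (auto simp: edge_point_nth leaves_def)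
  then show "fst z $ a + snd z $ b + (if stem a = stem b then 0 else L) \<ge> r"
    "fst z $ a + snd z $ b \<le> 2"
    using z(2,4,6) tree_dist_outward[OF assms(3-5) z(2,4) assms(1)] unfolding z(5) e by auto
qed

lemma leaf_pairs_leaves:
  assumes "i < 12"
  shows "fst (leaf_pairs ! i) \<in> leaves" "snd (leaf_pairs ! i) \<in> leaves"
    "fst (leaf_pairs ! i) \<noteq> snd (leaf_pairs ! i)"
    "stem (fst (leaf_pairs ! i)) = stem (snd (leaf_pairs ! i)) \<longleftrightarrow> 2 \<le> i \<and> i < 6"
  using assms by (cases rule: less_12_cases; simp add: leaves_def)+

lemma weight_path_component:
  assumes "i < 12" "(r, L) \<in> summand_supports ! i" "path_component (hconf r L) z z'"
  shows "weight i z \<longleftrightarrow> weight i z'"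
proof -
  have L: "L > 0" using assms by (simp add: summand_supports_nth)
  consider "i = 0" | "i = 1" | "2 \<le> i" by linarith
  then show ?thesis
  proof cases
    case 1
    then show ?thesis by (simp add: weight_def)
  next
    case 2
    let ?g = "\<lambda>z. L * (bridge_coord (fst z) - bridge_coord (snd z))"
    have "?g z \<le> 0 \<longleftrightarrow> ?g z' \<le> 0"
    proof (rule path_component_gap[OF _ _ _ assms(3)])
      show "continuous_on UNIV ?g"
        unfolding bridge_coord_def
        by (intro continuous_intros bounded_linear.continuous_on[OF bounded_linear_vec_nth])
      show "0 < min L (r - 1)" using L assms(2) 2 by (simp add: summand_supports_nth)
      show "?g z \<le> 0 \<or> min L (r - 1) \<le> ?g z" if "z \<in> hconf r L" for z
        using bridge_gap[OF L _ that] assms(2) 2 by (simp add: summand_supports_nth)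
    qed
    then show ?thesis using L 2 by (auto simp: weight_def mult_le_0_iff)
  next
    case 3
    let ?a = "fst (leaf_pairs ! i)" and ?b = "snd (leaf_pairs ! i)"
    let ?g = "\<lambda>z :: hpoint \<times> hpoint. fst z $ ?a + snd z $ ?b"
    \<comment> \<open>The omitted values lie between the threshold 1 and \<open>d\<close>. The
      support contains precisely the lower bound that makes \<open>1 < d\<close>:
      \<open>1 < r\<close> for two leaves on one side of the bridge, \<open>L + 1 < r\<close> across
      it.\<close>
    define d where "d = r - (if stem ?a = stem ?b then 0 else L)"
    have "?g z \<le> 1 \<longleftrightarrow> ?g z' \<le> 1"
    proof (rule path_component_gap[OF _ _ _ assms(3)])
      show "continuous_on UNIV ?g"
        by (intro continuous_intros bounded_linear.continuous_on[OF bounded_linear_vec_nth])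
      show "1 < d" using assms(1,2) 3
        by (auto simp: summand_supports_nth d_def leaf_pairs_leaves split: if_splits)
      show "?g z \<le> 1 \<or> d \<le> ?g z" if "z \<in> hconf r L" for z
        using leaf_gap(1)[OF L that leaf_pairs_leaves(1-3)[OF assms(1)]]
        by (cases "?g z \<le> 1") (simp_all add: d_def)
    qed
    then show ?thesis using 3 by (auto simp: weight_def)
  qed
qed

text \<open>Row 0 is constant, row 1 also sees the pairs 9 to 11 because their first point is on the
  side of \<open>Hv\<close>, and all other rows are unit rows.\<close>

lemma weight_leaf_config:
  assumes "i < 12" "k < 12"
  shows "weight i (leaf_config k) \<longleftrightarrow>
    i = 0 \<or> i = k \<or> i = 1 \<and> 9 \<le> k"
  using assms by (elim less_12_cases)
    (simp_all add: weight_def leaf_config_def vpair_def bridge_coord_def axis_def)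

lemma leaf_config_in_hconf:
  assumes "k < 12" "(r, L) \<in> summand_supports ! k"
  shows "leaf_config k \<in> hconf r L"
proof -
  have L: "L > 0" using assms by (simp add: summand_supports_nth)
  let ?a = "fst (leaf_pairs ! k)" and ?b = "snd (leaf_pairs ! k)"
  note ab = leaf_pairs_leaves[OF assms(1)]
  have "axis c 1 \<in> hgraph" if "c \<in> leaves" for c
    using edge_point_in_hgraph[OF leaf_edge_in_hedges[OF that], of 1] by (simp add: edge_point_simps)
  then show ?thesis
    using assms ab tree_dist_leaves[OF ab(1-3) L] L
    by (auto simp: hconf_eq leaf_config_def vpair_def summand_supports_nth split: if_splits)
qed

text \<open>Used contrapositively: a weight whose support is entered between \<open>p\<close> and
  \<open>q\<close> vanishes at \<open>p\<close>. Lower bounds on \<open>r\<close> pass from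
  \<open>q\<close> to \<open>p\<close>, where \<open>r\<close> is larger and \<open>L\<close>
  smaller. The bound \<open>r \<le> L + 2\<close> holds since there is a configuration at all, and
  \<open>r \<le> 2\<close> since for \<open>2 \<le> i < 6\<close> the weight places both points on
  leaf edges at the same branch vertex.\<close>

lemma support_of_weight:
  assumes "i < 12" "p \<in> params" "p \<preceq> q" "q \<in> summand_supports ! i" "z \<in> hconf (fst p) (snd p)" "weight i z"
  shows "p \<in> summand_supports ! i"
proof -
  obtain r L where p: "p = (r, L)" by (cases p)
  obtain r' L' where q: "q = (r', L')" by (cases q)
  have L: "L > 0" "r > 0" using assms(2) p by (auto simp: params_def)
  have le: "r' \<le> r" "L \<le> L'" using assms(3) p q by (auto simp: param_le_def)
  obtain k where k: "k < 12" "(r, L) \<in> summand_supports ! k"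
    using reach_leaf_config[of r L z] assms p by auto
  then have "r \<le> L + 2" using L by (auto simp: summand_supports_nth split: if_splits)
  moreover have "r \<le> 2" if "2 \<le> i" "i < 6"
    using leaf_gap[OF L(1) _ leaf_pairs_leaves(1-3)[OF assms(1)], of z r]
      assms(5,6) that leaf_pairs_leaves(4)[OF assms(1)] p by (auto simp: weight_def)
  ultimately show ?thesis
    using assms(1,4) L le unfolding p q by (auto simp: summand_supports_nth split: if_splits)
qed


section \<open>Vector spaces and persistence modules\<close>

lemma field_ring_simps [simp]:
  "carrier field_ring = UNIV" "\<zero>\<^bsub>field_ring\<^esub> = (0 :: 'f::field)" "\<one>\<^bsub>field_ring\<^esub> = (1 :: 'f)"
  "(x :: 'f) \<oplus>\<^bsub>field_ring\<^esub> y = x + y" "x \<otimes>\<^bsub>field_ring\<^esub> y = x * y"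
  by (simp_all add: field_ring_def)

lemma cring_field_ring: "cring (field_ring :: 'f::field ring)"
proof (rule cringI)
  show "abelian_group (field_ring :: 'f ring)"
  proof (rule abelian_groupI)
    show "\<exists>y\<in>carrier field_ring. y \<oplus>\<^bsub>field_ring\<^esub> x = \<zero>\<^bsub>field_ring\<^esub>" for x :: 'f
      by (auto intro!: exI[of _ "- x"])
  qed (auto simp: algebra_simps)
  show "Group.comm_monoid (field_ring :: 'f ring)"
    by (rule comm_monoidI) (auto simp: algebra_simps)
qed (auto simp: algebra_simps)

text \<open>Additive inverses are supplied by \<open>(- 1) \<odot> x\<close>, because
  \<open>0 \<odot> x\<close> is assumed to be zero.\<close>

lemma vec_spaceI:
  fixes V :: "('f::field, 'v) module" (structure)
  assumes "\<zero> \<in> carrier V"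
    and "\<And>x y. x \<in> carrier V \<Longrightarrow> y \<in> carrier V \<Longrightarrow> x \<oplus> y \<in> carrier V"
    and "\<And>k x. x \<in> carrier V \<Longrightarrow> k \<odot> x \<in> carrier V"
    and "\<And>x y z. x \<in> carrier V \<Longrightarrow> y \<in> carrier V \<Longrightarrow> z \<in> carrier V \<Longrightarrow> (x \<oplus> y) \<oplus> z = x \<oplus> (y \<oplus> z)"
    and "\<And>x y. x \<in> carrier V \<Longrightarrow> y \<in> carrier V \<Longrightarrow> x \<oplus> y = y \<oplus> x"
    and "\<And>x. x \<in> carrier V \<Longrightarrow> \<zero> \<oplus> x = x"
    and "\<And>k l x. x \<in> carrier V \<Longrightarrow> (k + l) \<odot> x = k \<odot> x \<oplus> l \<odot> x"
    and "\<And>k x y. x \<in> carrier V \<Longrightarrow> y \<in> carrier V \<Longrightarrow> k \<odot> (x \<oplus> y) = k \<odot> x \<oplus> k \<odot> y"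
    and "\<And>k l x. x \<in> carrier V \<Longrightarrow> (k * l) \<odot> x = k \<odot> (l \<odot> x)"
    and "\<And>x. x \<in> carrier V \<Longrightarrow> 1 \<odot> x = x"
    and "\<And>x. x \<in> carrier V \<Longrightarrow> 0 \<odot> x = \<zero>"
  shows "vec_space V"
  unfolding vec_space_def
proof (rule moduleI)
  show "abelian_group V"
  proof (rule abelian_groupI)
    show "\<exists>y\<in>carrier V. y \<oplus> x = \<zero>" if "x \<in> carrier V" for x
    proof
      have "(- 1) \<odot> x \<oplus> x = (- 1 + 1) \<odot> x" using assms(7)[OF that, of "- 1" 1] assms(10)[OF that] by simp
      then show "(- 1) \<odot> x \<oplus> x = \<zero>" using assms(11)[OF that] by simp
    qed (use assms that in auto)
  qed (use assms in auto)
qed (use assms cring_field_ring in auto)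

locale vspace =
  fixes V :: "('f::field, 'v) module" (structure)
  assumes vec_space: "vec_space V"

sublocale vspace \<subseteq> module "field_ring :: 'f::field ring" V
  using vec_space by (simp add: vec_space_def)

context vspace
begin

lemma scale_closed: "x \<in> carrier V \<Longrightarrow> k \<odot> x \<in> carrier V"
  using smult_closed[of k x] by simp

lemma scale_zero: "x \<in> carrier V \<Longrightarrow> 0 \<odot> x = \<zero>"
  using smult_l_null[of x] by simp

lemma scale_zero_right: "k \<odot> \<zero> = \<zero>"
  using smult_r_null[of k] by simp

lemma scale_one: "x \<in> carrier V \<Longrightarrow> 1 \<odot> x = x"
  using smult_one[of x] by simp

lemma scale_mult: "x \<in> carrier V \<Longrightarrow> (k * l) \<odot> x = k \<odot> (l \<odot> x)"
  using smult_assoc1[of k l x] by simp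

lemma scale_add_left: "x \<in> carrier V \<Longrightarrow> (k + l) \<odot> x = k \<odot> x \<oplus> l \<odot> x"
  using smult_l_distr[of k l x] by simp

lemma scale_add_right: "x \<in> carrier V \<Longrightarrow> y \<in> carrier V \<Longrightarrow> k \<odot> (x \<oplus> y) = k \<odot> x \<oplus> k \<odot> y"
  using smult_r_distr[of k x y] by simp

lemma cancel_scale: "x \<in> carrier V \<Longrightarrow> k \<odot> x = \<zero> \<Longrightarrow> k \<noteq> 0 \<Longrightarrow> x = \<zero>"
  using scale_mult[of x "inverse k" k] scale_one[of x] scale_zero_right by simp

lemma add_minus_cancel: "x \<in> carrier V \<Longrightarrow> y \<in> carrier V \<Longrightarrow> (x \<oplus> (- 1) \<odot> y) \<oplus> y = x"
proof -
  assume xy: "x \<in> carrier V" "y \<in> carrier V"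
  have "(- 1) \<odot> y \<oplus> y = \<zero>"
    using scale_add_left[of y "- 1" 1] scale_one[of y] scale_zero[of y] xy by simp
  then show ?thesis using xy scale_closed by (simp add: a_assoc)
qed

lemma minus_add_cancel: "x \<in> carrier V \<Longrightarrow> y \<in> carrier V \<Longrightarrow> (x \<oplus> y) \<oplus> (- 1) \<odot> x = y"
proof -
  assume xy: "x \<in> carrier V" "y \<in> carrier V"
  have "x \<oplus> (- 1) \<odot> x = \<zero>"
    using scale_add_left[of x 1 "- 1"] scale_one[of x] scale_zero[of x] xy by simp
  moreover have "(x \<oplus> y) \<oplus> (- 1) \<odot> x = y \<oplus> (x \<oplus> (- 1) \<odot> x)"
    using xy scale_closed a_comm[of x y] by (simp add: a_assoc)
  ultimately show ?thesis using xy by simp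
qed

end

lemma vspaceI: "vec_space V \<Longrightarrow> vspace V"
  by (simp add: vspace_def)

lemma linear_mapsD:
  assumes "f \<in> linear_maps V W"
  shows "x \<in> carrier V \<Longrightarrow> f x \<in> carrier W"
    and "x \<in> carrier V \<Longrightarrow> y \<in> carrier V \<Longrightarrow> f (x \<oplus>\<^bsub>V\<^esub> y) = f x \<oplus>\<^bsub>W\<^esub> f y"
    and "x \<in> carrier V \<Longrightarrow> f (k \<odot>\<^bsub>V\<^esub> x) = k \<odot>\<^bsub>W\<^esub> f x"
  using assms by (auto simp: linear_maps_def)

lemma linear_mapsI:
  assumes "\<And>x. x \<in> carrier V \<Longrightarrow> f x \<in> carrier W"
    and "\<And>x y. x \<in> carrier V \<Longrightarrow> y \<in> carrier V \<Longrightarrow> f (x \<oplus>\<^bsub>V\<^esub> y) = f x \<oplus>\<^bsub>W\<^esub> f y"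
    and "\<And>k x. x \<in> carrier V \<Longrightarrow> f (k \<odot>\<^bsub>V\<^esub> x) = k \<odot>\<^bsub>W\<^esub> f x"
  shows "f \<in> linear_maps V W"
  using assms by (auto simp: linear_maps_def)

lemma linear_maps_compose:
  assumes "f \<in> linear_maps V W" "g \<in> linear_maps W U"
  shows "(\<lambda>x. g (f x)) \<in> linear_maps V U"
  using linear_mapsD[OF assms(1)] linear_mapsD[OF assms(2)] by (intro linear_mapsI) auto

lemma linear_maps_zero:
  assumes "vec_space V" "vec_space W" "f \<in> linear_maps V W"
  shows "f \<zero>\<^bsub>V\<^esub> = \<zero>\<^bsub>W\<^esub>"
proof -
  interpret V: vspace V by (rule vspaceI) fact
  interpret W: vspace W by (rule vspaceI) fact
  have "f \<zero>\<^bsub>V\<^esub> = f (0 \<odot>\<^bsub>V\<^esub> \<zero>\<^bsub>V\<^esub>)" by (simp add: V.scale_zero_right)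
  also have "\<dots> = \<zero>\<^bsub>W\<^esub>"
    unfolding linear_mapsD(3)[OF assms(3) V.zero_closed]
    by (rule W.scale_zero[OF linear_mapsD(1)[OF assms(3) V.zero_closed]])
  finally show ?thesis .
qed

lemma persistence_moduleD:
  assumes "persistence_module M" "p \<in> params"
  shows "vec_space (obj M p)"
    and "q \<in> params \<Longrightarrow> p \<preceq> q \<Longrightarrow> mor M p q \<in> linear_maps (obj M p) (obj M q)"
  using assms by (auto simp: persistence_module_def)

section \<open>Homomorphisms, direct sums and submodules\<close>

definition pmod_hom :: "('f::field, 'v) pmod \<Rightarrow> ('f, 'w) pmod \<Rightarrow> (param \<Rightarrow> 'v \<Rightarrow> 'w) \<Rightarrow> bool" where
  "pmod_hom M N f \<longleftrightarrow> (\<forall>p\<in>params. f p \<in> linear_maps (obj M p) (obj N p)) \<and>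
     (\<forall>p\<in>params. \<forall>q\<in>params. p \<preceq> q \<longrightarrow>
        (\<forall>x\<in>carrier (obj M p). f q (mor M p q x) = mor N p q (f p x)))"

lemma pmod_homD:
  assumes "pmod_hom M N f" "p \<in> params"
  shows "f p \<in> linear_maps (obj M p) (obj N p)"
    and "x \<in> carrier (obj M p) \<Longrightarrow> f p x \<in> carrier (obj N p)"
    and "q \<in> params \<Longrightarrow> p \<preceq> q \<Longrightarrow> x \<in> carrier (obj M p) \<Longrightarrow> f q (mor M p q x) = mor N p q (f p x)"
  using assms linear_mapsD(1) by (fastforce simp: pmod_hom_def)+

lemma pmod_homI:
  assumes "\<And>p. p \<in> params \<Longrightarrow> f p \<in> linear_maps (obj M p) (obj N p)"
    and "\<And>p q x. p \<in> params \<Longrightarrow> q \<in> params \<Longrightarrow> p \<preceq> q \<Longrightarrow> x \<in> carrier (obj M p) \<Longrightarrow>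
      f q (mor M p q x) = mor N p q (f p x)"
  shows "pmod_hom M N f"
  using assms by (simp add: pmod_hom_def)

lemma pmod_hom_compose:
  assumes "pmod_hom M N f" "pmod_hom N R g"
  shows "pmod_hom M R (\<lambda>p x. g p (f p x))"
proof (rule pmod_homI)
  show "(\<lambda>x. g p (f p x)) \<in> linear_maps (obj M p) (obj R p)" if "p \<in> params" for p
    by (rule linear_maps_compose[OF pmod_homD(1)[OF assms(1) that] pmod_homD(1)[OF assms(2) that]])
  show "g q (f q (mor M p q x)) = mor R p q (g p (f p x))"
    if "p \<in> params" "q \<in> params" "p \<preceq> q" "x \<in> carrier (obj M p)" for p q x
    using pmod_homD(2,3)[OF assms(1)] pmod_homD(3)[OF assms(2)] that by simp
qed

lemma pmod_isoI:
  assumes "pmod_hom M N f" "\<And>p. p \<in> params \<Longrightarrow> bij_betw (f p) (carrier (obj M p)) (carrier (obj N p))"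
  shows "M \<simeq>\<^sub>P N"
  using assms unfolding pmod_iso_def pmod_hom_def by blast

lemma pmod_isoI_inverse:
  assumes "pmod_hom M N f" "pmod_hom N M g"
    and "\<And>p x. p \<in> params \<Longrightarrow> x \<in> carrier (obj M p) \<Longrightarrow> g p (f p x) = x"
    and "\<And>p y. p \<in> params \<Longrightarrow> y \<in> carrier (obj N p) \<Longrightarrow> f p (g p y) = y"
  shows "M \<simeq>\<^sub>P N"
proof (rule pmod_isoI[OF assms(1)])
  show "bij_betw (f p) (carrier (obj M p)) (carrier (obj N p))" if "p \<in> params" for p
    by (rule bij_betw_byWitness[where f' = "g p"])
      (use assms(3,4)[OF that] pmod_homD(2)[OF assms(1) that] pmod_homD(2)[OF assms(2) that] in auto)
qed

text \<open>Linearity and naturality of the pointwise inverse come from evaluating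
  \<open>g p (f p z) = z\<close> at the claimed value \<open>z\<close>.\<close>

lemma pmod_isoE:
  assumes "persistence_module M" "M \<simeq>\<^sub>P N"
  obtains f g where "pmod_hom M N f" "pmod_hom N M g"
    "\<And>p x. p \<in> params \<Longrightarrow> x \<in> carrier (obj M p) \<Longrightarrow> g p (f p x) = x"
    "\<And>p y. p \<in> params \<Longrightarrow> y \<in> carrier (obj N p) \<Longrightarrow> f p (g p y) = y"
proof -
  obtain f where f: "pmod_hom M N f"
    and bij: "\<And>p. p \<in> params \<Longrightarrow> bij_betw (f p) (carrier (obj M p)) (carrier (obj N p))"
    using assms(2) unfolding pmod_iso_def pmod_hom_def by blast
  define g where "g p = inv_into (carrier (obj M p)) (f p)" for p
  have gf: "g p (f p x) = x" if "p \<in> params" "x \<in> carrier (obj M p)" for p x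
    unfolding g_def using bij[OF that(1)] that(2) by (simp add: bij_betw_def)
  have fg: "f p (g p y) = y" "g p y \<in> carrier (obj M p)"
    if "p \<in> params" "y \<in> carrier (obj N p)" for p y
    unfolding g_def using bij[OF that(1)] that(2)
    by (auto simp: bij_betw_def f_inv_into_f inv_into_into)
  have "pmod_hom N M g"
  proof (rule pmod_homI)
    fix p assume p: "p \<in> params"
    interpret M: vspace "obj M p"
      using persistence_moduleD(1)[OF assms(1) p] by (rule vspaceI)
    note lin = linear_mapsD[OF pmod_homD(1)[OF f p]]
    show "g p \<in> linear_maps (obj N p) (obj M p)"
    proof (rule linear_mapsI)
      fix x y assume xy: "x \<in> carrier (obj N p)" "y \<in> carrier (obj N p)"
      have "g p (f p (g p x \<oplus>\<^bsub>obj M p\<^esub> g p y)) = g p x \<oplus>\<^bsub>obj M p\<^esub> g p y"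
        using xy fg[OF p] p by (intro gf) auto
      then show "g p (x \<oplus>\<^bsub>obj N p\<^esub> y) = g p x \<oplus>\<^bsub>obj M p\<^esub> g p y"
        using xy fg[OF p] lin(2) by simp
    next
      fix k x assume x: "x \<in> carrier (obj N p)"
      have "g p (f p (k \<odot>\<^bsub>obj M p\<^esub> g p x)) = k \<odot>\<^bsub>obj M p\<^esub> g p x"
        using x fg[OF p] p M.scale_closed by (intro gf) auto
      then show "g p (k \<odot>\<^bsub>obj N p\<^esub> x) = k \<odot>\<^bsub>obj M p\<^esub> g p x"
        using x fg[OF p] lin(3) by simp
    qed (use fg[OF p] in auto)
  next
    fix p q x assume pq: "p \<in> params" "q \<in> params" "p \<preceq> q" and x: "x \<in> carrier (obj N p)"
    have "mor M p q (g p x) \<in> carrier (obj M q)"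
      using linear_mapsD(1)[OF persistence_moduleD(2)[OF assms(1) pq]] fg(2)[OF pq(1) x] by simp
    then have "g q (f q (mor M p q (g p x))) = mor M p q (g p x)"
      using gf pq by simp
    then show "g q (mor N p q x) = mor M p q (g p x)"
      using pmod_homD(3)[OF f pq(1,2,3) fg(2)[OF pq(1) x]] fg(1)[OF pq(1) x] by simp
  qed
  then show ?thesis using that f gf fg(1) by blast
qed

lemma direct_sum_simps [simp]:
  "carrier (obj (direct_sum J N) p) =
    {x \<in> \<Pi>\<^sub>E j\<in>J. carrier (obj (N j) p). finite {j \<in> J. x j \<noteq> \<zero>\<^bsub>obj (N j) p\<^esub>}}"
  "\<zero>\<^bsub>obj (direct_sum J N) p\<^esub> = (\<lambda>j\<in>J. \<zero>\<^bsub>obj (N j) p\<^esub>)"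
  "x \<oplus>\<^bsub>obj (direct_sum J N) p\<^esub> y = (\<lambda>j\<in>J. x j \<oplus>\<^bsub>obj (N j) p\<^esub> y j)"
  "k \<odot>\<^bsub>obj (direct_sum J N) p\<^esub> x = (\<lambda>j\<in>J. k \<odot>\<^bsub>obj (N j) p\<^esub> x j)"
  "mor (direct_sum J N) p q x = (\<lambda>j\<in>J. mor (N j) p q (x j))"
  by (simp_all add: direct_sum_def)

definition inclusion :: "'j set \<Rightarrow> ('j \<Rightarrow> ('f::field, 'v) pmod) \<Rightarrow> 'j \<Rightarrow> param \<Rightarrow> 'v \<Rightarrow> 'j \<Rightarrow> 'v" where
  "inclusion J N j p x = (\<lambda>i\<in>J. if i = j then x else \<zero>\<^bsub>obj (N i) p\<^esub>)"

lemma pmod_hom_projection: "j \<in> J \<Longrightarrow> pmod_hom (direct_sum J N) (N j) (\<lambda>p x. x j)"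
  by (intro pmod_homI linear_mapsI) auto

lemma pmod_hom_inclusion:
  assumes "j \<in> J" "\<And>i. i \<in> J \<Longrightarrow> persistence_module (N i)"
  shows "pmod_hom (N j) (direct_sum J N) (inclusion J N j)"
proof (intro pmod_homI linear_mapsI)
  fix p assume p: "p \<in> params"
  have V: "vspace (obj (N i) p)" if "i \<in> J" for i
    using persistence_moduleD(1)[OF assms(2)[OF that] p] by (rule vspaceI)
  fix x assume x: "x \<in> carrier (obj (N j) p)"
  have z: "\<zero>\<^bsub>obj (N i) p\<^esub> \<in> carrier (obj (N i) p)" if "i \<in> J" for i
  proof -
    interpret V: vspace "obj (N i) p" using V[OF that] .
    show ?thesis by simp
  qed
  have "{i \<in> J. inclusion J N j p x i \<noteq> \<zero>\<^bsub>obj (N i) p\<^esub>} \<subseteq> {j}"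
    by (auto simp: inclusion_def)
  then have "finite {i \<in> J. inclusion J N j p x i \<noteq> \<zero>\<^bsub>obj (N i) p\<^esub>}"
    using finite_subset by blast
  then show "inclusion J N j p x \<in> carrier (obj (direct_sum J N) p)"
    using x z by (auto simp: inclusion_def)
  show "inclusion J N j p (k \<odot>\<^bsub>obj (N j) p\<^esub> x) = k \<odot>\<^bsub>obj (direct_sum J N) p\<^esub> inclusion J N j p x" for k
    by (auto simp: inclusion_def fun_eq_iff vspace.scale_zero_right[OF V])
  fix y assume y: "y \<in> carrier (obj (N j) p)"
  have "\<zero>\<^bsub>obj (N i) p\<^esub> = \<zero>\<^bsub>obj (N i) p\<^esub> \<oplus>\<^bsub>obj (N i) p\<^esub> \<zero>\<^bsub>obj (N i) p\<^esub>" if "i \<in> J" for i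
  proof -
    interpret V: vspace "obj (N i) p" using V[OF that] .
    show ?thesis by simp
  qed
  then show "inclusion J N j p (x \<oplus>\<^bsub>obj (N j) p\<^esub> y) =
      inclusion J N j p x \<oplus>\<^bsub>obj (direct_sum J N) p\<^esub> inclusion J N j p y"
    by (auto simp: inclusion_def fun_eq_iff)
next
  fix p q x assume pq: "p \<in> params" "q \<in> params" "p \<preceq> q" "x \<in> carrier (obj (N j) p)"
  have "mor (N i) p q \<zero>\<^bsub>obj (N i) p\<^esub> = \<zero>\<^bsub>obj (N i) q\<^esub>" if "i \<in> J" for i
    using linear_maps_zero[OF persistence_moduleD(1)[OF assms(2)[OF that] pq(1)]
        persistence_moduleD(1)[OF assms(2)[OF that] pq(2)] persistence_moduleD(2)[OF assms(2)[OF that] pq(1-3)]] .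
  then show "inclusion J N j q (mor (N j) p q x) = mor (direct_sum J N) p q (inclusion J N j p x)"
    by (auto simp: inclusion_def fun_eq_iff)
qed

definition sub_pmod :: "('f::field, 'v) pmod \<Rightarrow> (param \<Rightarrow> 'v set) \<Rightarrow> ('f, 'v) pmod" where
  "sub_pmod M C = \<lparr>obj = (\<lambda>p. (obj M p)\<lparr>carrier := C p\<rparr>), mor = mor M\<rparr>"

lemma sub_pmod_simps [simp]:
  "carrier (obj (sub_pmod M C) p) = C p" "\<zero>\<^bsub>obj (sub_pmod M C) p\<^esub> = \<zero>\<^bsub>obj M p\<^esub>"
  "x \<oplus>\<^bsub>obj (sub_pmod M C) p\<^esub> y = x \<oplus>\<^bsub>obj M p\<^esub> y"
  "k \<odot>\<^bsub>obj (sub_pmod M C) p\<^esub> x = k \<odot>\<^bsub>obj M p\<^esub> x"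
  "mor (sub_pmod M C) = mor M"
  by (simp_all add: sub_pmod_def)

lemma persistence_module_sub_pmod:
  assumes "persistence_module M"
    and "\<And>p. p \<in> params \<Longrightarrow> C p \<subseteq> carrier (obj M p)"
    and "\<And>p. p \<in> params \<Longrightarrow> \<zero>\<^bsub>obj M p\<^esub> \<in> C p"
    and "\<And>p x y. p \<in> params \<Longrightarrow> x \<in> C p \<Longrightarrow> y \<in> C p \<Longrightarrow> x \<oplus>\<^bsub>obj M p\<^esub> y \<in> C p"
    and "\<And>p k x. p \<in> params \<Longrightarrow> x \<in> C p \<Longrightarrow> k \<odot>\<^bsub>obj M p\<^esub> x \<in> C p"
    and "\<And>p q x. p \<in> params \<Longrightarrow> q \<in> params \<Longrightarrow> p \<preceq> q \<Longrightarrow> x \<in> C p \<Longrightarrow> mor M p q x \<in> C q"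
  shows "persistence_module (sub_pmod M C)"
  unfolding persistence_module_def
proof (intro conjI ballI impI allI)
  fix p assume p: "p \<in> params"
  interpret M: vspace "obj M p"
    using persistence_moduleD(1)[OF assms(1) p] by (rule vspaceI)
  have C: "x \<in> carrier (obj M p)" if "x \<in> C p" for x using assms(2)[OF p] that by blast
  show "vec_space (obj (sub_pmod M C) p)"
    by (rule vec_spaceI)
      (use assms(3-5)[OF p] C in \<open>auto simp: M.a_ac M.scale_zero M.scale_one M.scale_mult
        M.scale_add_left M.scale_add_right\<close>)
  show "mor (sub_pmod M C) p p x = x" if "x \<in> carrier (obj (sub_pmod M C) p)" for x
    using assms(1) p C that by (simp add: persistence_module_def)
  fix q assume q: "q \<in> params"
  show "mor (sub_pmod M C) p q \<in> linear_maps (obj (sub_pmod M C) p) (obj (sub_pmod M C) q)"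
    if "p \<preceq> q"
    using linear_mapsD[OF persistence_moduleD(2)[OF assms(1) p q that]] assms(6)[OF p q that] C
    by (intro linear_mapsI) auto
  fix s x assume "s \<in> params" "p \<preceq> q \<and> q \<preceq> s" "x \<in> carrier (obj (sub_pmod M C) p)"
  then show "mor (sub_pmod M C) p s x = mor (sub_pmod M C) q s (mor (sub_pmod M C) p q x)"
    using assms(1) p q C unfolding persistence_module_def by simp
qed

text \<open>The image and the kernel of an idempotent endomorphism are complementary summands.\<close>

lemma indecomposable_idempotent:
  fixes M :: "('f::field, 'v) pmod"
  assumes "indecomposable M" "pmod_hom M M e"
    and idem: "\<And>p x. p \<in> params \<Longrightarrow> x \<in> carrier (obj M p) \<Longrightarrow> e p (e p x) = e p x"
  shows "(\<forall>p\<in>params. \<forall>x\<in>carrier (obj M p). e p x = \<zero>\<^bsub>obj M p\<^esub>) \<or>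
    (\<forall>p\<in>params. \<forall>x\<in>carrier (obj M p). e p x = x)"
proof -
  have M: "persistence_module M" using assms(1) by (simp add: indecomposable_def)
  have V: "vspace (obj M p)" if "p \<in> params" for p
    using persistence_moduleD(1)[OF M that] by (rule vspaceI)
  have e0: "e p \<zero>\<^bsub>obj M p\<^esub> = \<zero>\<^bsub>obj M p\<^esub>" if "p \<in> params" for p
    using linear_maps_zero[OF persistence_moduleD(1)[OF M that] persistence_moduleD(1)[OF M that]
      pmod_homD(1)[OF assms(2) that]] .
  note lin = linear_mapsD[OF pmod_homD(1)[OF assms(2)]]
  define A where "A = sub_pmod M (\<lambda>p. {x \<in> carrier (obj M p). e p x = x})"
  define B where "B = sub_pmod M (\<lambda>p. {x \<in> carrier (obj M p). e p x = \<zero>\<^bsub>obj M p\<^esub>})"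
  have closed: "\<zero>\<^bsub>obj M p\<^esub> \<in> carrier (obj M p)" "\<zero>\<^bsub>obj M p\<^esub> \<oplus>\<^bsub>obj M p\<^esub> \<zero>\<^bsub>obj M p\<^esub> = \<zero>\<^bsub>obj M p\<^esub>"
    "\<And>x y. x \<in> carrier (obj M p) \<Longrightarrow> y \<in> carrier (obj M p) \<Longrightarrow> x \<oplus>\<^bsub>obj M p\<^esub> y \<in> carrier (obj M p)"
    "\<And>k x. x \<in> carrier (obj M p) \<Longrightarrow> k \<odot>\<^bsub>obj M p\<^esub> x \<in> carrier (obj M p)" if "p \<in> params" for p
  proof -
    interpret vspace "obj M p" using V[OF that] .
    show "\<zero>\<^bsub>obj M p\<^esub> \<in> carrier (obj M p)" "\<zero>\<^bsub>obj M p\<^esub> \<oplus>\<^bsub>obj M p\<^esub> \<zero>\<^bsub>obj M p\<^esub> = \<zero>\<^bsub>obj M p\<^esub>"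
    "\<And>x y. x \<in> carrier (obj M p) \<Longrightarrow> y \<in> carrier (obj M p) \<Longrightarrow> x \<oplus>\<^bsub>obj M p\<^esub> y \<in> carrier (obj M p)"
    "\<And>k x. x \<in> carrier (obj M p) \<Longrightarrow> k \<odot>\<^bsub>obj M p\<^esub> x \<in> carrier (obj M p)"
      using scale_closed by auto
  qed
  have mor0: "mor M p q \<zero>\<^bsub>obj M p\<^esub> = \<zero>\<^bsub>obj M q\<^esub>" if "p \<in> params" "q \<in> params" "p \<preceq> q" for p q
    using linear_maps_zero[OF persistence_moduleD(1)[OF M that(1)] persistence_moduleD(1)[OF M that(2)]
        persistence_moduleD(2)[OF M that]] .
  have morc: "mor M p q x \<in> carrier (obj M q)"
    if "p \<in> params" "q \<in> params" "p \<preceq> q" "x \<in> carrier (obj M p)" for p q x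
    using linear_mapsD(1)[OF persistence_moduleD(2)[OF M that(1-3)] that(4)] .
  have A: "persistence_module A"
    unfolding A_def
  proof (rule persistence_module_sub_pmod[OF M], goal_cases)
    case (2 p)
    then show ?case using closed(1) e0 by simp
  next
    case (3 p x y)
    then show ?case using closed(3)[OF 3(1)] lin(2)[OF 3(1)] by simp
  next
    case (4 p k x)
    then show ?case using closed(4)[OF 4(1)] lin(3)[OF 4(1)] by simp
  next
    case (5 p q x)
    then show ?case using morc[OF 5(1-3)] pmod_homD(3)[OF assms(2) 5(1-3)] by simp
  qed auto
  have B: "persistence_module B"
    unfolding B_def
  proof (rule persistence_module_sub_pmod[OF M], goal_cases)
    case (2 p)
    then show ?case using closed(1) e0 by simp
  next
    case (3 p x y)
    then show ?case using closed(2,3)[OF 3(1)] lin(2)[OF 3(1)] by simp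
  next
    case (4 p k x)
    then show ?case using closed(4)[OF 4(1)] lin(3)[OF 4(1)] vspace.scale_zero_right[OF V[OF 4(1)]] by simp
  next
    case (5 p q x)
    then show ?case using morc[OF 5(1-3)] pmod_homD(3)[OF assms(2) 5(1-3)] mor0[OF 5(1-3)] by simp
  qed auto
  let ?N = "\<lambda>i. if i then A else B"
  \<comment> \<open>A vector is split as \<open>e x\<close> plus \<open>x - e x\<close>, the
    difference being written with the scalar \<open>- 1\<close>. The index \<open>True\<close>
    labels the image of \<open>e\<close> and \<open>False\<close> its kernel.\<close>
  define f where "f p x = (\<lambda>i. if i then e p x else x \<oplus>\<^bsub>obj M p\<^esub> (- 1) \<odot>\<^bsub>obj M p\<^esub> e p x)" for p x
  define g where "g p y = y True \<oplus>\<^bsub>obj M p\<^esub> y False" for p y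
  have fst: "x \<in> carrier (obj (direct_sum UNIV ?N) p) \<longleftrightarrow> x True \<in> carrier (obj A p) \<and> x False \<in> carrier (obj B p)" for p x
    by (auto simp: PiE_def Pi_def)
  have ker: "e p (x \<oplus>\<^bsub>obj M p\<^esub> (- 1) \<odot>\<^bsub>obj M p\<^esub> e p x) = \<zero>\<^bsub>obj M p\<^esub>"
    if p: "p \<in> params" and x: "x \<in> carrier (obj M p)" for p x
  proof -
    interpret vspace "obj M p" using V[OF p] .
    have "e p (x \<oplus>\<^bsub>obj M p\<^esub> (- 1) \<odot>\<^bsub>obj M p\<^esub> e p x) = e p x \<oplus>\<^bsub>obj M p\<^esub> (- 1) \<odot>\<^bsub>obj M p\<^esub> e p x"
      using lin[OF p] closed[OF p] x idem[OF p x] by simp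
    also have "\<dots> = \<zero>\<^bsub>obj M p\<^esub>"
      using minus_add_cancel[of "e p x" "\<zero>\<^bsub>obj M p\<^esub>"] lin(1)[OF p x] closed(1)[OF p] by simp
    finally show ?thesis .
  qed
  have fc: "f p x \<in> carrier (obj (direct_sum UNIV ?N) p)" if p: "p \<in> params" and x: "x \<in> carrier (obj M p)" for p x
    unfolding fst unfolding f_def A_def B_def
    using ker[OF p x] idem[OF p x] lin(1)[OF p] closed(3,4)[OF p] x by simp
  have hom_f: "pmod_hom M (direct_sum UNIV ?N) f"
  proof (intro pmod_homI linear_mapsI)
    fix p assume p: "p \<in> params"
    interpret vspace "obj M p" using V[OF p] .
    fix x assume x: "x \<in> carrier (obj M p)"
    show "f p x \<in> carrier (obj (direct_sum UNIV ?N) p)" by (rule fc[OF p x])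
    show "f p (k \<odot>\<^bsub>obj M p\<^esub> x) = k \<odot>\<^bsub>obj (direct_sum UNIV ?N) p\<^esub> f p x" for k
      using lin[OF p] closed[OF p] x scale_mult[of "e p x" "- 1" k] scale_mult[of "e p x" k "- 1"]
      by (auto simp: f_def fun_eq_iff A_def B_def scale_add_right)
    fix y assume y: "y \<in> carrier (obj M p)"
    have c: "e p x \<in> carrier (obj M p)" "e p y \<in> carrier (obj M p)"
      "(- 1) \<odot>\<^bsub>obj M p\<^esub> e p x \<in> carrier (obj M p)" "(- 1) \<odot>\<^bsub>obj M p\<^esub> e p y \<in> carrier (obj M p)"
      using lin(1)[OF p] closed(4)[OF p] x y by auto
    then show "f p (x \<oplus>\<^bsub>obj M p\<^esub> y) = f p x \<oplus>\<^bsub>obj (direct_sum UNIV ?N) p\<^esub> f p y"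
      using lin(2)[OF p x y] x y
      by (auto simp: f_def fun_eq_iff A_def B_def scale_add_right a_ac)
  next
    fix p q x assume pq: "p \<in> params" "q \<in> params" "p \<preceq> q" "x \<in> carrier (obj M p)"
    note mlin = linear_mapsD[OF persistence_moduleD(2)[OF M pq(1-3)]]
    show "f q (mor M p q x) = mor (direct_sum UNIV ?N) p q (f p x)"
      using pmod_homD(3)[OF assms(2) pq] mlin lin(1)[OF pq(1)] closed[OF pq(1)] pq(4)
      by (auto simp: f_def fun_eq_iff A_def B_def)
  qed
  have "bij_betw (f p) (carrier (obj M p)) (carrier (obj (direct_sum UNIV ?N) p))" if p: "p \<in> params" for p
  proof (rule bij_betw_byWitness[where f' = "g p"])
    interpret vspace "obj M p" using V[OF p] .
    show "\<forall>x\<in>carrier (obj M p). g p (f p x) = x"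
    proof
      fix x assume x: "x \<in> carrier (obj M p)"
      have c: "e p x \<in> carrier (obj M p)" "x \<oplus>\<^bsub>obj M p\<^esub> (- 1) \<odot>\<^bsub>obj M p\<^esub> e p x \<in> carrier (obj M p)"
        using lin(1)[OF p] closed[OF p] x by auto
      show "g p (f p x) = x"
        using add_minus_cancel[OF x c(1)] a_comm[OF c] by (simp add: f_def g_def)
    qed
    show "\<forall>y\<in>carrier (obj (direct_sum UNIV ?N) p). f p (g p y) = y"
    proof
      fix y assume "y \<in> carrier (obj (direct_sum UNIV ?N) p)"
      then have y: "y True \<in> carrier (obj M p)" "e p (y True) = y True"
        "y False \<in> carrier (obj M p)" "e p (y False) = \<zero>\<^bsub>obj M p\<^esub>"
        unfolding fst by (auto simp: A_def B_def)
      have "e p (g p y) = y True"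
        using lin(2)[OF p y(1,3)] y by (simp add: g_def)
      moreover have "g p y \<oplus>\<^bsub>obj M p\<^esub> (- 1) \<odot>\<^bsub>obj M p\<^esub> y True = y False"
        using minus_add_cancel[OF y(1,3)] by (simp add: g_def)
      ultimately show "f p (g p y) = y" by (auto simp: f_def fun_eq_iff)
    qed
    show "f p ` carrier (obj M p) \<subseteq> carrier (obj (direct_sum UNIV ?N) p)"
      using fc[OF p] by blast
    show "g p ` carrier (obj (direct_sum UNIV ?N) p) \<subseteq> carrier (obj M p)"
      using closed(3)[OF p] unfolding g_def image_subset_iff Ball_def fst by (auto simp: A_def B_def)
  qed
  then have "M \<simeq>\<^sub>P direct_sum UNIV ?N" by (rule pmod_isoI[OF hom_f])
  then have "pmod_zero A \<or> pmod_zero B"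
    using assms(1) A B unfolding indecomposable_def by blast
  then show ?thesis
  proof
    assume "pmod_zero A"
    then have "e p x = \<zero>\<^bsub>obj M p\<^esub>" if "p \<in> params" "x \<in> carrier (obj M p)" for p x
      using that idem[OF that] lin(1)[OF that] unfolding pmod_zero_def A_def by auto
    then show ?thesis by blast
  next
    assume zero: "pmod_zero B"
    have "e p x = x" if p: "p \<in> params" and x: "x \<in> carrier (obj M p)" for p x
    proof -
      interpret vspace "obj M p" using V[OF p] .
      have c: "e p x \<in> carrier (obj M p)" "x \<oplus>\<^bsub>obj M p\<^esub> (- 1) \<odot>\<^bsub>obj M p\<^esub> e p x \<in> carrier (obj M p)"
        using lin(1)[OF p] closed[OF p] x by auto
      then have "x \<oplus>\<^bsub>obj M p\<^esub> (- 1) \<odot>\<^bsub>obj M p\<^esub> e p x = \<zero>\<^bsub>obj M p\<^esub>"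
        using zero ker[OF p x] p unfolding pmod_zero_def B_def by auto
      then show ?thesis using add_minus_cancel[OF x c(1)] c(1) by simp
    qed
    then show ?thesis by blast
  qed
qed


section \<open>Interval modules and the maps between them\<close>

lemma interval_module_simps [simp]:
  "carrier (obj (interval_module I) p) = (if p \<in> I then UNIV else {0})"
  "\<zero>\<^bsub>obj (interval_module I) p\<^esub> = 0"
  "x \<oplus>\<^bsub>obj (interval_module I) p\<^esub> y = x + y"
  "k \<odot>\<^bsub>obj (interval_module I) p\<^esub> x = k * x"
  "mor (interval_module I) p q x = (if p \<in> I \<and> q \<in> I then x else 0)"
  by (simp_all add: interval_module_def)

text \<open>Convexity gives the composition law: if \<open>p\<close> and \<open>s\<close> are in
  \<open>I\<close> but \<open>q\<close> between them is not, the composite is zero while the direct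
  map is the identity.\<close>

lemma persistence_module_interval:
  assumes "poset_convex I"
  shows "persistence_module (interval_module I :: ('f::field, 'f) pmod)"
  unfolding persistence_module_def
proof (intro conjI ballI impI allI)
  show "vec_space (obj (interval_module I :: ('f, 'f) pmod) p)" for p
    by (rule vec_spaceI) (auto simp: algebra_simps)
  show "mor (interval_module I :: ('f, 'f) pmod) p q \<in>
      linear_maps (obj (interval_module I) p) (obj (interval_module I) q)" for p q
    by (rule linear_mapsI) auto
  show "mor (interval_module I :: ('f, 'f) pmod) p p x = x"
    if "x \<in> carrier (obj (interval_module I :: ('f, 'f) pmod) p)" for p x
    using that by (auto split: if_splits)
  show "mor (interval_module I :: ('f, 'f) pmod) p s x = mor (interval_module I) q s (mor (interval_module I) p q x)"
    if "q \<in> params" "p \<preceq> q \<and> q \<preceq> s" for p q s x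
  proof -
    have "q \<in> I" if "p \<in> I" "s \<in> I"
      using that \<open>q \<in> params\<close> \<open>p \<preceq> q \<and> q \<preceq> s\<close> assms unfolding poset_convex_def by blast
    then show ?thesis by simp
  qed
qed

lemma pmod_hom_interval_scalar:
  fixes f :: "param \<Rightarrow> 'f::field \<Rightarrow> 'f"
  assumes "pmod_hom (interval_module A) (interval_module B) f" "p \<in> params" "p \<in> A"
  shows "f p x = f p 1 * x"
  using linear_mapsD(3)[OF pmod_homD(1)[OF assms(1,2)], of 1 x] assms(3) by (simp add: mult.commute)

lemma pmod_hom_interval_zero:
  fixes f :: "param \<Rightarrow> 'f::field \<Rightarrow> 'f"
  assumes "pmod_hom (interval_module A) (interval_module B) f" "p \<in> params"
  shows "f p 0 = 0"
  using linear_mapsD(3)[OF pmod_homD(1)[OF assms], of 0 0] by simp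

text \<open>The vector \<open>x\<close> at \<open>p\<close> already comes from the earlier parameter
  \<open>q\<close>, where the target is zero, and naturality carries this zero forward.\<close>

lemma pmod_hom_interval_vanish_source:
  fixes f :: "param \<Rightarrow> 'f::field \<Rightarrow> 'f"
  assumes "pmod_hom (interval_module A) (interval_module B) f" "p \<in> params" "q \<in> params" "q \<preceq> p"
    "p \<in> A" "q \<in> A" "q \<notin> B"
  shows "f p x = 0"
  using pmod_homD(3)[OF assms(1,3,2,4), of x] assms(5-) by simp

text \<open>The dual obstruction: the target carries \<open>f p x\<close> unchanged to the later
  parameter \<open>q\<close>, where the source has died.\<close>

lemma pmod_hom_interval_vanish_target:
  fixes f :: "param \<Rightarrow> 'f::field \<Rightarrow> 'f"
  assumes "pmod_hom (interval_module A) (interval_module B) f" "p \<in> params" "q \<in> params" "p \<preceq> q"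
    "p \<in> A" "p \<in> B" "q \<in> B" "q \<notin> A"
  shows "f p x = 0"
  using pmod_homD(3)[OF assms(1-4), of x] pmod_hom_interval_zero[OF assms(1,3)] assms(5-) by simp

lemma pmod_hom_interval_off_support:
  fixes f :: "param \<Rightarrow> 'f::field \<Rightarrow> 'f"
  assumes "pmod_hom (interval_module A) (interval_module B) f" "p \<in> params"
    "x \<in> carrier (obj (interval_module A :: ('f, 'f) pmod) p)" "p \<notin> A \<or> p \<notin> B"
  shows "f p x = 0"
  using pmod_homD(2)[OF assms(1,2,3)] assms(3,4) pmod_hom_interval_zero[OF assms(1,2)]
  by (auto split: if_splits)

text \<open>Naturality forces equal scalars at comparable parameters, and connectedness spreads the
  equality along zigzags.\<close>

lemma interval_endo_const:
  fixes f :: "param \<Rightarrow> 'f::field \<Rightarrow> 'f"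
  assumes "poset_interval I" "pmod_hom (interval_module I) (interval_module I) f"
  obtains c where "\<And>p x. p \<in> I \<Longrightarrow> f p x = c * x"
proof -
  have I: "I \<subseteq> params" "I \<noteq> {}"
    and conn: "\<And>a b. a \<in> I \<Longrightarrow> b \<in> I \<Longrightarrow> (\<lambda>x y. x \<in> I \<and> y \<in> I \<and> (x \<preceq> y \<or> y \<preceq> x))\<^sup>*\<^sup>* a b"
    using assms(1) by (auto simp: poset_interval_def poset_connected_def)
  have le: "f q 1 = f p 1" if "p \<in> I" "q \<in> I" "p \<preceq> q" for p q
    using pmod_homD(3)[OF assms(2) _ _ that(3), of 1] that I by auto
  obtain p0 where p0: "p0 \<in> I" using I by blast
  have "f p 1 = f p0 1" if "p \<in> I" for p
    using conn[OF p0 that]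
  proof induction
    case (step y z)
    then show ?case using le[of y z] le[of z y] by auto
  qed simp
  then have "f p x = f p0 1 * x" if "p \<in> I" for p x
    using pmod_hom_interval_scalar[OF assms(2) _ that] I(1) that by (metis subsetD)
  then show ?thesis by (rule that)
qed

lemma pmod_hom_interval_scale:
  "pmod_hom (interval_module I) (interval_module I) (\<lambda>p x :: 'f::field. k * x)"
  by (intro pmod_homI linear_mapsI) (auto simp: algebra_simps)

text \<open>Projecting to the summand \<open>A\<close> is an idempotent endomorphism, hence
  multiplication by an idempotent scalar \<open>c\<close>. The value 0 makes \<open>A\<close>
  vanish, the value 1 makes \<open>B\<close> vanish.\<close>

lemma indecomposable_interval_module:
  assumes "poset_interval I"
  shows "indecomposable (interval_module I :: ('f::field, 'f) pmod)"
  unfolding indecomposable_def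
proof (intro conjI allI impI)
  let ?M = "interval_module I :: ('f, 'f) pmod"
  have conv: "poset_convex I" and I: "I \<subseteq> params" "I \<noteq> {}"
    using assms by (auto simp: poset_interval_def poset_connected_def)
  show M: "persistence_module ?M" by (rule persistence_module_interval[OF conv])
  show "\<not> pmod_zero ?M"
  proof
    assume zero: "pmod_zero ?M"
    obtain p where p: "p \<in> I" "p \<in> params" using I by blast
    have "carrier (obj ?M p) = {0}" using zero p(2) by (simp add: pmod_zero_def)
    then have "(1 :: 'f) \<in> {0}" using p(1) by (metis UNIV_I interval_module_simps(1))
    then show False by simp
  qed
  fix A B :: "('f, 'f) pmod"
  let ?N = "\<lambda>i. if i then A else B"
  assume AB: "persistence_module A \<and> persistence_module B \<and> ?M \<simeq>\<^sub>P direct_sum UNIV ?N"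
  then have N: "persistence_module (?N i)" for i by auto
  obtain f g where f: "pmod_hom ?M (direct_sum UNIV ?N) f" and g: "pmod_hom (direct_sum UNIV ?N) ?M g"
    and gf: "\<And>p x. p \<in> params \<Longrightarrow> x \<in> carrier (obj ?M p) \<Longrightarrow> g p (f p x) = x"
    and fg: "\<And>p y. p \<in> params \<Longrightarrow> y \<in> carrier (obj (direct_sum UNIV ?N) p) \<Longrightarrow> f p (g p y) = y"
    using pmod_isoE[OF M] AB by blast
  let ?in = "inclusion UNIV ?N"
  have inc: "pmod_hom (?N i) (direct_sum UNIV ?N) (?in i)" for i
    by (rule pmod_hom_inclusion) (use N in auto)
  have fi: "pmod_hom ?M (?N i) (\<lambda>p x. f p x i)" for i
    by (rule pmod_hom_compose[OF f pmod_hom_projection[of i]]) simp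
  have gi: "pmod_hom (?N i) ?M (\<lambda>p x. g p (?in i p x))" for i
    by (rule pmod_hom_compose[OF inc g])
  define e where "e p x = g p (?in True p (f p x True))" for p x
  have e: "pmod_hom ?M ?M e"
    unfolding e_def using pmod_hom_compose[OF fi[of True] gi[of True]] .
  obtain c where c: "\<And>p x. p \<in> I \<Longrightarrow> e p x = c * x"
    using interval_endo_const[OF assms e] by blast
  have f0: "f p 0 i = \<zero>\<^bsub>obj (?N i) p\<^esub>" if "p \<in> params" for p i
    using linear_maps_zero[OF persistence_moduleD(1)[OF M that] persistence_moduleD(1)[OF N that]
        pmod_homD(1)[OF fi that], of i] by simp
  have g0: "g p (?in i p \<zero>\<^bsub>obj (?N i) p\<^esub>) = 0" if "p \<in> params" for p i
    using linear_maps_zero[OF persistence_moduleD(1)[OF N that] persistence_moduleD(1)[OF M that]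
        pmod_homD(1)[OF gi that], of i] by simp
  have ein: "e p (g p (?in i p y)) = g p (?in True p (?in i p y True))"
    if "p \<in> params" "y \<in> carrier (obj (?N i) p)" for p i y
    unfolding e_def using fg[OF that(1) pmod_homD(2)[OF inc that]] by simp
  \<comment> \<open>Since \<open>f\<close> inverts \<open>g\<close>, a vector of a summand that is
    sent to 0 in the interval module is zero. Outside \<open>I\<close> the interval module is zero,
    so the condition concerns only parameters in \<open>I\<close>.\<close>
  have zero: "y = \<zero>\<^bsub>obj (?N i) p\<^esub>"
    if "p \<in> params" "y \<in> carrier (obj (?N i) p)" "p \<in> I \<Longrightarrow> g p (?in i p y) = 0" for p i y
  proof -
    have "g p (?in i p y) = 0"
      using that(3) pmod_homD(2)[OF gi that(1,2)] by (cases "p \<in> I") auto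
    then have "?in i p y = f p 0"
      using fg[OF that(1) pmod_homD(2)[OF inc that(1,2)]] by simp
    then have "?in i p y i = \<zero>\<^bsub>obj (?N i) p\<^esub>" using f0[OF that(1)] by metis
    then show ?thesis by (simp add: inclusion_def)
  qed
  obtain p0 where p0: "p0 \<in> I" "p0 \<in> params" using I by blast
  have "e p0 (e p0 1) = e p0 1"
  proof -
    have "f p0 1 True \<in> carrier (obj (?N True) p0)"
      using pmod_homD(2)[OF fi[of True] p0(2), of 1] p0(1) by simp
    then show ?thesis
      using ein[OF p0(2), of "f p0 1 True" True] by (simp add: e_def inclusion_def)
  qed
  then have "c = 0 \<or> c = 1" using c[OF p0(1)] by auto
  then show "pmod_zero A \<or> pmod_zero B"
  proof
    assume c0: "c = 0"
    have "y = \<zero>\<^bsub>obj A p\<^esub>" if "p \<in> params" "y \<in> carrier (obj A p)" for p y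
    proof -
      have "g p (?in True p y) = 0" if "p \<in> I"
        using ein[of p y True] c[OF that, of "g p (?in True p y)"] c0
          \<open>p \<in> params\<close> \<open>y \<in> carrier (obj A p)\<close> by (simp add: inclusion_def)
      then show ?thesis using zero[of p y True] that by simp
    qed
    moreover have "\<zero>\<^bsub>obj A p\<^esub> \<in> carrier (obj A p)" if "p \<in> params" for p
    proof -
      interpret vspace "obj A p" using persistence_moduleD(1)[of A p] AB that by (simp add: vspaceI)
      show ?thesis by simp
    qed
    ultimately show ?thesis unfolding pmod_zero_def by blast
  next
    assume c1: "c = 1"
    have "y = \<zero>\<^bsub>obj B p\<^esub>" if "p \<in> params" "y \<in> carrier (obj B p)" for p y
    proof -
      have "g p (?in False p y) = 0" if "p \<in> I"
        using ein[of p y False] c[OF that, of "g p (?in False p y)"] c1 g0[of p True]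
          \<open>p \<in> params\<close> \<open>y \<in> carrier (obj B p)\<close> by (simp add: inclusion_def)
      then show ?thesis using zero[of p y False] that by simp
    qed
    moreover have "\<zero>\<^bsub>obj B p\<^esub> \<in> carrier (obj B p)" if "p \<in> params" for p
    proof -
      interpret vspace "obj B p" using persistence_moduleD(1)[of B p] AB that by (simp add: vspaceI)
      show ?thesis by simp
    qed
    ultimately show ?thesis unfolding pmod_zero_def by blast
  qed
qed

text \<open>The composite of \<open>a\<close> and \<open>b\<close> is an endomorphism of the
  interval module, so a scalar, and it is nonzero at \<open>p0\<close>. After rescaling
  \<open>b\<close>, the map \<open>a\<close> is a split injection. The resulting idempotent of
  \<open>N\<close> is nonzero, hence the identity by indecomposability.\<close>

lemma indecomposable_iso_interval_module:
  fixes N :: "('f::field, 'v) pmod"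
  assumes "indecomposable N" "poset_interval I"
    and a: "pmod_hom (interval_module I) N a" and b: "pmod_hom N (interval_module I) b"
    and "p0 \<in> params" "x0 \<in> carrier (obj (interval_module I :: ('f, 'f) pmod) p0)" "b p0 (a p0 x0) \<noteq> 0"
  shows "N \<simeq>\<^sub>P (interval_module I :: ('f, 'f) pmod)"
proof -
  let ?M = "interval_module I :: ('f, 'f) pmod"
  have N: "persistence_module N" using assms(1) by (simp add: indecomposable_def)
  have M: "persistence_module ?M"
    using assms(2) by (intro persistence_module_interval) (simp add: poset_interval_def)
  have ba: "pmod_hom ?M ?M (\<lambda>p x. b p (a p x))" by (rule pmod_hom_compose[OF a b])
  obtain c where c: "\<And>p x. p \<in> I \<Longrightarrow> b p (a p x) = c * x"
    using interval_endo_const[OF assms(2) ba] by blast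
  have p0: "p0 \<in> I"
    using pmod_hom_interval_off_support[OF ba assms(5,6)] assms(7) by blast
  then have "c \<noteq> 0" using c assms(7) by auto
  define b' where "b' p y = inverse c * b p y" for p y
  have b': "pmod_hom N ?M b'"
    unfolding b'_def by (rule pmod_hom_compose[OF b pmod_hom_interval_scale])
  have b'a: "b' p (a p x) = x" if "p \<in> params" "x \<in> carrier (obj ?M p)" for p x
  proof (cases "p \<in> I")
    case True
    then show ?thesis using c \<open>c \<noteq> 0\<close> by (simp add: b'_def)
  next
    case False
    then show ?thesis
      using pmod_hom_interval_off_support[OF pmod_hom_compose[OF a b'] that] that(2) by simp
  qed
  let ?e = "\<lambda>p y. a p (b' p y)"
  have e: "pmod_hom N N ?e" by (rule pmod_hom_compose[OF b' a])
  have "?e p (?e p y) = ?e p y" if "p \<in> params" "y \<in> carrier (obj N p)" for p y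
    using b'a[OF that(1) pmod_homD(2)[OF b' that]] by simp
  from indecomposable_idempotent[OF assms(1) e this]
  have "\<forall>p\<in>params. \<forall>y\<in>carrier (obj N p). ?e p y = y"
  proof
    assume zero: "\<forall>p\<in>params. \<forall>x\<in>carrier (obj N p). ?e p x = \<zero>\<^bsub>obj N p\<^esub>"
    have "a p0 x0 = \<zero>\<^bsub>obj N p0\<^esub>"
      using zero pmod_homD(2)[OF a assms(5,6)] b'a[OF assms(5,6)] assms(5) by force
    then have "b p0 (a p0 x0) = 0"
      using linear_maps_zero[OF persistence_moduleD(1)[OF N assms(5)] persistence_moduleD(1)[OF M assms(5)]
          pmod_homD(1)[OF b assms(5)]] by simp
    then show ?thesis using assms(7) by simp
  qed blast
  then show ?thesis
    using b'a by (intro pmod_isoI_inverse[OF b' a]) blast+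
qed


section \<open>Dimension bounds for direct sums\<close>

lemma homogeneous_system_solution:
  fixes u :: "'j \<Rightarrow> 'k \<Rightarrow> 'f::field"
  assumes "finite K" "finite J" "card K < card J"
  shows "\<exists>c. (\<exists>j\<in>J. c j \<noteq> 0) \<and> (\<forall>k\<in>K. (\<Sum>j\<in>J. c j * u j k) = 0)"
  using assms
proof (induction K arbitrary: J u rule: finite_induct)
  case empty
  then have "J \<noteq> {}" by auto
  then show ?case by (intro exI[of _ "\<lambda>_. 1"]) auto
next
  case (insert k K)
  show ?case
  proof (cases "\<forall>j\<in>J. u j k = 0")
    case True
    have "card K < card J" using insert by simp
    then obtain c where "\<exists>j\<in>J. c j \<noteq> 0" "\<forall>k\<in>K. (\<Sum>j\<in>J. c j * u j k) = 0"
      using insert.IH[OF insert.prems(1)] by blast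
    then show ?thesis using True by (intro exI[of _ c]) auto
  next
    case False
    then obtain j0 where j0: "j0 \<in> J" "u j0 k \<noteq> 0" by blast
    \<comment> \<open>Gaussian elimination with pivot \<open>u j0 k\<close>: equation
      \<open>k\<close> is solved for the unknown \<open>j0\<close>, \<open>u'\<close> holds the
      coefficients left after substitution, and \<open>- d\<close> is the value recovered for
      \<open>j0\<close>.\<close>
    define J' where "J' = J - {j0}"
    define u' where "u' j l = u j l - u j k / u j0 k * u j0 l" for j l
    have J': "finite J'" "card K < card J'" "j0 \<notin> J'" "J = insert j0 J'"
      using insert j0 by (auto simp: J'_def)
    obtain c where c: "\<exists>j\<in>J'. c j \<noteq> 0" "\<forall>l\<in>K. (\<Sum>j\<in>J'. c j * u' j l) = 0"
      using insert.IH[OF J'(1,2), of u'] by blast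
    define d where "d = (\<Sum>j\<in>J'. c j * (u j k / u j0 k))"
    define c' where "c' = c(j0 := - d)"
    have sum: "(\<Sum>j\<in>J. c' j * u j l) = (\<Sum>j\<in>J'. c j * u' j l)" for l
    proof -
      have "(\<Sum>j\<in>J'. c' j * u j l) = (\<Sum>j\<in>J'. c j * u j l)"
        by (rule sum.cong) (use J'(3) in \<open>auto simp: c'_def\<close>)
      moreover have "(\<Sum>j\<in>J'. c j * u' j l) = (\<Sum>j\<in>J'. c j * u j l) - d * u j0 l"
        by (simp add: u'_def d_def sum_distrib_right sum_subtractf right_diff_distrib mult.assoc)
      ultimately show ?thesis
        unfolding J'(4) using J'(1,3) by (simp add: c'_def)
    qed
    have "(\<Sum>j\<in>J. c' j * u j l) = 0" if "l \<in> insert k K" for l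
    proof (cases "l = k")
      case True
      then show ?thesis unfolding sum using j0(2) by (simp add: u'_def)
    next
      case False
      then show ?thesis unfolding sum using c(2) that by blast
    qed
    moreover have "\<exists>j\<in>J. c' j \<noteq> 0" using c(1) J'(3,4) by (auto simp: c'_def)
    ultimately show ?thesis by blast
  qed
qed

text \<open>The zero vector is presented as a multiple by 0, the form in which homogeneity shows
  that linear maps preserve it.\<close>

lemma direct_sum_zero_scale:
  assumes "\<And>i. i \<in> J \<Longrightarrow> persistence_module (N i)" "p \<in> params"
    "x \<in> carrier (obj (direct_sum J N) p)"
  shows "0 \<odot>\<^bsub>obj (direct_sum J N) p\<^esub> x = \<zero>\<^bsub>obj (direct_sum J N) p\<^esub>"
proof -
  have "0 \<odot>\<^bsub>obj (N i) p\<^esub> x i = \<zero>\<^bsub>obj (N i) p\<^esub>" if "i \<in> J" for i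
    using vspace.scale_zero[OF vspaceI[OF persistence_moduleD(1)[OF assms(1)[OF that] assms(2)]]]
      assms(3) that by auto
  then show ?thesis by (auto simp: fun_eq_iff)
qed

definition finite_part :: "'j set \<Rightarrow> ('j \<Rightarrow> ('f::field, 'v) pmod) \<Rightarrow> param \<Rightarrow> 'j set \<Rightarrow> ('j \<Rightarrow> 'v) \<Rightarrow> 'j \<Rightarrow> 'v" where
  "finite_part J N p J0 s = (\<lambda>i\<in>J. if i \<in> J0 then s i else \<zero>\<^bsub>obj (N i) p\<^esub>)"

lemma finite_part_in_carrier:
  assumes "\<And>i. i \<in> J \<Longrightarrow> persistence_module (N i)" "p \<in> params"
    "finite J0" "J0 \<subseteq> J" "\<And>i. i \<in> J0 \<Longrightarrow> s i \<in> carrier (obj (N i) p)"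
  shows "finite_part J N p J0 s \<in> carrier (obj (direct_sum J N) p)"
proof -
  have "\<zero>\<^bsub>obj (N i) p\<^esub> \<in> carrier (obj (N i) p)" if "i \<in> J" for i
  proof -
    interpret vspace "obj (N i) p" using persistence_moduleD(1)[OF assms(1)[OF that] assms(2)] by (rule vspaceI)
    show ?thesis by simp
  qed
  moreover have "{i \<in> J. finite_part J N p J0 s i \<noteq> \<zero>\<^bsub>obj (N i) p\<^esub>} \<subseteq> J0"
    by (auto simp: finite_part_def)
  then have "finite {i \<in> J. finite_part J N p J0 s i \<noteq> \<zero>\<^bsub>obj (N i) p\<^esub>}"
    using assms(3) finite_subset by blast
  ultimately show ?thesis using assms(5) by (auto simp: finite_part_def)
qed

text \<open>At \<open>p\<close> the module \<open>interval_module UNIV\<close> is the field itself,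
  so \<open>F\<close> is a linear functional. The index set \<open>J\<close> may be infinite;
  \<open>finite_part\<close> confines the sum and the induction to a finite subset.\<close>

lemma functional_finite_part:
  fixes N :: "'j \<Rightarrow> ('f::field, 'v) pmod" and F :: "('j \<Rightarrow> 'v) \<Rightarrow> 'f"
  assumes N: "\<And>i. i \<in> J \<Longrightarrow> persistence_module (N i)" and p: "p \<in> params"
    and F: "F \<in> linear_maps (obj (direct_sum J N) p) (obj (interval_module UNIV) p)"
    and "finite J0" "J0 \<subseteq> J" "\<And>i. i \<in> J0 \<Longrightarrow> s i \<in> carrier (obj (N i) p)"
  shows "F (finite_part J N p J0 s) = (\<Sum>i\<in>J0. F (inclusion J N i p (s i)))"
  using assms(4-)
proof (induction J0 rule: finite_induct)
  case empty
  have c: "finite_part J N p {} s \<in> carrier (obj (direct_sum J N) p)"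
    by (rule finite_part_in_carrier[OF N p]) auto
  have "finite_part J N p {} s = \<zero>\<^bsub>obj (direct_sum J N) p\<^esub>" by (auto simp: finite_part_def)
  then have "finite_part J N p {} s = 0 \<odot>\<^bsub>obj (direct_sum J N) p\<^esub> finite_part J N p {} s"
    using direct_sum_zero_scale[OF N p c] by simp
  then have "F (finite_part J N p {} s) = 0 * F (finite_part J N p {} s)"
    using linear_mapsD(3)[OF F c, of 0] by (metis interval_module_simps(4))
  then show ?case by simp
next
  case (insert j J0)
  have V: "vspace (obj (N i) p)" if "i \<in> J" for i
    using persistence_moduleD(1)[OF N[OF that] p] by (rule vspaceI)
  have c: "finite_part J N p J0 s \<in> carrier (obj (direct_sum J N) p)"
    by (rule finite_part_in_carrier[OF N p]) (use insert in auto)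
  have j: "j \<in> J" "s j \<in> carrier (obj (N j) p)" using insert.prems by auto
  have ci: "inclusion J N j p (s j) \<in> carrier (obj (direct_sum J N) p)"
    by (rule pmod_homD(2)[OF pmod_hom_inclusion[of j J N, OF j(1) N] p j(2)])
  have "finite_part J N p (insert j J0) s =
      inclusion J N j p (s j) \<oplus>\<^bsub>obj (direct_sum J N) p\<^esub> finite_part J N p J0 s"
  proof (rule ext)
    fix i
    show "finite_part J N p (insert j J0) s i =
        (inclusion J N j p (s j) \<oplus>\<^bsub>obj (direct_sum J N) p\<^esub> finite_part J N p J0 s) i"
    proof (cases "i \<in> J")
      case True
      interpret vspace "obj (N i) p" using V[OF True] .
      have "s j \<oplus>\<^bsub>obj (N j) p\<^esub> \<zero>\<^bsub>obj (N j) p\<^esub> = s j" if "i = j"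
        using r_zero[of "s i"] j(2) that by simp
      then show ?thesis using True insert.hyps insert.prems(2)[of i]
        by (simp add: finite_part_def inclusion_def)
    qed (simp add: finite_part_def)
  qed
  then have "F (finite_part J N p (insert j J0) s) = F (inclusion J N j p (s j)) + F (finite_part J N p J0 s)"
    using linear_mapsD(2)[OF F ci c] by (metis interval_module_simps(3))
  moreover have "F (finite_part J N p J0 s) = (\<Sum>i\<in>J0. F (inclusion J N i p (s i)))"
    using insert by auto
  ultimately show ?case using insert.hyps by simp
qed

text \<open>Each summand in \<open>J'\<close> contributes a nonzero vector, while the functionals
  \<open>b k\<close> detect every nonzero vector on the other side. With more vectors than
  functionals, a nontrivial combination is killed by all of them, against injectivity of
  \<open>f\<close>. The bound is proved for finite subsets of \<open>J'\<close>, so it yields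
  finiteness of \<open>J'\<close> as well.\<close>

lemma direct_sum_dim_le:
  fixes N :: "'j \<Rightarrow> ('f::field, 'v) pmod" and M :: "'k \<Rightarrow> ('f, 'w) pmod"
  assumes N: "\<And>i. i \<in> J \<Longrightarrow> persistence_module (N i)" and M: "\<And>i. i \<in> K \<Longrightarrow> persistence_module (M i)"
    and p: "p \<in> params"
    and f: "f \<in> linear_maps (obj (direct_sum J N) p) (obj (direct_sum K M) p)"
    and inj: "inj_on f (carrier (obj (direct_sum J N) p))"
    and J': "J' \<subseteq> J" "\<And>j. j \<in> J' \<Longrightarrow> \<exists>y\<in>carrier (obj (N j) p). y \<noteq> \<zero>\<^bsub>obj (N j) p\<^esub>"
    and K': "finite K'" "K' \<subseteq> K" "\<And>k. k \<in> K - K' \<Longrightarrow> carrier (obj (M k) p) = {\<zero>\<^bsub>obj (M k) p\<^esub>}"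
    and b: "\<And>k. k \<in> K' \<Longrightarrow> b k \<in> linear_maps (obj (M k) p) (obj (interval_module UNIV) p)"
      "\<And>k y. k \<in> K' \<Longrightarrow> y \<in> carrier (obj (M k) p) \<Longrightarrow> b k y = 0 \<Longrightarrow> y = \<zero>\<^bsub>obj (M k) p\<^esub>"
  shows "finite J' \<and> card J' \<le> card K'"
proof (rule finite_if_finite_subsets_card_bdd)
  fix J0 assume J0: "J0 \<subseteq> J'" "finite J0"
  have V: "vspace (obj (N i) p)" if "i \<in> J" for i
    using persistence_moduleD(1)[OF N[OF that] p] by (rule vspaceI)
  show "card J0 \<le> card K'"
  proof (rule ccontr)
    assume "\<not> card J0 \<le> card K'"
    then have less: "card K' < card J0" by simp
    have "\<forall>j\<in>J'. \<exists>y. y \<in> carrier (obj (N j) p) \<and> y \<noteq> \<zero>\<^bsub>obj (N j) p\<^esub>" using J'(2) by blast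
    from bchoice[OF this] obtain y where y: "\<And>j. j \<in> J' \<Longrightarrow> y j \<in> carrier (obj (N j) p) \<and> y j \<noteq> \<zero>\<^bsub>obj (N j) p\<^esub>"
      by blast
    define F where "F k x = b k (f x k)" for k x
    have F: "F k \<in> linear_maps (obj (direct_sum J N) p) (obj (interval_module UNIV) p)" if "k \<in> K'" for k
    proof -
      have "k \<in> K" using that K'(2) by blast
      show ?thesis
        unfolding F_def
        using linear_maps_compose[OF linear_maps_compose[OF f pmod_homD(1)[OF pmod_hom_projection[OF \<open>k \<in> K\<close>] p]] b(1)[OF that]] .
    qed
    obtain c where c: "\<exists>j\<in>J0. c j \<noteq> 0"
      "\<And>k. k \<in> K' \<Longrightarrow> (\<Sum>j\<in>J0. c j * F k (inclusion J N j p (y j))) = 0"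
      using homogeneous_system_solution[OF K'(1) J0(2) less, of "\<lambda>j k. F k (inclusion J N j p (y j))"] by blast
    define s where "s j = c j \<odot>\<^bsub>obj (N j) p\<^esub> y j" for j
    have J0J: "j \<in> J" "j \<in> J'" if "j \<in> J0" for j using that J0 J' by auto
    have s: "s j \<in> carrier (obj (N j) p)" if "j \<in> J0" for j
      unfolding s_def using vspace.scale_closed[OF V] y J0J[OF that] by blast
    define x where "x = finite_part J N p J0 s"
    have x: "x \<in> carrier (obj (direct_sum J N) p)"
      unfolding x_def by (rule finite_part_in_carrier[OF N p J0(2)]) (use J0J s in auto)
    have fx: "f x \<in> carrier (obj (direct_sum K M) p)" using linear_mapsD(1)[OF f x] .
    have "F k x = 0" if k: "k \<in> K'" for k
    proof -
      have "F k x = (\<Sum>i\<in>J0. F k (inclusion J N i p (s i)))"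
        unfolding x_def by (rule functional_finite_part[OF N p F[OF k] J0(2)]) (use J0J s in auto)
      also have "\<dots> = (\<Sum>i\<in>J0. c i * F k (inclusion J N i p (y i)))"
      proof (rule sum.cong[OF HOL.refl])
        fix i assume i: "i \<in> J0"
        note inc = pmod_hom_inclusion[of i J N, OF J0J(1)[OF i] N]
        have yi: "y i \<in> carrier (obj (N i) p)" using y J0J[OF i] by blast
        have "inclusion J N i p (s i) = c i \<odot>\<^bsub>obj (direct_sum J N) p\<^esub> inclusion J N i p (y i)"
          unfolding s_def by (rule linear_mapsD(3)[OF pmod_homD(1)[OF inc p] yi])
        then show "F k (inclusion J N i p (s i)) = c i * F k (inclusion J N i p (y i))"
          using linear_mapsD(3)[OF F[OF k] pmod_homD(2)[OF inc p yi], of "c i"]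
          by (metis interval_module_simps(4))
      qed
      finally show ?thesis using c(2)[OF k] by simp
    qed
    then have "f x k = \<zero>\<^bsub>obj (M k) p\<^esub>" if "k \<in> K" for k
      using that K'(3)[of k] b(2)[of k "f x k"] fx by (cases "k \<in> K'") (auto simp: F_def)
    then have "f x = \<zero>\<^bsub>obj (direct_sum K M) p\<^esub>"
      using fx by (auto simp: fun_eq_iff PiE_def extensional_def)
    also have "\<dots> = f (0 \<odot>\<^bsub>obj (direct_sum J N) p\<^esub> x)"
      using linear_mapsD(3)[OF f x, of 0] direct_sum_zero_scale[OF M p fx] by simp
    finally have "x = \<zero>\<^bsub>obj (direct_sum J N) p\<^esub>"
    proof -
      assume eq: "f x = f (0 \<odot>\<^bsub>obj (direct_sum J N) p\<^esub> x)"
      have z: "0 \<odot>\<^bsub>obj (direct_sum J N) p\<^esub> x = \<zero>\<^bsub>obj (direct_sum J N) p\<^esub>"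
        by (rule direct_sum_zero_scale[OF N p x])
      have "finite_part J N p {} s \<in> carrier (obj (direct_sum J N) p)"
        by (rule finite_part_in_carrier[OF N p]) auto
      then have "\<zero>\<^bsub>obj (direct_sum J N) p\<^esub> \<in> carrier (obj (direct_sum J N) p)"
        unfolding finite_part_def direct_sum_simps(2) by simp
      then show ?thesis using inj_onD[OF inj eq[unfolded z] x] by blast
    qed
    then have "x j = \<zero>\<^bsub>obj (N j) p\<^esub>" if "j \<in> J" for j using that by simp
    then have "c j \<odot>\<^bsub>obj (N j) p\<^esub> y j = \<zero>\<^bsub>obj (N j) p\<^esub>" if "j \<in> J0" for j
      using J0J(1)[OF that] that unfolding x_def finite_part_def s_def by fastforce
    then have "c j = 0" if "j \<in> J0" for j
      using vspace.cancel_scale[OF V[OF J0J(1)[OF that]]] y[OF J0J(2)[OF that]] that by blast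
    then show False using c(1) by blast
  qed
qed

text \<open>The endomorphism of the interval sum cut out by a summand \<open>N j\<close> is idempotent. If all its matrix
  entries between isomorphic intervals vanished, it would be strictly triangular for \<open>lvl\<close>, hence zero.\<close>

lemma summand_of_interval_sum:
  fixes N :: "'j \<Rightarrow> ('f::field, 'v) pmod" and T :: "'k \<Rightarrow> param set" and lvl :: "'k \<Rightarrow> nat"
  defines "S \<equiv> \<lambda>k. interval_module (T k) :: ('f, 'f) pmod"
  assumes K: "finite K" "\<And>k. k \<in> K \<Longrightarrow> poset_interval (T k)"
    and vanish: "\<And>a b f p x. a \<in> K \<Longrightarrow> b \<in> K \<Longrightarrow> T a \<noteq> T b \<Longrightarrow> lvl a \<le> lvl b \<Longrightarrow>
      pmod_hom (S b) (S a) f \<Longrightarrow> p \<in> params \<Longrightarrow> x \<in> carrier (obj (S b) p) \<Longrightarrow> f p x = 0"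
    and N: "\<And>i. i \<in> J \<Longrightarrow> persistence_module (N i)" and j: "j \<in> J" "indecomposable (N j)"
    and f: "pmod_hom (direct_sum K S) (direct_sum J N) f" and g: "pmod_hom (direct_sum J N) (direct_sum K S) g"
    and fg: "\<And>p y. p \<in> params \<Longrightarrow> y \<in> carrier (obj (direct_sum J N) p) \<Longrightarrow> f p (g p y) = y"
  shows "\<exists>k\<in>K. N j \<simeq>\<^sub>P S k"
proof (rule ccontr)
  assume not_iso: "\<not> (\<exists>k\<in>K. N j \<simeq>\<^sub>P S k)"
  have S: "persistence_module (S k)" if "k \<in> K" for k
    unfolding S_def using K(2)[OF that] by (intro persistence_module_interval) (simp add: poset_interval_def)
  \<comment> \<open>The composite of \<open>\<alpha> b\<close> and \<open>\<beta> a\<close> is the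
    matrix entry from \<open>S b\<close> to \<open>S a\<close> of the idempotent that projects to
    \<open>N j\<close> in the other decomposition.\<close>
  define \<alpha> where "\<alpha> b p x = f p (inclusion K S b p x) j" for b p x
  define \<beta> where "\<beta> a p y = g p (inclusion J N j p y) a" for a p y
  have \<alpha>: "pmod_hom (S b) (N j) (\<alpha> b)" if "b \<in> K" for b
    unfolding \<alpha>_def
    by (rule pmod_hom_compose[OF pmod_hom_compose[OF pmod_hom_inclusion[of b K S, OF that S] f] pmod_hom_projection[OF j(1)]])
  have \<beta>: "pmod_hom (N j) (S a) (\<beta> a)" if "a \<in> K" for a
    unfolding \<beta>_def
    by (rule pmod_hom_compose[OF pmod_hom_compose[OF pmod_hom_inclusion[of j J N, OF j(1) N] g] pmod_hom_projection[OF that]])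
  have zero: "\<beta> a p (\<alpha> b p x) = 0"
    if "a \<in> K" "b \<in> K" "lvl a \<le> lvl b" "p \<in> params" "x \<in> carrier (obj (S b) p)" for a b p x
  proof (cases "T a = T b")
    case False
    show ?thesis
      by (rule vanish[OF that(1,2) False that(3) pmod_hom_compose[OF \<alpha>[OF that(2)] \<beta>[OF that(1)]] that(4,5)])
  next
    case True
    then have eq: "S a = S b" by (simp add: S_def)
    show ?thesis
    proof (rule ccontr)
      assume "\<beta> a p (\<alpha> b p x) \<noteq> 0"
      then have "N j \<simeq>\<^sub>P S b"
        using indecomposable_iso_interval_module[OF j(2) K(2)[OF that(2)] \<alpha>[OF that(2), unfolded S_def]
            \<beta>[OF that(1), unfolded eq, unfolded S_def] that(4) that(5)[unfolded S_def]] by (simp add: S_def)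
      then show False using not_iso that(2) by blast
    qed
  qed
  have "\<not> pmod_zero (N j)" using j(2) by (simp add: indecomposable_def)
  then obtain p where p: "p \<in> params" "carrier (obj (N j) p) \<noteq> {\<zero>\<^bsub>obj (N j) p\<^esub>}"
    by (auto simp: pmod_zero_def)
  interpret Nj: vspace "obj (N j) p" using persistence_moduleD(1)[OF N[OF j(1)] p(1)] by (rule vspaceI)
  have "\<zero>\<^bsub>obj (N j) p\<^esub> \<in> carrier (obj (N j) p)" by simp
  then obtain y where y: "y \<in> carrier (obj (N j) p)" "y \<noteq> \<zero>\<^bsub>obj (N j) p\<^esub>"
    using p(2) by blast
  have iy: "inclusion J N j p y \<in> carrier (obj (direct_sum J N) p)"
    by (rule pmod_homD(2)[OF pmod_hom_inclusion[of j J N, OF j(1) N] p(1) y(1)])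
  \<comment> \<open>\<open>t\<close> is the image of \<open>y\<close>, hence a fixed vector of the
    idempotent. In coordinates this says that each \<open>t a\<close> is the sum of the matrix
    entries applied to the \<open>t b\<close>.\<close>
  define t where "t = g p (inclusion J N j p y)"
  have t: "t \<in> carrier (obj (direct_sum K S) p)" unfolding t_def by (rule pmod_homD(2)[OF g p(1) iy])
  have ft: "f p t j = y" unfolding t_def fg[OF p(1) iy] using j(1) by (simp add: inclusion_def)
  have tk: "t k \<in> carrier (obj (S k) p)" if "k \<in> K" for k using t that by auto
  have t_eq: "t = finite_part K S p K t"
    using t by (auto simp: finite_part_def fun_eq_iff PiE_def extensional_def)
  have expand: "t a = (\<Sum>b\<in>K. \<beta> a p (\<alpha> b p (t b)))" if a: "a \<in> K" for a
  proof -
    define F where "F s = \<beta> a p (f p s j)" for s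
    have h: "pmod_hom (direct_sum K S) (S a) (\<lambda>p s. \<beta> a p (f p s j))"
      by (rule pmod_hom_compose[OF pmod_hom_compose[OF f pmod_hom_projection[OF j(1)]] \<beta>[OF a]])
    have F: "F \<in> linear_maps (obj (direct_sum K S) p) (obj (interval_module UNIV) p)"
      using linear_mapsD[OF pmod_homD(1)[OF h p(1)]]
      by (intro linear_mapsI) (simp_all add: F_def S_def)
    have "t a = F t" unfolding F_def ft by (simp add: \<beta>_def t_def)
    also have "\<dots> = F (finite_part K S p K t)" using t_eq by simp
    also have "\<dots> = (\<Sum>b\<in>K. F (inclusion K S b p (t b)))"
      by (rule functional_finite_part[OF S p(1) F K(1)]) (use tk in auto)
    finally show ?thesis by (simp add: F_def \<alpha>_def)
  qed
  \<comment> \<open>Only entries starting at a strictly lower level can be nonzero, so the equation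
    for \<open>t a\<close> involves only coordinates of lower level, which are zero by
    induction.\<close>
  have "\<forall>a\<in>K. lvl a = n \<longrightarrow> t a = 0" for n
  proof (induction n rule: less_induct)
    case (less n)
    show ?case
    proof (intro ballI impI)
      fix a assume a: "a \<in> K" "lvl a = n"
      have "\<beta> a p (\<alpha> b p (t b)) = 0" if b: "b \<in> K" for b
      proof (cases "lvl a \<le> lvl b")
        case True
        then show ?thesis using zero[OF a(1) b _ p(1) tk[OF b]] by blast
      next
        case False
        then have "lvl b < n" using a(2) by simp
        then have "t b = 0" using less.IH b by blast
        moreover have "\<beta> a p (\<alpha> b p 0) = 0"
          using pmod_hom_interval_zero[OF pmod_hom_compose[OF \<alpha>[OF b] \<beta>[OF a(1)], unfolded S_def] p(1)] .
        ultimately show ?thesis by simp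
      qed
      then show "t a = 0" using expand[OF a(1)] by simp
    qed
  qed
  then have "t a = 0" if "a \<in> K" for a using that by blast
  then have "t = 0 \<odot>\<^bsub>obj (direct_sum K S) p\<^esub> t"
    using t by (auto simp: fun_eq_iff PiE_def extensional_def S_def)
  then have "f p t = 0 \<odot>\<^bsub>obj (direct_sum J N) p\<^esub> f p t"
    using linear_mapsD(3)[OF pmod_homD(1)[OF f p(1)] t, of 0] by metis
  then have "y = 0 \<odot>\<^bsub>obj (N j) p\<^esub> y"
    using ft j(1) unfolding direct_sum_simps(4) by (metis restrict_apply')
  then show False using Nj.scale_zero[OF y(1)] y(2) by simp
qed


section \<open>The four distinct supports and the maps between them\<close>

definition support_class :: "nat \<Rightarrow> nat" where
  "support_class k = (if k = 0 then 0 else if k = 1 then 1 else if k < 6 then 2 else 3)"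

definition support :: "nat \<Rightarrow> param set" where
  "support c = {(r, L) \<in> params. if c = 0 then r \<le> L + 2 else if c = 1 then 1 < r \<and> r \<le> L + 2
     else if c = 2 then 1 < r \<and> r \<le> 2 else L + 1 < r \<and> r \<le> L + 2}"

lemma summand_supports_eq_support:
  assumes "k < 12"
  shows "summand_supports ! k = support (support_class k)"
proof (rule Set.set_eqI)
  fix p :: param
  obtain r L where "p = (r, L)" by (cases p)
  then show "p \<in> summand_supports ! k \<longleftrightarrow> p \<in> support (support_class k)"
    using assms by (simp add: summand_supports_nth support_def support_class_def params_def)
qed

lemma support_class_less: "support_class k < 4"
  by (simp add: support_class_def)

lemma less_4_cases:
  assumes "c < (4 :: nat)"
  obtains "c = 0" | "c = 1" | "c = 2" | "c = 3"
  using assms by (auto simp: less_Suc_eq numeral_eq_Suc)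

lemma support_iff:
  "(r, L) \<in> support c \<longleftrightarrow> r > 0 \<and> L > 0 \<and> (if c = 0 then r \<le> L + 2 else if c = 1 then 1 < r \<and> r \<le> L + 2
     else if c = 2 then 1 < r \<and> r \<le> 2 else L + 1 < r \<and> r \<le> L + 2)"
  by (auto simp: support_def params_def)

lemma poset_convex_support: "poset_convex (support c)"
  by (auto simp: poset_convex_def support_def param_le_def params_def split: if_splits)

abbreviation zigzag :: "param set \<Rightarrow> param \<Rightarrow> param \<Rightarrow> bool" where
  "zigzag I \<equiv> (\<lambda>x y. x \<in> I \<and> y \<in> I \<and> (x \<preceq> y \<or> y \<preceq> x))\<^sup>*\<^sup>*"

lemma zigzag_sym: "zigzag I a b \<Longrightarrow> zigzag I b a"
  by (rule sympD[OF symp_rtranclp]) (auto intro: sympI)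

lemma zigzag_step: "a \<in> I \<Longrightarrow> b \<in> I \<Longrightarrow> a \<preceq> b \<or> b \<preceq> a \<Longrightarrow> zigzag I a b"
  by (rule r_into_rtranclp) simp

lemma zigzag_trans: "zigzag I a b \<Longrightarrow> zigzag I b c \<Longrightarrow> zigzag I a c"
  by (rule rtranclp_trans)

text \<open>These supports contain, with any two parameters, the common upper bound
  \<open>(min r r', max L L')\<close>, so two steps suffice. The strip
  \<open>L + 1 < r \<le> L + 2\<close> does not have this property.\<close>

lemma poset_connected_directed:
  assumes "c < 3"
  shows "poset_connected (support c)"
  unfolding poset_connected_def
proof (intro conjI ballI)
  have "(3 / 2, 1) \<in> support c" using assms by (simp add: support_def params_def)
  then show "support c \<noteq> {}" by blast
  fix a b assume ab: "a \<in> support c" "b \<in> support c"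
  obtain r L r' L' where eq: "a = (r, L)" "b = (r', L')" by (cases a, cases b)
  define q where "q = (min r r', max L L')"
  have "c = 0 \<or> c = 1 \<or> c = 2" using assms by auto
  then have q: "q \<in> support c"
    using ab unfolding eq q_def support_iff min_def max_def by (elim disjE) simp_all
  have "a \<preceq> q" "b \<preceq> q" by (simp_all add: eq q_def param_le_def)
  show "zigzag (support c) a b"
    using zigzag_trans[OF zigzag_step[OF ab(1) q] zigzag_step[OF q ab(2)]] \<open>a \<preceq> q\<close> \<open>b \<preceq> q\<close> by blast
qed

text \<open>The strip is traversed along the line \<open>r = L + 2\<close> in steps of length \<open>1/2\<close>.\<close>

lemma poset_connected_strip: "poset_connected (support 3)"
  unfolding poset_connected_def
proof (intro conjI ballI)
  have mem: "(r, L) \<in> support 3 \<longleftrightarrow> r > 0 \<and> L > 0 \<and> L + 1 < r \<and> r \<le> L + 2" for r L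
    by (simp add: support_iff)
  have "(3, 1) \<in> support 3" unfolding mem by simp
  then show "support 3 \<noteq> {}" by blast
  \<comment> \<open>The intermediate point \<open>(L + 2, L')\<close> is in the strip because
    \<open>L' < L + 1\<close>, which is what limits the length of a step.\<close>
  have edge: "zigzag (support 3) (L + 2, L) (L' + 2, L')" if "0 < L" "L \<le> L'" "L' < L + 1" for L L'
  proof (rule zigzag_trans)
    show "zigzag (support 3) (L + 2, L) (L + 2, L')"
      by (rule zigzag_step) (use that in \<open>auto simp: mem param_le_def\<close>)
    show "zigzag (support 3) (L + 2, L') (L' + 2, L')"
      by (rule zigzag_step) (use that in \<open>auto simp: mem param_le_def\<close>)
  qed
  have chain: "zigzag (support 3) (L + 2, L) (L' + 2, L')" if "0 < L" "L \<le> L'" "L' \<le> L + real n / 2" for n L L'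
    using that
  proof (induction n arbitrary: L')
    case 0
    then show ?case by simp
  next
    case (Suc n)
    define M where "M = max L (L' - 1 / 2)"
    have "zigzag (support 3) (L + 2, L) (M + 2, M)"
      by (rule Suc.IH) (use Suc.prems in \<open>auto simp: M_def max_def field_simps\<close>)
    moreover have "zigzag (support 3) (M + 2, M) (L' + 2, L')"
      by (rule edge) (use Suc.prems in \<open>auto simp: M_def max_def\<close>)
    ultimately show ?case by (rule zigzag_trans)
  qed
  have all: "zigzag (support 3) (L + 2, L) (L' + 2, L')" if "0 < L" "L \<le> L'" for L L'
  proof -
    obtain n :: nat where "2 * (L' - L) \<le> real n" using real_arch_simple by blast
    then show ?thesis using chain[OF that, of n] by simp
  qed
  have start: "zigzag (support 3) (L + 2, L) (r, L)" if "(r, L) \<in> support 3" for r L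
    by (rule zigzag_step) (use that in \<open>auto simp: mem param_le_def\<close>)
  fix a b assume ab: "a \<in> support 3" "b \<in> support 3"
  obtain r L r' L' where eq: "a = (r, L)" "b = (r', L')" by (cases a, cases b)
  have "zigzag (support 3) (L + 2, L) (L' + 2, L')"
    using all[of L L'] zigzag_sym[OF all[of L' L]] ab unfolding eq mem by linarith
  then show "zigzag (support 3) a b"
    using zigzag_trans[OF zigzag_trans[OF zigzag_sym[OF start]] start] ab unfolding eq by blast
qed

lemma poset_interval_support:
  assumes "c < 4"
  shows "poset_interval (support c)"
  unfolding poset_interval_def
proof (intro conjI)
  show "support c \<subseteq> params" by (auto simp: support_def)
  show "poset_connected (support c)"
  proof (cases "c < 3")
    case False
    then have "c = 3" using assms by simp
    then show ?thesis using poset_connected_strip by simp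
  qed (rule poset_connected_directed)
qed (rule poset_convex_support)

text \<open>There are nonzero maps from support 0 to 1, from 2 to 1, and from 1 to 3. Between 0 and
  2 all maps vanish in both directions, so these two share the lowest level.\<close>

definition support_level :: "nat \<Rightarrow> nat" where
  "support_level c = (if c = 1 then 1 else if c = 3 then 2 else 0)"

text \<open>The witnesses are as follows. \<open>(L + 2, L)\<close>, the earliest parameter with
  this \<open>L\<close> in any support, lies in every support except 2, which kills the maps into 2.
  \<open>(1, L)\<close> lies in support 0 only, which kills the maps into 0.
  \<open>(r, L + r)\<close>, later than \<open>p\<close>, has left the strip but not support 1,
  which kills the maps from 3 to 1.\<close>

lemma support_hom_vanish:
  fixes f :: "param \<Rightarrow> 'f::field \<Rightarrow> 'f"
  assumes "a < 4" "b < 4" "a \<noteq> b" "support_level a \<le> support_level b"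
    and f: "pmod_hom (interval_module (support b)) (interval_module (support a)) f" and p: "p \<in> params"
    and x: "x \<in> carrier (obj (interval_module (support b) :: ('f, 'f) pmod) p)"
  shows "f p x = 0"
proof (cases "p \<in> support a \<and> p \<in> support b")
  case False
  then show ?thesis using pmod_hom_interval_off_support[OF f p x] by blast
next
  case True
  obtain r L where pe: "p = (r, L)" by (cases p)
  have rL: "r > 0" "L > 0" "r \<le> L + 2" using True unfolding pe support_iff by (auto split: if_splits)
  have src: ?thesis if "(L + 2, L) \<in> support b" "(L + 2, L) \<notin> support a"
    by (rule pmod_hom_interval_vanish_source[OF f p _ _ _ that])
      (use True pe rL in \<open>auto simp: params_def param_le_def\<close>)
  have tgt: ?thesis if "q \<in> support a" "q \<notin> support b" "p \<preceq> q" for q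
    by (rule pmod_hom_interval_vanish_target[OF f p _ that(3) _ _ that(1,2)])
      (use True that in \<open>auto simp: support_def\<close>)
  consider "a = 0" "b = 1 \<or> b = 2 \<or> b = 3" | "a = 1" "b = 3" | "a = 2" "b = 0 \<or> b = 1 \<or> b = 3"
    using assms(1-4) by (elim less_4_cases) (simp_all add: support_level_def)
  then show ?thesis
  proof cases
    case 1
    then show ?thesis
      using tgt[of "(1, L)"] rL True unfolding pe support_iff by (auto simp: param_le_def)
  next
    case 2
    then show ?thesis
      using tgt[of "(r, L + r)"] rL True unfolding pe support_iff by (auto simp: param_le_def)
  next
    case 3
    then show ?thesis using src rL unfolding support_iff by auto
  qed
qed

section \<open>Counting the summands of each class\<close>

lemma matching_bijection:
  assumes "finite K"
    and "\<And>t. finite {j \<in> J. c j = t}" "\<And>t. card {j \<in> J. c j = t} = card {k \<in> K. d k = t}"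
  shows "\<exists>\<sigma>. bij_betw \<sigma> J K \<and> (\<forall>j\<in>J. d (\<sigma> j) = c j)"
proof -
  have "\<exists>h. bij_betw h {j \<in> J. c j = t} {k \<in> K. d k = t}" for t
    using assms by (intro finite_same_card_bij) auto
  then obtain h where h: "\<And>t. bij_betw (h t) {j \<in> J. c j = t} {k \<in> K. d k = t}" by metis
  define \<sigma> where "\<sigma> j = h (c j) j" for j
  have \<sigma>: "\<sigma> j \<in> K" "d (\<sigma> j) = c j" if "j \<in> J" for j
    using bij_betw_apply[OF h[of "c j"], of j] that by (auto simp: \<sigma>_def)
  have "bij_betw \<sigma> J K"
  proof (rule bij_betw_imageI)
    show "inj_on \<sigma> J"
    proof (rule inj_onI)
      fix i j assume ij: "i \<in> J" "j \<in> J" "\<sigma> i = \<sigma> j"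
      then have "c i = c j" using \<sigma>(2) by metis
      then show "i = j"
        using ij bij_betw_imp_inj_on[OF h[of "c j"]] by (auto simp: \<sigma>_def dest: inj_onD)
    qed
    have "k \<in> \<sigma> ` J" if "k \<in> K" for k
    proof -
      have "k \<in> h (d k) ` {j \<in> J. c j = d k}"
        using bij_betw_imp_surj_on[OF h[of "d k"]] that by simp
      then obtain j where "j \<in> J" "c j = d k" "h (d k) j = k" by auto
      then have "\<sigma> j = k" by (simp add: \<sigma>_def)
      then show ?thesis using \<open>j \<in> J\<close> by blast
    qed
    then show "\<sigma> ` J = K" using \<sigma> by blast
  qed
  then show ?thesis using \<sigma>(2) by blast
qed

text \<open>Once each \<open>N j\<close> is known to be one of the four interval modules, it has a
  class \<open>c j\<close>, and only the sizes of the four classes remain to be found. They are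
  determined by how many summands are alive at suitable parameters.\<close>

lemma interval_sum_decomposition_unique:
  fixes N :: "'j \<Rightarrow> ('f::field, 'v) pmod"
  defines "S \<equiv> \<lambda>k. interval_module (summand_supports ! k) :: ('f, 'f) pmod"
  assumes ind: "\<And>j. j \<in> J \<Longrightarrow> indecomposable (N j)"
    and f: "pmod_hom (direct_sum {..<12} S) (direct_sum J N) f"
    and g: "pmod_hom (direct_sum J N) (direct_sum {..<12} S) g"
    and gf: "\<And>p x. p \<in> params \<Longrightarrow> x \<in> carrier (obj (direct_sum {..<12} S) p) \<Longrightarrow> g p (f p x) = x"
    and fg: "\<And>p y. p \<in> params \<Longrightarrow> y \<in> carrier (obj (direct_sum J N) p) \<Longrightarrow> f p (g p y) = y"
  shows "\<exists>\<sigma>. bij_betw \<sigma> J {..<12} \<and> (\<forall>j\<in>J. N j \<simeq>\<^sub>P S (\<sigma> j))"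
proof -
  let ?T = "\<lambda>k. support (support_class k)"
  have S_eq: "S k = interval_module (?T k)" if "k < 12" for k
    unfolding S_def by (simp add: summand_supports_eq_support[OF that])
  have N: "persistence_module (N j)" if "j \<in> J" for j using ind[OF that] by (simp add: indecomposable_def)
  have S: "persistence_module (S k)" if "k \<in> {..<12}" for k
    using that poset_convex_support by (simp add: S_eq persistence_module_interval)
  have "\<exists>k\<in>{..<12}. N j \<simeq>\<^sub>P (interval_module (summand_supports ! k) :: ('f, 'f) pmod)" if j: "j \<in> J" for j
  proof (rule summand_of_interval_sum[where lvl = "\<lambda>k. support_level (support_class k)"
        and K = "{..<12}" and T = "\<lambda>k. summand_supports ! k" and J = J and N = N and f = f and g = g])
    show "persistence_module (N i)" if "i \<in> J" for i using N[OF that] .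
    show "pmod_hom (direct_sum {..<12} (\<lambda>k. interval_module (summand_supports ! k))) (direct_sum J N) f"
      using f unfolding S_def .
    show "pmod_hom (direct_sum J N) (direct_sum {..<12} (\<lambda>k. interval_module (summand_supports ! k))) g"
      using g unfolding S_def .
    show "f p (g p y) = y" if "p \<in> params" "y \<in> carrier (obj (direct_sum J N) p)" for p y
      by (rule fg[OF that])
    show "poset_interval (summand_supports ! k)" if "k \<in> {..<12}" for k
      using that poset_interval_support[OF support_class_less] by (simp add: summand_supports_eq_support)
    show "h p x = 0"
      if "a \<in> {..<12}" "b \<in> {..<12}" "summand_supports ! a \<noteq> summand_supports ! b"
        "support_level (support_class a) \<le> support_level (support_class b)"
        "pmod_hom (interval_module (summand_supports ! b)) (interval_module (summand_supports ! a)) h" "p \<in> params"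
        "x \<in> carrier (obj (interval_module (summand_supports ! b) :: ('f, 'f) pmod) p)" for a b h p and x :: 'f
    proof -
      have eq: "summand_supports ! a = ?T a" "summand_supports ! b = ?T b"
        using that(1,2) by (simp_all add: summand_supports_eq_support)
      have "support_class a \<noteq> support_class b" using that(3) unfolding eq by auto
      then show ?thesis
        by (rule support_hom_vanish[OF support_class_less support_class_less _ that(4-7)[unfolded eq]])
    qed
  qed (use ind j in auto)
  then have "\<forall>j\<in>J. \<exists>k. k < 12 \<and> N j \<simeq>\<^sub>P (interval_module (summand_supports ! k) :: ('f, 'f) pmod)" by blast
  from bchoice[OF this] obtain \<kappa> where
    \<kappa>: "\<And>j. j \<in> J \<Longrightarrow> \<kappa> j < 12 \<and> N j \<simeq>\<^sub>P (interval_module (summand_supports ! \<kappa> j) :: ('f, 'f) pmod)" by blast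
  define c where "c j = support_class (\<kappa> j)" for j
  have iso: "N j \<simeq>\<^sub>P (interval_module (support (c j)) :: ('f, 'f) pmod)" if "j \<in> J" for j
    using \<kappa>[OF that] summand_supports_eq_support[of "\<kappa> j"] by (simp add: c_def)
  have "\<forall>j\<in>J. \<exists>h. pmod_hom (N j) (interval_module (support (c j)) :: ('f, 'f) pmod) h \<and>
    (\<forall>p\<in>params. bij_betw (h p) (carrier (obj (N j) p)) (carrier (obj (interval_module (support (c j)) :: ('f, 'f) pmod) p)))"
    using iso unfolding pmod_iso_def pmod_hom_def by blast
  from bchoice[OF this] obtain h where
    h: "\<And>j. j \<in> J \<Longrightarrow> pmod_hom (N j) (interval_module (support (c j)) :: ('f, 'f) pmod) (h j)"
    and bij: "\<And>j p. j \<in> J \<Longrightarrow> p \<in> params \<Longrightarrow>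
      bij_betw (h j p) (carrier (obj (N j) p)) (carrier (obj (interval_module (support (c j)) :: ('f, 'f) pmod) p))"
    by blast
  have h0: "h j p \<zero>\<^bsub>obj (N j) p\<^esub> = 0" "\<zero>\<^bsub>obj (N j) p\<^esub> \<in> carrier (obj (N j) p)" if "j \<in> J" "p \<in> params" for j p
  proof -
    interpret vspace "obj (N j) p" using persistence_moduleD(1)[OF N[OF that(1)] that(2)] by (rule vspaceI)
    show "\<zero>\<^bsub>obj (N j) p\<^esub> \<in> carrier (obj (N j) p)" by simp
    show "h j p \<zero>\<^bsub>obj (N j) p\<^esub> = 0"
      using linear_maps_zero[OF persistence_moduleD(1)[OF N[OF that(1)] that(2)]
        persistence_moduleD(1)[OF persistence_module_interval[OF poset_convex_support] that(2)]
        pmod_homD(1)[OF h[OF that(1)] that(2)]] by simp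
  qed
  \<comment> \<open>\<open>g p\<close> and \<open>f p\<close> are injective in opposite directions,
    so the numbers of summands alive at \<open>p\<close> bound each other. The maps
    \<open>h j p\<close> serve as coordinates on the spaces of \<open>N j\<close>, which are at most
    one-dimensional.\<close>
  have dim: "finite {j \<in> J. p \<in> support (c j)} \<and>
      card {j \<in> J. p \<in> support (c j)} = card {k \<in> {..<12}. p \<in> ?T k}" if p: "p \<in> params" for p
  proof -
    let ?J = "{j \<in> J. p \<in> support (c j)}" and ?K = "{k \<in> {..<12}. p \<in> ?T k}"
    have zero_inj: "y = \<zero>\<^bsub>obj (N j) p\<^esub>" if "j \<in> J" "y \<in> carrier (obj (N j) p)" "h j p y = 0" for j y
      using inj_onD[OF bij_betw_imp_inj_on[OF bij[OF that(1) p]] _ that(2) h0(2)[OF that(1) p]]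
        h0(1)[OF that(1) p] that(3) by simp
    have le1: "finite ?J \<and> card ?J \<le> card ?K"
    proof (rule direct_sum_dim_le[where J = J and N = N and K = "{..<12}" and M = S and f = "g p" and b = "\<lambda>_ y. y", OF N S p])
      show "g p \<in> linear_maps (obj (direct_sum J N) p) (obj (direct_sum {..<12} S) p)"
        by (rule pmod_homD(1)[OF g p])
      show "inj_on (g p) (carrier (obj (direct_sum J N) p))"
        by (rule inj_on_inverseI[where g = "f p"]) (rule fg[OF p])
      show "\<exists>y\<in>carrier (obj (N j) p). y \<noteq> \<zero>\<^bsub>obj (N j) p\<^esub>" if "j \<in> ?J" for j
      proof -
        have j: "j \<in> J" "p \<in> support (c j)" using that by auto
        have "1 \<in> h j p ` carrier (obj (N j) p)"
          using bij_betw_imp_surj_on[OF bij[OF j(1) p]] j(2) by simp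
        then obtain y where y: "y \<in> carrier (obj (N j) p)" "h j p y = 1" by force
        then have "y \<noteq> \<zero>\<^bsub>obj (N j) p\<^esub>" using h0(1)[OF j(1) p] by force
        then show ?thesis using y(1) by blast
      qed
      show "carrier (obj (S k) p) = {\<zero>\<^bsub>obj (S k) p\<^esub>}" if "k \<in> {..<12} - ?K" for k
        using that by (simp add: S_eq)
      show "(\<lambda>y. y) \<in> linear_maps (obj (S k) p) (obj (interval_module UNIV) p)" if "k \<in> ?K" for k
        using that by (intro linear_mapsI) (simp_all add: S_eq)
      show "y = \<zero>\<^bsub>obj (S k) p\<^esub>" if "k \<in> ?K" "y = 0" for k y
        using that by (simp add: S_eq)
    qed auto
    have "finite ?K \<and> card ?K \<le> card ?J"
    proof (rule direct_sum_dim_le[where K = J and M = N and J = "{..<12}" and N = S and f = "f p" and b = "\<lambda>j. h j p", OF S N p])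
      show "f p \<in> linear_maps (obj (direct_sum {..<12} S) p) (obj (direct_sum J N) p)"
        by (rule pmod_homD(1)[OF f p])
      show "inj_on (f p) (carrier (obj (direct_sum {..<12} S) p))"
        by (rule inj_on_inverseI[where g = "g p"]) (rule gf[OF p])
      show "\<exists>y\<in>carrier (obj (S k) p). y \<noteq> \<zero>\<^bsub>obj (S k) p\<^esub>" if "k \<in> ?K" for k
        using that by (intro bexI[of _ 1]) (simp_all add: S_eq)
      show "finite ?J" using le1 by blast
      show "carrier (obj (N j) p) = {\<zero>\<^bsub>obj (N j) p\<^esub>}" if "j \<in> J - ?J" for j
      proof -
        have j: "j \<in> J" "p \<notin> support (c j)" using that by auto
        have "h j p y = 0" if "y \<in> carrier (obj (N j) p)" for y
          using pmod_homD(2)[OF h[OF j(1)] p that] j(2) by simp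
        then show ?thesis using zero_inj[OF j(1)] h0(2)[OF j(1) p] by blast
      qed
      show "h j p \<in> linear_maps (obj (N j) p) (obj (interval_module UNIV) p)" if "j \<in> ?J" for j
        using linear_mapsD[OF pmod_homD(1)[OF h p], of j] that by (intro linear_mapsI) simp_all
      show "y = \<zero>\<^bsub>obj (N j) p\<^esub>" if "j \<in> ?J" "y \<in> carrier (obj (N j) p)" "h j p y = 0" for j y
        using zero_inj that by blast
    qed auto
    with le1 show ?thesis by simp
  qed
  define A where "A t = {j \<in> J. c j = t}" for t
  have c4: "c j < 4" for j by (simp add: c_def support_class_less)
  have classes: "finite {j \<in> J. c j \<in> X} \<and> card {j \<in> J. c j \<in> X} = card {k \<in> {..<12}. support_class k \<in> X}"
    if "p \<in> params" "\<And>t. t < 4 \<Longrightarrow> p \<in> support t \<longleftrightarrow> t \<in> X" for p X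
    using dim[OF that(1)] that(2)[OF c4] that(2)[OF support_class_less] by simp
  have K: "{k \<in> {..<12}. support_class k \<in> {0}} = {0}"
    "{k \<in> {..<12}. support_class k \<in> {0, 1}} = {0, 1}"
    "{k \<in> {..<12}. support_class k \<in> {0, 1, 2}} = {..<6}"
    "{k \<in> {..<12}. support_class k \<in> {0, 1, 3}} = {0, 1} \<union> {6..<12}"
    by (auto simp: support_class_def)
  have part: "{j \<in> J. c j \<in> {0}} = A 0" "{j \<in> J. c j \<in> {0, 1}} = A 0 \<union> A 1"
    "{j \<in> J. c j \<in> {0, 1, 2}} = A 0 \<union> A 1 \<union> A 2" "{j \<in> J. c j \<in> {0, 1, 3}} = A 0 \<union> A 1 \<union> A 3"
    by (auto simp: A_def)
  \<comment> \<open>The parameters \<open>(1, 1)\<close>, \<open>(3, 5)\<close>,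
    \<open>(2, 5)\<close> and \<open>(3, 3 / 2)\<close> lie exactly in the supports 0; 0 and 1; 0, 1
    and 2; 0, 1 and 3. Differences of the counts isolate each class.\<close>
  have "finite (A 0) \<and> card (A 0) = 1"
    using classes[of "(1, 1)" "{0}"] unfolding K part
    by (simp add: params_def support_iff)
  moreover have "finite (A 0 \<union> A 1) \<and> card (A 0 \<union> A 1) = 2"
    using classes[of "(3, 5)" "{0, 1}"] unfolding K part
    by (simp add: params_def support_iff)
  moreover have "finite (A 0 \<union> A 1 \<union> A 2) \<and> card (A 0 \<union> A 1 \<union> A 2) = 6"
    using classes[of "(2, 5)" "{0, 1, 2}"] unfolding K part
    by (simp add: params_def support_iff)
  moreover have "finite (A 0 \<union> A 1 \<union> A 3) \<and> card (A 0 \<union> A 1 \<union> A 3) = 8"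
  proof -
    have "t \<in> {0, 1, 3} \<longleftrightarrow> (3, 3 / 2) \<in> support t" if "t < 4" for t
      using that by (elim less_4_cases) (simp_all add: support_iff)
    moreover have "card ({0, 1} \<union> {6..<12 :: nat}) = 8" by (subst card_Un_disjoint) auto
    ultimately show ?thesis
      using classes[of "(3, 3 / 2)" "{0, 1, 3}"] unfolding K part by (simp add: params_def)
  qed
  ultimately have fin: "finite (A 0)" "finite (A 1)" "finite (A 2)" "finite (A 3)"
    and card': "card (A 0) = 1" "card (A 0 \<union> A 1) = 2" "card (A 0 \<union> A 1 \<union> A 2) = 6" "card (A 0 \<union> A 1 \<union> A 3) = 8"
    by simp_all
  have disj: "A 0 \<inter> A 1 = {}" "(A 0 \<union> A 1) \<inter> A 2 = {}" "(A 0 \<union> A 1) \<inter> A 3 = {}"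
    unfolding A_def by auto
  have card: "card (A 0) = 1" "card (A 1) = 1" "card (A 2) = 4" "card (A 3) = 6"
    using card' card_Un_disjoint[OF fin(1,2) disj(1)]
      card_Un_disjoint[OF finite_UnI[OF fin(1,2)] fin(3) disj(2)]
      card_Un_disjoint[OF finite_UnI[OF fin(1,2)] fin(4) disj(3)] by linarith+
  have K1: "{k \<in> {..<12}. support_class k = 0} = {0}" "{k \<in> {..<12}. support_class k = 1} = {1}"
    "{k \<in> {..<12}. support_class k = 2} = {2..<6}" "{k \<in> {..<12}. support_class k = 3} = {6..<12}"
    by (auto simp: support_class_def)
  have "finite (A t) \<and> card (A t) = card {k \<in> {..<12}. support_class k = t}" for t
  proof (cases "t < 4")
    case True
    then show ?thesis
      by (elim less_4_cases) (simp_all only: fin card K1, simp_all)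
  next
    case False
    \<comment> \<open>The matching runs over all natural numbers as classes; those from 4 on are
      empty on both sides.\<close>
    then have "A t = {}" "{k \<in> {..<12}. support_class k = t} = {}"
      using c4 support_class_less by (auto simp: A_def)
    then show ?thesis by simp
  qed
  then obtain \<sigma> where \<sigma>: "bij_betw \<sigma> J {..<12}" "\<forall>j\<in>J. support_class (\<sigma> j) = c j"
    using matching_bijection[of "{..<12}" J c support_class] unfolding A_def by auto
  have "N j \<simeq>\<^sub>P S (\<sigma> j)" if "j \<in> J" for j
    using iso[OF that] \<sigma>(2) bij_betwE[OF \<sigma>(1)] that by (simp add: S_eq)
  then show ?thesis using \<sigma>(1) by blast
qed


section \<open>Singular homology in degree zero\<close>

lemma lookup_fscale [simp]: "Poly_Mapping.lookup (fscale k c) s = k * Poly_Mapping.lookup c s"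
  by (simp add: fscale_def Poly_Mapping.map.rep_eq when_def)

lemma keys_fscale: "Poly_Mapping.keys (fscale k c) \<subseteq> Poly_Mapping.keys c"
  by (auto simp: in_keys_iff)

lemma fscale_simps:
  "fscale k (c + d) = fscale k c + fscale k d" "fscale (k + l) c = fscale k c + fscale l c"
  "fscale (k * l) c = fscale k (fscale l c)" "fscale 1 c = c" "fscale 0 c = 0" "fscale k 0 = 0"
  "fscale k (Poly_Mapping.single s a) = Poly_Mapping.single s (k * a)" "fscale (- 1) c = - c"
  by (rule poly_mapping_eqI; simp add: lookup_add lookup_single when_def algebra_simps)+

lemma fscale_sum: "fscale k (\<Sum>i\<in>A. c i) = (\<Sum>i\<in>A. fscale k (c i))"
  by (induction A rule: infinite_finite_induct) (simp_all add: fscale_simps)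

lemma sum_keys_superset:
  assumes "finite A" "Poly_Mapping.keys c \<subseteq> A" "\<And>s. h s 0 = 0"
  shows "(\<Sum>s\<in>Poly_Mapping.keys c. h s (Poly_Mapping.lookup c s)) = (\<Sum>s\<in>A. h s (Poly_Mapping.lookup c s))"
  using assms by (intro sum.mono_neutral_left) (auto simp: in_keys_iff)

lemma sum_single_lookup:
  assumes "finite A" "Poly_Mapping.keys c \<subseteq> A"
  shows "(\<Sum>s\<in>A. Poly_Mapping.single s (Poly_Mapping.lookup c s)) = c"
proof (rule poly_mapping_eqI)
  fix t
  have "t \<notin> A \<Longrightarrow> Poly_Mapping.lookup c t = 0" using assms(2) by (auto simp: in_keys_iff)
  then show "Poly_Mapping.lookup (\<Sum>s\<in>A. Poly_Mapping.single s (Poly_Mapping.lookup c s)) t = Poly_Mapping.lookup c t"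
    using assms(1) by (auto simp: lookup_sum lookup_single when_def)
qed

text \<open>Cancellation can make the keys of \<open>c + d\<close> smaller than the union of the
  keys, so all three sums are first extended to that union.\<close>

lemma sum_keys_add:
  assumes "\<And>s. h s 0 = 0" "\<And>s a b. h s (a + b) = h s a + h s b"
  shows "(\<Sum>s\<in>Poly_Mapping.keys (c + d). h s (Poly_Mapping.lookup (c + d) s)) =
    (\<Sum>s\<in>Poly_Mapping.keys c. h s (Poly_Mapping.lookup c s)) + (\<Sum>s\<in>Poly_Mapping.keys d. h s (Poly_Mapping.lookup d s))"
proof -
  let ?A = "Poly_Mapping.keys c \<union> Poly_Mapping.keys d"
  have A: "finite ?A" "Poly_Mapping.keys c \<subseteq> ?A" "Poly_Mapping.keys d \<subseteq> ?A" "Poly_Mapping.keys (c + d) \<subseteq> ?A"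
    using keys_add[of c d] by auto
  show ?thesis
    unfolding sum_keys_superset[OF A(1,2), of h, OF assms(1)] sum_keys_superset[OF A(1,3), of h, OF assms(1)]
      sum_keys_superset[OF A(1,4), of h, OF assms(1)]
    by (simp add: lookup_add assms(2) sum.distrib)
qed

lemma sum_keys_fscale:
  assumes "\<And>s. h s 0 = 0"
  shows "(\<Sum>s\<in>Poly_Mapping.keys (fscale k c). h s (Poly_Mapping.lookup (fscale k c) s)) =
    (\<Sum>s\<in>Poly_Mapping.keys c. h s (k * Poly_Mapping.lookup c s))"
  using sum_keys_superset[OF finite_keys keys_fscale, of h k c, OF assms] by simp

lemma fboundary_add: "fboundary p (c + d) = fboundary p c + fboundary p d"
  using sum_keys_add[where h = "\<lambda>s a. \<Sum>k\<le>p. Poly_Mapping.single (singular_face p k s) ((-1) ^ k * a)", of c d]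
  by (simp add: fboundary_def single_add sum.distrib distrib_left)

lemma fboundary_fscale: "fboundary p (fscale k c) = fscale k (fboundary p c)"
  using sum_keys_fscale[where h = "\<lambda>s a. \<Sum>k\<le>p. Poly_Mapping.single (singular_face p k s) ((-1) ^ k * a)", of k c]
  by (simp add: fboundary_def fscale_sum fscale_simps mult.left_commute)

lemma fchains_closed:
  "0 \<in> fchains p X" "c \<in> fchains p X \<Longrightarrow> d \<in> fchains p X \<Longrightarrow> c + d \<in> fchains p X"
  "c \<in> fchains p X \<Longrightarrow> fscale k c \<in> fchains p X"
  using keys_add[of c d] keys_fscale[of k c] unfolding fchains_def mem_Collect_eq by (auto simp del: lookup_fscale)

lemma fboundary_zero: "fboundary p 0 = 0"
  by (simp add: fboundary_def)

lemma fcycles_closed: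
  "0 \<in> fcycles p X" "c \<in> fcycles p X \<Longrightarrow> d \<in> fcycles p X \<Longrightarrow> c + d \<in> fcycles p X"
  "c \<in> fcycles p X \<Longrightarrow> fscale k c \<in> fcycles p X"
  by (simp_all add: fcycles_def fchains_closed fboundary_add fboundary_fscale fboundary_zero fscale_simps)

lemma fboundaries_closed:
  "0 \<in> fboundaries p X" "c \<in> fboundaries p X \<Longrightarrow> d \<in> fboundaries p X \<Longrightarrow> c + d \<in> fboundaries p X"
  "c \<in> fboundaries p X \<Longrightarrow> fscale k c \<in> fboundaries p X"
proof -
  show "0 \<in> fboundaries p X"
    unfolding fboundaries_def by (rule image_eqI[of _ _ 0]) (simp_all add: fboundary_zero fchains_closed)
  show "c + d \<in> fboundaries p X" if "c \<in> fboundaries p X" "d \<in> fboundaries p X"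
    using that unfolding fboundaries_def by (auto simp: fchains_closed simp flip: fboundary_add)
  show "fscale k c \<in> fboundaries p X" if "c \<in> fboundaries p X"
    using that unfolding fboundaries_def by (auto simp: fchains_closed simp flip: fboundary_fscale)
qed

lemma fboundaries_uminus: "c \<in> fboundaries p X \<Longrightarrow> - c \<in> fboundaries p X"
  using fboundaries_closed(3)[of c p X "- 1"] by (simp add: fscale_simps)

lemma fboundaries_diff: "c \<in> fboundaries p X \<Longrightarrow> d \<in> fboundaries p X \<Longrightarrow> c - d \<in> fboundaries p X"
  using fboundaries_closed(2)[OF _ fboundaries_uminus[of d p X], of c] by simp

lemma fboundaries_sum: "(\<And>i. i \<in> A \<Longrightarrow> c i \<in> fboundaries p X) \<Longrightarrow> (\<Sum>i\<in>A. c i) \<in> fboundaries p X"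
  by (induction A rule: infinite_finite_induct) (simp_all add: fboundaries_closed)

lemma mem_fclass: "d \<in> fclass p X c \<longleftrightarrow> d - c \<in> fboundaries p X"
proof -
  have "\<exists>b. d = c + b \<and> b \<in> fboundaries p X" if "d - c \<in> fboundaries p X"
    using that by (intro exI[of _ "d - c"]) simp
  then show ?thesis by (auto simp: fclass_def)
qed

lemma fclass_self: "c \<in> fclass p X c"
  by (simp add: mem_fclass fboundaries_closed)

lemma fclass_eq_iff: "fclass p X c = fclass p X d \<longleftrightarrow> c - d \<in> fboundaries p X"
proof
  assume "fclass p X c = fclass p X d"
  then show "c - d \<in> fboundaries p X" using fclass_self[of c p X] by (simp add: mem_fclass)
next
  assume cd: "c - d \<in> fboundaries p X"
  have "e - c \<in> fboundaries p X \<longleftrightarrow> e - d \<in> fboundaries p X" for e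
    using fboundaries_closed(2)[OF _ cd, of "e - c"] fboundaries_diff[OF _ cd, of "e - d"] by auto
  then show "fclass p X c = fclass p X d" by (auto simp: mem_fclass)
qed

lemma UN_const_nonempty: "x \<in> A \<Longrightarrow> (\<And>y. y \<in> A \<Longrightarrow> F y = C) \<Longrightarrow> (\<Union>y\<in>A. F y) = C"
  by auto

text \<open>The operations are unions over all representatives. The content is that every choice of
  representatives gives the same coset, so the union collapses to it.\<close>

lemma fhomology_simps:
  "carrier (fhomology p X) = fclass p X ` fcycles p X"
  "\<zero>\<^bsub>fhomology p X\<^esub> = fclass p X 0"
  "fclass p X c \<oplus>\<^bsub>fhomology p X\<^esub> fclass p X d = fclass p X (c + d)"
  "k \<odot>\<^bsub>fhomology p X\<^esub> fclass p X c = fclass p X (fscale k c)"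
proof -
  show "carrier (fhomology p X) = fclass p X ` fcycles p X" "\<zero>\<^bsub>fhomology p X\<^esub> = fclass p X 0"
    by (simp_all add: fhomology_def)
  have ne: "fclass p X c \<noteq> {}" "fclass p X d \<noteq> {}" using fclass_self by blast+
  have "fclass p X (a + b) = fclass p X (c + d)" if "a \<in> fclass p X c" "b \<in> fclass p X d" for a b
    using fboundaries_closed(2)[of "a - c" p X "b - d"] that
    by (simp add: fclass_eq_iff mem_fclass algebra_simps)
  then show "fclass p X c \<oplus>\<^bsub>fhomology p X\<^esub> fclass p X d = fclass p X (c + d)"
    by (simp add: fhomology_def ne)
  have "fclass p X (fscale k a) = fclass p X (fscale k c)" if "a \<in> fclass p X c" for a
  proof -
    have "fscale k a - fscale k c = fscale k (a - c)"
      by (rule poly_mapping_eqI) (simp add: lookup_minus algebra_simps)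
    then show ?thesis
      using fboundaries_closed(3)[of "a - c" p X k] that by (simp add: fclass_eq_iff mem_fclass)
  qed
  then show "k \<odot>\<^bsub>fhomology p X\<^esub> fclass p X c = fclass p X (fscale k c)"
    by (simp add: fhomology_def ne)
qed

lemma vec_space_fhomology: "vec_space (fhomology p X)"
  by (rule vec_spaceI)
    (auto simp: fhomology_simps fcycles_closed fscale_simps ac_simps intro!: imageI)

lemma fchains_mono:
  assumes "S \<subseteq> S'"
  shows "fchains p (top_of_set S) \<subseteq> fchains p (top_of_set S')"
  using singular_simplex_mono[OF _ assms] by (auto simp: fchains_def)

lemma fboundary_in_fchains:
  assumes "d \<in> fchains (Suc p) X"
  shows "fboundary (Suc p) d \<in> fchains p X"
proof -
  have "Poly_Mapping.keys (\<Sum>s\<in>Poly_Mapping.keys d. \<Sum>k\<le>Suc p. Poly_Mapping.single (singular_face (Suc p) k s)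
      ((- 1) ^ k * Poly_Mapping.lookup d s)) \<subseteq> singular_simplex_set p X"
  proof (rule order_trans[OF keys_sum UN_least])
    fix s assume s: "s \<in> Poly_Mapping.keys d"
    then have "singular_simplex (Suc p) X s" using assms by (auto simp: fchains_def)
    from singular_simplex_singular_face[OF this]
    have face: "singular_simplex p X (singular_face (Suc p) k s)" if "k \<le> Suc p" for k
      using that by simp
    show "Poly_Mapping.keys (\<Sum>k\<le>Suc p. Poly_Mapping.single (singular_face (Suc p) k s)
        ((- 1) ^ k * Poly_Mapping.lookup d s)) \<subseteq> singular_simplex_set p X"
      by (rule order_trans[OF keys_sum UN_least]) (use face in \<open>auto split: if_splits\<close>)
  qed
  then show ?thesis by (simp add: fchains_def fboundary_def)
qed

text \<open>A representative differs from the cycle \<open>c\<close> by a boundary and is therefore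
  a chain in \<open>S\<close>. Singular simplices are extensional functions, so composing them with
  the identity leaves them unchanged.\<close>

lemma fhom_induced_inclusion:
  assumes "S \<subseteq> S'" "c \<in> fcycles p (top_of_set S)"
  shows "fhom_induced p (top_of_set S') (\<lambda>z. z) (fclass p (top_of_set S) c) = fclass p (top_of_set S') c"
  unfolding fhom_induced_def
proof (rule UN_const_nonempty[OF fclass_self])
  fix a assume "a \<in> fclass p (top_of_set S) c"
  then have ac: "a - c \<in> fboundaries p (top_of_set S)" by (simp add: mem_fclass)
  have "a - c \<in> fchains p (top_of_set S)"
    using ac fboundary_in_fchains by (auto simp: fboundaries_def)
  then have "c + (a - c) \<in> fchains p (top_of_set S)"
    using assms(2) by (intro fchains_closed) (auto simp: fcycles_def)
  then have a: "a \<in> fchains p (top_of_set S)" by simp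
  have "fchain_map p (\<lambda>z. z) a = (\<Sum>s\<in>Poly_Mapping.keys a. Poly_Mapping.single s (Poly_Mapping.lookup a s))"
    unfolding fchain_map_def
  proof (rule sum.cong[OF HOL.refl])
    fix s assume "s \<in> Poly_Mapping.keys a"
    then have "singular_simplex p (top_of_set S) s" using a by (auto simp: fchains_def)
    then have "simplex_map p (\<lambda>z. z) s = s" by (rule simplex_map_id_gen) simp
    then show "Poly_Mapping.single (simplex_map p (\<lambda>z. z) s) (Poly_Mapping.lookup a s) =
        Poly_Mapping.single s (Poly_Mapping.lookup a s)" by simp
  qed
  also have "\<dots> = a" by (simp add: sum_single_lookup)
  finally have "fchain_map p (\<lambda>z. z) a = a" .
  moreover have "a - c \<in> fboundaries p (top_of_set S')"
    using ac fchains_mono[OF assms(1)] unfolding fboundaries_def by blast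
  ultimately show "fclass p (top_of_set S') (fchain_map p (\<lambda>z. z) a) = fclass p (top_of_set S') c"
    by (simp add: fclass_eq_iff)
qed

section \<open>Points and paths as singular simplices\<close>

definition simplex_origin :: "nat \<Rightarrow> real" where
  "simplex_origin = (\<lambda>i. if i = 0 then 1 else 0)"

text \<open>The restriction makes the function extensional, as singular simplices are required to
  be.\<close>

definition point_simplex :: "'a \<Rightarrow> (nat \<Rightarrow> real) \<Rightarrow> 'a" where
  "point_simplex a = restrict (\<lambda>_. a) (standard_simplex 0)"

lemma standard_simplex_0_origin: "standard_simplex 0 = {simplex_origin}"
  by (auto simp: standard_simplex_def simplex_origin_def fun_eq_iff)

lemma singular_simplex_point: "a \<in> S \<Longrightarrow> singular_simplex 0 (top_of_set S) (point_simplex a)"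
  by (simp add: singular_simplex_def point_simplex_def)

lemma singular_simplex_0_eq_point:
  assumes "singular_simplex 0 (top_of_set S) s"
  shows "s = point_simplex (s simplex_origin)" "s simplex_origin \<in> S"
proof -
  show "s = point_simplex (s simplex_origin)"
  proof
    show "s x = point_simplex (s simplex_origin) x" for x
      using assms by (cases "x = simplex_origin")
        (simp_all add: singular_simplex_def point_simplex_def standard_simplex_0_origin extensional_def)
  qed
  show "s simplex_origin \<in> S"
    using assms by (auto simp: singular_simplex_def continuous_map_in_subtopology standard_simplex_0_origin)
qed

lemma point_simplex_origin [simp]: "point_simplex a simplex_origin = a"
  by (simp add: point_simplex_def standard_simplex_0_origin)

lemma path_component_faces:
  assumes "singular_simplex (Suc 0) (top_of_set S) s"
  shows "path_component S (singular_face (Suc 0) 0 s simplex_origin) (singular_face (Suc 0) (Suc 0) s simplex_origin)"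
proof -
  \<comment> \<open>\<open>h\<close> runs along the 1-simplex from vertex 1 to vertex 0. Face 0 is
    opposite to vertex 0, so the path leads from face 0 to face 1.\<close>
  define h where "h t = (\<lambda>i::nat. if i = 0 then t else if i = 1 then 1 - t else (0 :: real))" for t
  have cont: "continuous_map (subtopology (powertop_real UNIV) (standard_simplex (Suc 0))) (top_of_set S) s"
    using assms by (simp add: singular_simplex_def)
  have h: "continuous_map (top_of_set {0..1}) (subtopology (powertop_real UNIV) (standard_simplex (Suc 0))) h"
    unfolding continuous_map_in_subtopology
  proof
    show "continuous_map (top_of_set {0..1}) (powertop_real UNIV) h"
      unfolding continuous_map_componentwise_UNIV
    proof
      show "continuous_map (top_of_set {0..1}) euclideanreal (\<lambda>t. h t k)" for k
        by (cases "k = 0"; cases "k = 1") (simp_all add: h_def continuous_intros)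
    qed
    show "h \<in> topspace (top_of_set {0..1}) \<rightarrow> standard_simplex (Suc 0)"
      by (auto simp: h_def standard_simplex_def)
  qed
  have "continuous_map (top_of_set {0..1}) (top_of_set S) (s \<circ> h)"
    by (rule continuous_map_compose[OF h cont])
  then have "path (s \<circ> h)" "path_image (s \<circ> h) \<subseteq> S"
    by (auto simp: path_def path_image_def continuous_map_in_subtopology)
  moreover have "singular_face (Suc 0) 0 s simplex_origin = (s \<circ> h) 0"
    "singular_face (Suc 0) (Suc 0) s simplex_origin = (s \<circ> h) 1"
    unfolding singular_face_def
    by (simp_all add: standard_simplex_0_origin) (rule arg_cong[where f = s];
      force simp: simplical_face_def simplex_origin_def h_def fun_eq_iff)+
  ultimately show ?thesis
    unfolding path_component_def pathstart_def pathfinish_def by metis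
qed

lemma point_difference_boundary:
  assumes "path_component S a b"
  shows "Poly_Mapping.single (point_simplex a) k - Poly_Mapping.single (point_simplex b) k
    \<in> fboundaries 0 (top_of_set S)"
proof -
  obtain g where g: "path g" "path_image g \<subseteq> S" "g 0 = a" "g 1 = b"
    using assms by (auto simp: path_component_def pathstart_def pathfinish_def)
  \<comment> \<open>Taking coordinate 0 as time puts \<open>a = g 0\<close> on face 0, which has
    sign plus in the boundary, and \<open>b = g 1\<close> on face 1, which has sign minus.\<close>
  define s where "s = restrict (\<lambda>x. g (x 0)) (standard_simplex (Suc 0))"
  have "continuous_map (subtopology (powertop_real UNIV) (standard_simplex (Suc 0))) (top_of_set {0..1}) (\<lambda>x. x 0)"
    unfolding continuous_map_in_subtopology
    by (auto simp: standard_simplex_def intro!: continuous_map_from_subtopology continuous_map_product_projection)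
  moreover have "continuous_map (top_of_set {0..1}) (top_of_set S) g"
    using g(1,2) by (auto simp: path_def path_image_def continuous_map_in_subtopology)
  ultimately have "continuous_map (subtopology (powertop_real UNIV) (standard_simplex (Suc 0))) (top_of_set S) (g \<circ> (\<lambda>x. x 0))"
    by (rule continuous_map_compose)
  then have s: "singular_simplex (Suc 0) (top_of_set S) s"
    unfolding singular_simplex_def s_def
    by (auto intro: continuous_map_eq)
  have c: "Poly_Mapping.single s k \<in> fchains (Suc 0) (top_of_set S)"
    using s by (auto simp: fchains_def split: if_splits)
  have "simplical_face i simplex_origin \<in> standard_simplex (Suc 0)" if "i \<le> Suc 0" for i
    by (rule simplical_face_in_standard_simplex) (use that in \<open>auto simp: standard_simplex_0_origin\<close>)
  then have "singular_face (Suc 0) i s = point_simplex (g (simplical_face i simplex_origin 0))" if "i \<le> Suc 0" for i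
    using that by (intro ext) (simp add: singular_face_def point_simplex_def s_def standard_simplex_0_origin restrict_def)
  then have faces: "singular_face (Suc 0) 0 s = point_simplex a" "singular_face (Suc 0) (Suc 0) s = point_simplex b"
    using g(3,4) by (auto simp: simplical_face_def simplex_origin_def)
  have "fboundary (Suc 0) (Poly_Mapping.single s k) =
      Poly_Mapping.single (point_simplex a) k - Poly_Mapping.single (point_simplex b) k"
    by (cases "k = 0") (simp_all add: fboundary_def faces single_uminus)
  then show ?thesis using c unfolding fboundaries_def by (metis image_eqI)
qed

text \<open>The pairing of a chain with the cochain \<open>w\<close>.\<close>

definition evaluate :: "(((nat \<Rightarrow> real) \<Rightarrow> 'a) \<Rightarrow> 'f::field) \<Rightarrow> ('a, 'f) fchain \<Rightarrow> 'f" where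
  "evaluate w c = (\<Sum>s\<in>Poly_Mapping.keys c. Poly_Mapping.lookup c s * w s)"

lemma evaluate_add: "evaluate w (c + d) = evaluate w c + evaluate w d"
  using sum_keys_add[where h = "\<lambda>s a. a * w s", of c d] by (simp add: evaluate_def distrib_right)

lemma evaluate_fscale: "evaluate w (fscale k c) = k * evaluate w c"
  using sum_keys_fscale[where h = "\<lambda>s a. a * w s", of k c]
  by (simp add: evaluate_def sum_distrib_left mult.assoc)

lemma evaluate_diff: "evaluate w (c - d) = evaluate w c - evaluate w d"
  using evaluate_add[of w c "- d"] evaluate_fscale[of w "- 1" d] by (simp add: fscale_simps)

lemma evaluate_single [simp]: "evaluate w (Poly_Mapping.single s a) = a * w s"
  by (cases "a = 0") (simp_all add: evaluate_def)

lemma evaluate_sum: "evaluate w (\<Sum>i\<in>A. c i) = (\<Sum>i\<in>A. evaluate w (c i))"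
  by (induction A rule: infinite_finite_induct) (simp_all add: evaluate_add evaluate_def[of w 0])

text \<open>The first assumption is the cocycle condition in degree 0; the pairing with a boundary
  then cancels simplex by simplex.\<close>

lemma evaluate_boundary:
  assumes "\<And>s. singular_simplex (Suc 0) X s \<Longrightarrow> w (singular_face (Suc 0) 0 s) = w (singular_face (Suc 0) (Suc 0) s)"
    and "c \<in> fboundaries 0 X"
  shows "evaluate w c = 0"
proof -
  obtain d where d: "d \<in> fchains (Suc 0) X" "c = fboundary (Suc 0) d"
    using assms(2) by (auto simp: fboundaries_def)
  have "w (singular_face (Suc 0) 0 s) = w (singular_face (Suc 0) (Suc 0) s)" if "s \<in> Poly_Mapping.keys d" for s
    using d(1) that assms(1) by (auto simp: fchains_def)
  then show ?thesis
    unfolding d(2) fboundary_def by (simp add: evaluate_sum evaluate_add)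
qed


section \<open>The zeroth persistent homology of the configuration spaces\<close>

abbreviation conf_space :: "param \<Rightarrow> (hpoint \<times> hpoint) topology" where
  "conf_space p \<equiv> top_of_set (hconf (fst p) (snd p))"

lemma PH_simps:
  "obj (PH n) p = fhomology n (conf_space p)"
  "mor (PH n) p q = fhom_induced n (conf_space q) (\<lambda>z. z)"
  by (simp_all add: PH_def case_prod_beta)

lemma hconf_mono:
  assumes "p \<in> params" "q \<in> params" "p \<preceq> q"
  shows "hconf (fst p) (snd p) \<subseteq> hconf (fst q) (snd q)"
proof -
  have L: "0 < snd p" "0 < snd q" "fst q \<le> fst p" "snd p \<le> snd q"
    using assms by (auto simp: params_def param_le_def)
  have "tree_dist (snd p) x y \<le> tree_dist (snd q) x y" for x y
    unfolding tree_dist_def using L(4) by (simp add: mult_right_mono)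
  then show ?thesis
    unfolding hconf_eq[OF L(1)] hconf_eq[OF L(2)] using L(3) by (auto intro: order_trans)
qed

lemma fcycles_mono: "S \<subseteq> S' \<Longrightarrow> fcycles p (top_of_set S) \<subseteq> fcycles p (top_of_set S')"
  using fchains_mono[of S S' p] by (auto simp: fcycles_def)

text \<open>Inclusions send the class of a cycle to the class of the same cycle, which reduces the
  functor laws to identities between classes.\<close>

lemma persistence_module_PH: "persistence_module (PH n :: ('f::field, (hpoint \<times> hpoint, 'f) fchain set) pmod)"
  unfolding persistence_module_def PH_simps
proof (intro conjI ballI impI)
  show "vec_space (fhomology n (conf_space p) :: ('f, (hpoint \<times> hpoint, 'f) fchain set) module)" for p by (rule vec_space_fhomology)
  have cls: "fhom_induced n (conf_space q) (\<lambda>z. z) (fclass n (conf_space p) c) = fclass n (conf_space q) c"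
    "c \<in> fcycles n (conf_space q)"
    if "p \<in> params" "q \<in> params" "p \<preceq> q" "c \<in> fcycles n (conf_space p)"
    for p q and c :: "(hpoint \<times> hpoint, 'f) fchain"
    using fhom_induced_inclusion[OF hconf_mono[OF that(1-3)] that(4)] fcycles_mono[OF hconf_mono[OF that(1-3)]]
      that(4) by auto
  show "fhom_induced n (conf_space q) (\<lambda>z. z) \<in> 
      linear_maps (fhomology n (conf_space p) :: ('f, (hpoint \<times> hpoint, 'f) fchain set) module) (fhomology n (conf_space q))"
    if "p \<in> params" "q \<in> params" "p \<preceq> q" for p q
    by (rule linear_mapsI)
      (use cls[OF that] in \<open>auto simp: fhomology_simps fcycles_closed\<close>)
  show "fhom_induced n (conf_space p) (\<lambda>z. z) x = x"
    if "p \<in> params" "x \<in> carrier (fhomology n (conf_space p))"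
    for p and x :: "(hpoint \<times> hpoint, 'f) fchain set"
    using cls[of p p] that by (auto simp: fhomology_simps param_le_def)
  fix p q s and x :: "(hpoint \<times> hpoint, 'f) fchain set"
  assume p: "p \<in> params" and q: "q \<in> params" and s: "s \<in> params" and le: "p \<preceq> q \<and> q \<preceq> s"
    and x: "x \<in> carrier (fhomology n (conf_space p))"
  have ps: "p \<preceq> s" using le by (auto simp: param_le_def)
  obtain c where c: "c \<in> fcycles n (conf_space p)" "x = fclass n (conf_space p) c"
    using x by (auto simp: fhomology_simps)
  show "fhom_induced n (conf_space s) (\<lambda>z. z) x =
      fhom_induced n (conf_space s) (\<lambda>z. z) (fhom_induced n (conf_space q) (\<lambda>z. z) x)"
    unfolding c(2) cls(1)[OF p s ps c(1)] cls(1)[OF p q conjunct1[OF le] c(1)]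
      cls(1)[OF q s conjunct2[OF le] cls(2)[OF p q conjunct1[OF le] c(1)]] ..
qed

lemma fcycles_0: "fcycles 0 X = fchains 0 X"
  by (simp add: fcycles_def fboundary_def)

definition weight_cochain :: "nat \<Rightarrow> ((nat \<Rightarrow> real) \<Rightarrow> hpoint \<times> hpoint) \<Rightarrow> 'f::field" where
  "weight_cochain i s = of_bool (weight i (s simplex_origin))"

definition active :: "param \<Rightarrow> nat set" where
  "active p = {i \<in> {..<12}. p \<in> summand_supports ! i}"

lemma activeD: "i \<in> active p \<Longrightarrow> i < 12" "i \<in> active p \<Longrightarrow> p \<in> summand_supports ! i"
  by (auto simp: active_def)

lemma finite_active [simp]: "finite (active p)"
  by (simp add: active_def)

lemma evaluate_weight_boundary:
  assumes "i \<in> active p" "c \<in> fboundaries 0 (conf_space p)"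
  shows "evaluate (weight_cochain i) c = 0"
proof (rule evaluate_boundary[OF _ assms(2)])
  fix s assume "singular_simplex (Suc 0) (conf_space p) s"
  from weight_path_component[OF _ _ path_component_faces[OF this], of i] activeD[OF assms(1)]
  show "weight_cochain i (singular_face (Suc 0) 0 s) = weight_cochain i (singular_face (Suc 0) (Suc 0) s)"
    by (simp add: weight_cochain_def)
qed

definition leaf_chain :: "param \<Rightarrow> (nat \<Rightarrow> 'f::field) \<Rightarrow> (hpoint \<times> hpoint, 'f) fchain" where
  "leaf_chain p a = (\<Sum>k\<in>active p. Poly_Mapping.single (point_simplex (leaf_config k)) (a k))"

lemma leaf_chain_in_fchains: "leaf_chain p a \<in> fchains 0 (conf_space p)"
proof -
  have "Poly_Mapping.keys (Poly_Mapping.single (point_simplex (leaf_config k)) (a k)) \<subseteq> singular_simplex_set 0 (conf_space p)"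
    if "k \<in> active p" for k
    using singular_simplex_point[of "leaf_config k" "hconf (fst p) (snd p)"]
      leaf_config_in_hconf[of k "fst p" "snd p"] activeD[OF that] by auto
  then show ?thesis
    unfolding leaf_chain_def fchains_def mem_Collect_eq
    by (intro order_trans[OF keys_sum UN_least])
qed

text \<open>The matrix of weights of leaf configurations is unitriangular.\<close>

lemma evaluate_leaf_chain:
  assumes "i \<in> active p"
  shows "evaluate (weight_cochain i) (leaf_chain p a) =
    (if i = 0 then a 0 + (\<Sum>k\<in>active p - {0}. a k)
     else if i = 1 then a 1 + (\<Sum>k\<in>active p \<inter> {9..}. a k) else a i)"
proof -
  have "evaluate (weight_cochain i) (leaf_chain p a) =
      (\<Sum>k\<in>active p. a k * of_bool (weight i (leaf_config k)))"
    by (simp add: leaf_chain_def evaluate_sum weight_cochain_def)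
  also have "\<dots> = (\<Sum>k\<in>active p. if i = 0 \<or> i = k \<or> i = 1 \<and> 9 \<le> k then a k else 0)"
    by (rule sum.cong) (use activeD assms in \<open>auto simp: weight_leaf_config\<close>)
  also have "\<dots> = (\<Sum>k\<in>{k \<in> active p. i = 0 \<or> i = k \<or> i = 1 \<and> 9 \<le> k}. a k)"
    by (simp add: sum.inter_filter)
  finally have eq: "evaluate (weight_cochain i) (leaf_chain p a) =
      (\<Sum>k\<in>{k \<in> active p. i = 0 \<or> i = k \<or> i = 1 \<and> 9 \<le> k}. a k)" .
  consider "i = 0" | "i = 1" | "i \<noteq> 0" "i \<noteq> 1" by blast
  then show ?thesis
  proof cases
    case 1
    then show ?thesis unfolding eq using sum.remove[of "active p" 0 a] assms by simp
  next
    case 2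
    have "{k \<in> active p. i = 0 \<or> i = k \<or> i = 1 \<and> 9 \<le> k} = insert 1 (active p \<inter> {9..})"
      using 2 assms by auto
    then show ?thesis unfolding eq using 2 by simp
  next
    case 3
    then have "{k \<in> active p. i = 0 \<or> i = k \<or> i = 1 \<and> 9 \<le> k} = {i}" using assms by auto
    then show ?thesis unfolding eq using 3 by simp
  qed
qed

text \<open>Back substitution: coefficients from 2 on are read off directly, then row 1 gives
  coefficient 1, and row 0 gives coefficient 0.\<close>

lemma leaf_chain_zero:
  assumes "\<And>i. i \<in> active p \<Longrightarrow> evaluate (weight_cochain i) (leaf_chain p a) = 0"
  shows "leaf_chain p a = 0"
proof -
  have ge2: "a k = 0" if "k \<in> active p" "k \<noteq> 0" "k \<noteq> 1" for k
    using assms[OF that(1)] evaluate_leaf_chain[OF that(1), of a] that by simp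
  have 1: "a 1 = 0" if "1 \<in> active p"
  proof -
    have "(\<Sum>k\<in>active p \<inter> {9..}. a k) = 0" using ge2 by (intro sum.neutral) auto
    then show ?thesis using assms[OF that] evaluate_leaf_chain[OF that, of a] by simp
  qed
  have nonzero: "a k = 0" if "k \<in> active p" "k \<noteq> 0" for k
    using ge2[OF that] 1 that by (cases "k = 1") auto
  have "a 0 = 0" if "0 \<in> active p"
  proof -
    have "(\<Sum>k\<in>active p - {0}. a k) = 0" using nonzero by (intro sum.neutral) auto
    then show ?thesis using assms[OF that] evaluate_leaf_chain[OF that, of a] by simp
  qed
  then have "a k = 0" if "k \<in> active p" for k using nonzero[OF that] that by (cases "k = 0") auto
  then show ?thesis unfolding leaf_chain_def by (intro sum.neutral) simp
qed

lemma leaf_chain_solve: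
  fixes t :: "nat \<Rightarrow> 'f::field"
  shows "\<exists>a. \<forall>i\<in>active p. evaluate (weight_cochain i) (leaf_chain p a) = t i"
proof -
  \<comment> \<open>These lines invert the unitriangular matrix: \<open>b\<close> corrects
    coefficient 1 by the pairs 9 to 11, then \<open>a\<close> corrects coefficient 0 by all others.
    The order matters, since row 0 sees the corrected coefficient 1.\<close>
  define b where "b = t(1 := t 1 - (\<Sum>k\<in>active p \<inter> {9..}. t k))"
  define a where "a = b(0 := t 0 - (\<Sum>k\<in>active p - {0}. b k))"
  have "(\<Sum>k\<in>active p \<inter> {9..}. a k) = (\<Sum>k\<in>active p \<inter> {9..}. t k)"
    by (rule sum.cong) (auto simp: a_def b_def)
  moreover have "(\<Sum>k\<in>active p - {0}. a k) = (\<Sum>k\<in>active p - {0}. b k)"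
    by (rule sum.cong) (auto simp: a_def)
  ultimately have "\<forall>i\<in>active p. evaluate (weight_cochain i) (leaf_chain p a) = t i"
    by (auto simp: evaluate_leaf_chain) (auto simp: a_def b_def)
  then show ?thesis by blast
qed

lemma chain_homologous_leaf_chain:
  fixes c :: "(hpoint \<times> hpoint, 'f::field) fchain"
  assumes "p \<in> params" "c \<in> fchains 0 (conf_space p)"
  shows "\<exists>a. c - leaf_chain p a \<in> fboundaries 0 (conf_space p)"
proof -
  let ?S = "hconf (fst p) (snd p)"
  have simplex: "singular_simplex 0 (conf_space p) s" if "s \<in> Poly_Mapping.keys c" for s
    using assms(2) that by (auto simp: fchains_def)
  have "\<exists>k. k \<in> active p \<and> path_component ?S (s simplex_origin) (leaf_config k)" if "s \<in> Poly_Mapping.keys c" for s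
    using reach_leaf_config[of "fst p" "snd p" "s simplex_origin"] assms(1)
      singular_simplex_0_eq_point(2)[OF simplex[OF that]] by (auto simp: active_def)
  then have "\<forall>s\<in>Poly_Mapping.keys c. \<exists>k. k \<in> active p \<and> path_component ?S (s simplex_origin) (leaf_config k)" by blast
  from bchoice[OF this] obtain \<kappa> where \<kappa>: "\<And>s. s \<in> Poly_Mapping.keys c \<Longrightarrow> \<kappa> s \<in> active p"
    "\<And>s. s \<in> Poly_Mapping.keys c \<Longrightarrow> path_component ?S (s simplex_origin) (leaf_config (\<kappa> s))" by blast
  \<comment> \<open>Each 0-simplex is moved along a path to the leaf configuration
    \<open>\<kappa> s\<close>, and the coefficients of simplices with the same destination are
    added.\<close>
  define a where "a k = (\<Sum>s\<in>{s \<in> Poly_Mapping.keys c. \<kappa> s = k}. Poly_Mapping.lookup c s)" for k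
  have single_sum: "Poly_Mapping.single x (\<Sum>s\<in>A. f s) = (\<Sum>s\<in>A. Poly_Mapping.single x (f s))"
    for x and f :: "((nat \<Rightarrow> real) \<Rightarrow> hpoint \<times> hpoint) \<Rightarrow> 'f" and A
    by (induction A rule: infinite_finite_induct) (simp_all add: single_add)
  have "leaf_chain p a = (\<Sum>k\<in>active p. \<Sum>s\<in>{s \<in> Poly_Mapping.keys c. \<kappa> s = k}.
      Poly_Mapping.single (point_simplex (leaf_config (\<kappa> s))) (Poly_Mapping.lookup c s))"
    unfolding leaf_chain_def a_def single_sum by (intro sum.cong) auto
  also have "\<dots> = (\<Sum>s\<in>Poly_Mapping.keys c. Poly_Mapping.single (point_simplex (leaf_config (\<kappa> s))) (Poly_Mapping.lookup c s))"
    by (rule sum.group) (use \<kappa>(1) in auto)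
  finally have leaf: "leaf_chain p a =
      (\<Sum>s\<in>Poly_Mapping.keys c. Poly_Mapping.single (point_simplex (leaf_config (\<kappa> s))) (Poly_Mapping.lookup c s))" .
  have "c - leaf_chain p a = (\<Sum>s\<in>Poly_Mapping.keys c. Poly_Mapping.single s (Poly_Mapping.lookup c s) -
      Poly_Mapping.single (point_simplex (leaf_config (\<kappa> s))) (Poly_Mapping.lookup c s))"
    unfolding leaf sum_subtractf by (simp add: sum_single_lookup)
  also have "\<dots> \<in> fboundaries 0 (conf_space p)"
  proof (rule fboundaries_sum)
    fix s assume s: "s \<in> Poly_Mapping.keys c"
    show "Poly_Mapping.single s (Poly_Mapping.lookup c s) -
        Poly_Mapping.single (point_simplex (leaf_config (\<kappa> s))) (Poly_Mapping.lookup c s) \<in> fboundaries 0 (conf_space p)"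
      using point_difference_boundary[OF \<kappa>(2)[OF s], of "Poly_Mapping.lookup c s"]
        singular_simplex_0_eq_point(1)[OF simplex[OF s]] by simp
  qed
  finally show ?thesis by blast
qed

text \<open>Injectivity of the weights on homology: up to a boundary, \<open>c\<close> is a leaf
  chain with the same weights on the active indices, and triangularity makes that leaf chain
  zero.\<close>

lemma boundary_if_weights_vanish:
  assumes "p \<in> params" "c \<in> fchains 0 (conf_space p)"
    and "\<And>i. i \<in> active p \<Longrightarrow> evaluate (weight_cochain i) c = 0"
  shows "c \<in> fboundaries 0 (conf_space p)"
proof -
  obtain a where a: "c - leaf_chain p a \<in> fboundaries 0 (conf_space p)"
    using chain_homologous_leaf_chain[OF assms(1,2)] by blast
  have "evaluate (weight_cochain i) (leaf_chain p a) = 0" if "i \<in> active p" for i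
    using evaluate_weight_boundary[OF that a] assms(3)[OF that] by (simp add: evaluate_diff)
  then have "leaf_chain p a = 0" by (rule leaf_chain_zero)
  then show ?thesis using a by simp
qed


section \<open>The isomorphism with the interval sum\<close>

definition weight_map :: "param \<Rightarrow> (hpoint \<times> hpoint, 'f::field) fchain set \<Rightarrow> nat \<Rightarrow> 'f" where
  "weight_map p A = (\<lambda>i\<in>{..<length summand_supports}.
     if p \<in> summand_supports ! i then evaluate (weight_cochain i) (SOME c. c \<in> A) else 0)"

text \<open>Active weights vanish on boundaries, so the value does not depend on the representative
  picked by \<open>SOME\<close>.\<close>

lemma weight_map_fclass:
  "weight_map p (fclass 0 (conf_space p) c) =
    (\<lambda>i\<in>{..<12}. if i \<in> active p then evaluate (weight_cochain i) c else 0)"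
proof
  fix i
  let ?d = "SOME d. d \<in> fclass 0 (conf_space p) c"
  have "?d \<in> fclass 0 (conf_space p) c" using someI[of "\<lambda>d. d \<in> fclass 0 (conf_space p) c", OF fclass_self] .
  then have "?d - c \<in> fboundaries 0 (conf_space p)" by (simp add: mem_fclass)
  then have "evaluate (weight_cochain i) ?d = evaluate (weight_cochain i) c" if "i \<in> active p"
    using evaluate_weight_boundary[OF that, of "?d - c"] by (simp add: evaluate_diff)
  then show "weight_map p (fclass 0 (conf_space p) c) i =
      (\<lambda>i\<in>{..<12}. if i \<in> active p then evaluate (weight_cochain i) c else 0) i"
    by (auto simp: weight_map_def active_def)
qed

lemma PH_iso_interval_sum:
  "(PH 0 :: ('f::field, (hpoint \<times> hpoint, 'f) fchain set) pmod) \<simeq>\<^sub>P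
    direct_sum {..<length summand_supports} (\<lambda>i. interval_module (summand_supports ! i))"
proof (rule pmod_isoI)
  let ?M = "PH 0 :: ('f, (hpoint \<times> hpoint, 'f) fchain set) pmod"
  let ?S = "direct_sum {..<length summand_supports} (\<lambda>i. interval_module (summand_supports ! i) :: ('f, 'f) pmod)"
  have carrier_M: "carrier (obj ?M p) = fclass 0 (conf_space p) ` fchains 0 (conf_space p)" for p
    by (simp add: PH_simps fhomology_simps fcycles_0)
  have carrier_S: "x \<in> carrier (obj ?S p) \<longleftrightarrow>
      x \<in> extensional {..<12} \<and> (\<forall>i<12. i \<notin> active p \<longrightarrow> x i = 0)" for x p
    by (auto simp: active_def PiE_def Pi_def split: if_splits)
  have in_S: "weight_map p (fclass 0 (conf_space p) c) \<in> carrier (obj ?S p)" for p and c :: "(hpoint \<times> hpoint, 'f) fchain"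
    unfolding weight_map_fclass carrier_S by auto
  show "pmod_hom ?M ?S weight_map"
  proof (intro pmod_homI linear_mapsI)
    fix p assume p: "p \<in> params"
    fix x assume "x \<in> carrier (obj ?M p)"
    then obtain c where c: "c \<in> fchains 0 (conf_space p)" "x = fclass 0 (conf_space p) c"
      unfolding carrier_M by blast
    show "weight_map p x \<in> carrier (obj ?S p)" unfolding c(2) by (rule in_S)
    show "weight_map p (k \<odot>\<^bsub>obj ?M p\<^esub> x) = k \<odot>\<^bsub>obj ?S p\<^esub> weight_map p x" for k
      unfolding c(2) PH_simps fhomology_simps weight_map_fclass
      by (auto simp: fun_eq_iff evaluate_fscale)
    fix y assume "y \<in> carrier (obj ?M p)"
    then obtain d where d: "d \<in> fchains 0 (conf_space p)" "y = fclass 0 (conf_space p) d"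
      unfolding carrier_M by blast
    show "weight_map p (x \<oplus>\<^bsub>obj ?M p\<^esub> y) = weight_map p x \<oplus>\<^bsub>obj ?S p\<^esub> weight_map p y"
      unfolding c(2) d(2) PH_simps fhomology_simps weight_map_fclass
      by (auto simp: fun_eq_iff evaluate_add)
  next
    fix p q x assume pq: "p \<in> params" "q \<in> params" "p \<preceq> q" and "x \<in> carrier (obj ?M p)"
    then obtain c where c: "c \<in> fchains 0 (conf_space p)" "x = fclass 0 (conf_space p) c"
      unfolding carrier_M by blast
    have mor: "mor ?M p q x = fclass 0 (conf_space q) c"
      unfolding c(2) PH_simps
      by (rule fhom_induced_inclusion[OF hconf_mono[OF pq]]) (simp add: fcycles_0 c(1))
    \<comment> \<open>The one case of naturality that is not formal: coordinate \<open>i\<close> is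
      alive at \<open>q\<close> but not at \<open>p\<close>, so the weight has to be zero at every
      point of the smaller space.\<close>
    have vanish: "evaluate (weight_cochain i) c = 0" if i: "i \<in> active q" "i \<notin> active p" for i
    proof -
      have "weight_cochain i s = (0 :: 'f)" if "s \<in> Poly_Mapping.keys c" for s
      proof -
        have "s simplex_origin \<in> hconf (fst p) (snd p)"
          using c(1) that by (intro singular_simplex_0_eq_point(2)) (auto simp: fchains_def)
        moreover have "p \<notin> summand_supports ! i" using i activeD(1)[OF i(1)] by (simp add: active_def)
        ultimately have "\<not> weight i (s simplex_origin)"
          using support_of_weight[OF activeD(1)[OF i(1)] pq(1,3) activeD(2)[OF i(1)]] by blast
        then show ?thesis by (simp add: weight_cochain_def)
      qed
      then show ?thesis by (simp add: evaluate_def)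
    qed
    show "weight_map q (mor ?M p q x) = mor ?S p q (weight_map p x)"
      unfolding mor unfolding c(2) weight_map_fclass direct_sum_simps
      using vanish by (auto simp: fun_eq_iff active_def)
  qed
  show "bij_betw (weight_map p) (carrier (obj ?M p)) (carrier (obj ?S p))" if p: "p \<in> params" for p
  proof (rule bij_betw_imageI)
    show "inj_on (weight_map p) (carrier (obj ?M p))"
    proof (rule inj_onI)
      fix x y assume "x \<in> carrier (obj ?M p)" "y \<in> carrier (obj ?M p)" and eq: "weight_map p x = weight_map p y"
      then obtain c d where c: "c \<in> fchains 0 (conf_space p)" "x = fclass 0 (conf_space p) c"
        and d: "d \<in> fchains 0 (conf_space p)" "y = fclass 0 (conf_space p) d"
        unfolding carrier_M by blast
      have "evaluate (weight_cochain i) (c - d) = 0" if "i \<in> active p" for i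
        using fun_cong[OF eq, of i] that activeD(1)[OF that] unfolding c(2) d(2) weight_map_fclass
        by (simp add: evaluate_diff)
      moreover have "c - d \<in> fchains 0 (conf_space p)"
        using fchains_closed(2)[OF c(1) fchains_closed(3)[OF d(1), of "- 1"]] by (simp add: fscale_simps)
      ultimately have "c - d \<in> fboundaries 0 (conf_space p)"
        using boundary_if_weights_vanish[OF p] by blast
      then show "x = y" unfolding c(2) d(2) fclass_eq_iff .
    qed
    have "x \<in> weight_map p ` carrier (obj ?M p)" if x: "x \<in> carrier (obj ?S p)" for x
    proof -
      obtain a where a: "\<forall>i\<in>active p. evaluate (weight_cochain i) (leaf_chain p a) = x i"
        using leaf_chain_solve by blast
      have "x = weight_map p (fclass 0 (conf_space p) (leaf_chain p a))"
        using x a unfolding weight_map_fclass carrier_S by (auto simp: fun_eq_iff extensional_def)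
      then show ?thesis unfolding carrier_M using leaf_chain_in_fchains by blast
    qed
    moreover have "weight_map p x \<in> carrier (obj ?S p)" if "x \<in> carrier (obj ?M p)" for x
      using that in_S unfolding carrier_M by blast
    ultimately show "weight_map p ` carrier (obj ?M p) = carrier (obj ?S p)" by blast
  qed
qed

section \<open>Reindexing and assembly of the statement\<close>

lemma pmod_iso_trans:
  assumes "M \<simeq>\<^sub>P N" "N \<simeq>\<^sub>P R"
  shows "M \<simeq>\<^sub>P R"
proof -
  obtain f where f: "pmod_hom M N f"
    "\<And>p. p \<in> params \<Longrightarrow> bij_betw (f p) (carrier (obj M p)) (carrier (obj N p))"
    using assms(1) unfolding pmod_iso_def pmod_hom_def by blast
  obtain g where g: "pmod_hom N R g"
    "\<And>p. p \<in> params \<Longrightarrow> bij_betw (g p) (carrier (obj N p)) (carrier (obj R p))"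
    using assms(2) unfolding pmod_iso_def pmod_hom_def by blast
  show ?thesis
    using bij_betw_trans[OF f(2) g(2)] by (intro pmod_isoI[OF pmod_hom_compose[OF f(1) g(1)]]) (simp add: comp_def)
qed

lemma direct_sum_reindex:
  assumes "finite K" "inj_on e K"
  shows "direct_sum K (\<lambda>k. N (e k)) \<simeq>\<^sub>P direct_sum (e ` K) N"
proof (rule pmod_isoI_inverse)
  let ?d = "inv_into K e"
  have d: "?d (e k) = k" if "k \<in> K" for k using assms(2) that by simp
  have fin: "finite {j \<in> e ` K. P j}" "finite {k \<in> K. Q k}" for P Q using assms(1) by auto
  show "pmod_hom (direct_sum K (\<lambda>k. N (e k))) (direct_sum (e ` K) N) (\<lambda>p x. \<lambda>j\<in>e ` K. x (?d j))"
    by (intro pmod_homI linear_mapsI) (auto simp: d fin fun_eq_iff simp del: finite_Collect_conjI)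
  show "pmod_hom (direct_sum (e ` K) N) (direct_sum K (\<lambda>k. N (e k))) (\<lambda>p y. \<lambda>k\<in>K. y (e k))"
    by (intro pmod_homI linear_mapsI) (auto simp: fin fun_eq_iff)
  show "(\<lambda>k\<in>K. (\<lambda>j\<in>e ` K. x (?d j)) (e k)) = x"
    if "x \<in> carrier (obj (direct_sum K (\<lambda>k. N (e k))) p)" for p x
    using that by (auto simp: d fun_eq_iff PiE_def extensional_def)
  show "(\<lambda>j\<in>e ` K. (\<lambda>k\<in>K. y (e k)) (?d j)) = y"
    if "y \<in> carrier (obj (direct_sum (e ` K) N) p)" for p y
    using that by (auto simp: d fun_eq_iff PiE_def extensional_def)
qed

text \<open>The definition of \<open>interval_decomposable\<close> prescribes indices in
  \<open>param \<times> 'v\<close>. The number \<open>k\<close> is therefore stored as a real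
  coordinate and recovered by rounding down; the vector component is a constant filler.\<close>

lemma interval_decomposableI:
  fixes M :: "('f::field, 'v) pmod" and T :: "nat \<Rightarrow> param set"
  assumes "persistence_module M" "\<And>k. k < n \<Longrightarrow> poset_interval (T k)"
    and "M \<simeq>\<^sub>P direct_sum {..<n} (\<lambda>k. interval_module (T k))"
  shows "interval_decomposable M"
proof -
  define e :: "nat \<Rightarrow> param \<times> 'v" where "e k = ((real k, 0), undefined)" for k
  define U where "U j = T (nat \<lfloor>fst (fst j)\<rfloor>)" for j :: "param \<times> 'v"
  have U: "U (e k) = T k" for k by (simp add: U_def e_def)
  have "inj_on e {..<n}" by (auto simp: inj_on_def e_def)
  then have "direct_sum {..<n} (\<lambda>k. interval_module (U (e k)) :: ('f, 'f) pmod) \<simeq>\<^sub>P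
      direct_sum (e ` {..<n}) (\<lambda>j. interval_module (U j))"
    by (rule direct_sum_reindex[OF finite_lessThan])
  then have "M \<simeq>\<^sub>P direct_sum (e ` {..<n}) (\<lambda>j. interval_module (U j))"
    using pmod_iso_trans[OF assms(3)] by (simp add: U)
  moreover have "\<forall>j\<in>e ` {..<n}. poset_interval (U j)" using assms(2) by (auto simp: U)
  ultimately show ?thesis unfolding interval_decomposable_def using assms(1) by blast
qed

lemma poset_interval_summand_supports: "k < 12 \<Longrightarrow> poset_interval (summand_supports ! k)"
  by (simp add: summand_supports_eq_support poset_interval_support support_class_less)

theorem theorem1p8:
  shows "interval_decomposable (PH 0 :: ('f::field, (hpoint \<times> hpoint, 'f) fchain set) pmod) \<and>
    (\<forall>I \<in> set summand_supports.
       poset_interval I \<and> indecomposable (interval_module I :: ('f, 'f) pmod)) \<and>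
    (PH 0 :: ('f, (hpoint \<times> hpoint, 'f) fchain set) pmod) \<simeq>\<^sub>P
      direct_sum {..<length summand_supports} (\<lambda>i. interval_module (summand_supports ! i)) \<and>
    (\<forall>(J :: 'j set) (N :: 'j \<Rightarrow> ('f, 'v) pmod).
       (\<forall>j\<in>J. indecomposable (N j)) \<and>
       (PH 0 :: ('f, (hpoint \<times> hpoint, 'f) fchain set) pmod) \<simeq>\<^sub>P direct_sum J N \<longrightarrow>
       (\<exists>\<sigma>. bij_betw \<sigma> J {..<length summand_supports} \<and>
            (\<forall>j\<in>J. N j \<simeq>\<^sub>P (interval_module (summand_supports ! \<sigma> j) :: ('f, 'f) pmod))))"
proof (intro conjI ballI allI impI)
  let ?M = "PH 0 :: ('f, (hpoint \<times> hpoint, 'f) fchain set) pmod"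
  let ?S = "direct_sum {..<length summand_supports} (\<lambda>i. interval_module (summand_supports ! i) :: ('f, 'f) pmod)"
  show iso: "?M \<simeq>\<^sub>P ?S" by (rule PH_iso_interval_sum)
  have M: "persistence_module ?M" by (rule persistence_module_PH)
  show "interval_decomposable ?M"
    by (rule interval_decomposableI[OF M _ iso]) (simp add: poset_interval_summand_supports)
  show "poset_interval I" if "I \<in> set summand_supports" for I
    using that poset_interval_summand_supports by (auto simp: in_set_conv_nth)
  then show "indecomposable (interval_module I :: ('f, 'f) pmod)" if "I \<in> set summand_supports" for I
    using that by (intro indecomposable_interval_module)
  fix J :: "'j set" and N :: "'j \<Rightarrow> ('f, 'v) pmod"
  assume N: "(\<forall>j\<in>J. indecomposable (N j)) \<and> ?M \<simeq>\<^sub>P direct_sum J N"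
  obtain f1 g1 where 1: "pmod_hom ?M ?S f1" "pmod_hom ?S ?M g1"
    "\<And>p x. p \<in> params \<Longrightarrow> x \<in> carrier (obj ?M p) \<Longrightarrow> g1 p (f1 p x) = x"
    "\<And>p y. p \<in> params \<Longrightarrow> y \<in> carrier (obj ?S p) \<Longrightarrow> f1 p (g1 p y) = y"
    using pmod_isoE[OF M iso] by blast
  obtain f2 g2 where 2: "pmod_hom ?M (direct_sum J N) f2" "pmod_hom (direct_sum J N) ?M g2"
    "\<And>p x. p \<in> params \<Longrightarrow> x \<in> carrier (obj ?M p) \<Longrightarrow> g2 p (f2 p x) = x"
    "\<And>p y. p \<in> params \<Longrightarrow> y \<in> carrier (obj (direct_sum J N) p) \<Longrightarrow> f2 p (g2 p y) = y"
    using pmod_isoE[OF M conjunct2[OF N]] by blast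
  \<comment> \<open>Both isomorphisms start at \<open>PH 0\<close>, so composing one with the
    inverse of the other gives mutually inverse maps between the interval sum and the sum of the
    \<open>N j\<close>.\<close>
  have "\<exists>\<sigma>. bij_betw \<sigma> J {..<12} \<and>
      (\<forall>j\<in>J. N j \<simeq>\<^sub>P (interval_module (summand_supports ! \<sigma> j) :: ('f, 'f) pmod))"
  proof (rule interval_sum_decomposition_unique)
    show "indecomposable (N j)" if "j \<in> J" for j using N that by blast
    show "pmod_hom (direct_sum {..<12} (\<lambda>i. interval_module (summand_supports ! i))) (direct_sum J N)
        (\<lambda>p x. f2 p (g1 p x))"
      using pmod_hom_compose[OF 1(2) 2(1)] by simp
    show "pmod_hom (direct_sum J N) (direct_sum {..<12} (\<lambda>i. interval_module (summand_supports ! i)))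
        (\<lambda>p y. f1 p (g2 p y))"
      using pmod_hom_compose[OF 2(2) 1(1)] by simp
    show "f1 p (g2 p (f2 p (g1 p x))) = x"
      if "p \<in> params" "x \<in> carrier (obj (direct_sum {..<12} (\<lambda>i. interval_module (summand_supports ! i) :: ('f, 'f) pmod)) p)" for p x
      using 1(4)[OF that(1)] 2(3)[OF that(1) pmod_homD(2)[OF 1(2) that(1)]] that(2)
      unfolding length_summand_supports by simp
    show "f2 p (g1 p (f1 p (g2 p y))) = y" if "p \<in> params" "y \<in> carrier (obj (direct_sum J N) p)" for p y
      using 2(4)[OF that] 1(3)[OF that(1) pmod_homD(2)[OF 2(2) that]] by simp
  qed
  then show "\<exists>\<sigma>. bij_betw \<sigma> J {..<length summand_supports} \<and>
      (\<forall>j\<in>J. N j \<simeq>\<^sub>P (interval_module (summand_supports ! \<sigma> j) :: ('f, 'f) pmod))"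
    by simp
qed

end
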